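(* Let $n\ge 2$ and let $\Gamma$ be a non-uniform torsion-free lattice in $\mathrm{PU}(n,1)$ for which the quotient space $\mathbb{H}^n_{\mathbb{C}}/\Gamma$ admits a toroidal compactification $X_\Gamma$. Then there is no Kähler metric with nonpositive sectional curvature on $X_\Gamma$.
   Context: Complex hyperbolic space $\mathbb{H}^n_{\mathbb{C}}$ is the open subset of $\mathbb{CP}^n$ of negative lines for a Hermitian form $\langle\cdot,\cdot\rangle$ of signature $(n,1)$ on $\mathbb{C}^{n+1}$; its boundary $\partial\mathbb{H}^n_{\mathbb{C}}$ consists of isotropic lines; $\mathrm{PU}(n,1)$ is its group of holomorphic isometries. A lattice $\Gamma<\mathrm{PU}(n,1)$ is non-uniform if $\mathbb{H}^n_{\mathbb{C}}/\Gamma$ has finite volume but is not compact. Heisenberg group and horoballs. For $\xi\in\partial\mathbb{H}^n_{\mathbb{C}}$ let $N_\xi$ be the unipotent radical of the stabiliser of $\xi$ in $\mathrm{PU}(n,1)$. Choose isotropic vectors $f_1,f_2$ with $[f_1]=\xi$ and $\langle f_1,f_2\rangle=1$, and identify $(\mathbb{C}f_1\oplus\mathbb{C}f_2)^\perp$ with $\mathbb{C}^{n-1}$ with its standard Hermitian product. The map $(a,w)\mapsto[af_1+f_2+w]$ identifies $\{(a,w)\in\mathbb{C}\times\mathbb{C}^{n-1}: 2\Re(a)+\|w\|^2<0\}$ with $\mathbb{H}^n_{\mathbb{C}}$, and $N_\xi=\{n_{(s,v)}: s\in\mathbb{R},v\in\mathbb{C}^{n-1}\}$ acts by $n_{(s,v)}(a,w)=(a-\tfrac{\|v\|^2}{2}-is-{}^t\bar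 v\,w,\;w+v)$. The horoballs centered at $\xi$ are the sets $\{\Re(a)<-\tfrac{\|w\|^2}{2}-c\}$, $c>0$. Let $\rho:N_\xi\to\mathbb{C}^{n-1}$, $n_{(s,v)}\mapsto v$. Toroidal compactification. $\mathbb{H}^n_{\mathbb{C}}/\Gamma$ is said to admit a toroidal compactification if $\Gamma$ is a non-uniform torsion-free lattice all of whose parabolic elements are unipotent. Then $\mathbb{H}^n_{\mathbb{C}}/\Gamma$ is the union of a compact set and finitely many disjoint cusps of the form $H/\Lambda$, with $H$ a horoball (with parameter $c$) centered at a point $\xi$ fixed by a parabolic element of $\Gamma$, and $\Lambda=\mathrm{Stab}_\Gamma(\xi)=\Gamma\cap N_\xi$ a lattice in $N_\xi$. The group $\Lambda\cap[N_\xi,N_\xi]$ is generated by some $n_{(l,0)}$, $l>0$; the map $(a,w)\mapsto(e^{2\pi a/l},w)$ identifies $H/\langle n_{(l,0)}\rangle$ with $\{(b,w): 0<|b|<e^{-2\pi c/l}e^{-\pi\|w\|^2/l}\}$; the induced action of $\Lambda$ extends to $\mathbb{C}\times\mathbb{C}^{n-1}$ by $n_{(s,v)}(b,w)=\big(\exp(\tfrac{2\pi}{l}(-\tfrac{\|v\|^2}{2}-is-{}^t\bar v\,w))\,b,\;w+v\big)$, and the quotient is a holomorphic line bundle $L$ over the complex torus $T=\mathbb{C}^{n-1}/\rho(\Lambda)$, in which $H/\Lambda$ is a punctured disk bundle. $X_\Gamma$ is the compact complex manifold obtained by adding to each cusp the zero section $T$ of the corresponding bundle. The added complex tori are the boundary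 tori, i.e. the connected components of $X_\Gamma\setminus(\mathbb{H}^n_{\mathbb{C}}/\Gamma)$. *)

theory Defs
  imports "HOL-Analysis.Analysis" "HOL-Algebra.Coset"
begin

section \<open>Quotient topologies and smooth functions\<close>

definition quotient_topology :: "'a topology \<Rightarrow> ('a \<Rightarrow> 'b) \<Rightarrow> 'b topology" where
  "quotient_topology X f =
     topology (\<lambda>S. S \<subseteq> f ` topspace X \<and> openin X {x \<in> topspace X. f x \<in> S})"

lemma openin_quotient_topology:
  "openin (quotient_topology X f) S \<longleftrightarrow>
     S \<subseteq> f ` topspace X \<and> openin X {x \<in> topspace X. f x \<in> S}"
proof -
  have "istopology (\<lambda>S. S \<subseteq> f ` topspace X \<and> openin X {x \<in> topspace X. f x \<in> S})"
    unfolding istopology_def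
  proof (intro conjI allI impI)
    fix S T
    assume S: "S \<subseteq> f ` topspace X \<and> openin X {x \<in> topspace X. f x \<in> S}"
      and T: "T \<subseteq> f ` topspace X \<and> openin X {x \<in> topspace X. f x \<in> T}"
    show "S \<inter> T \<subseteq> f ` topspace X" using S by blast
    have "{x \<in> topspace X. f x \<in> S \<inter> T} =
        {x \<in> topspace X. f x \<in> S} \<inter> {x \<in> topspace X. f x \<in> T}" by blast
    then show "openin X {x \<in> topspace X. f x \<in> S \<inter> T}" using S T by auto
  next
    fix K
    assume K: "\<forall>S\<in>K. S \<subseteq> f ` topspace X \<and> openin X {x \<in> topspace X. f x \<in> S}"
    show "\<Union>K \<subseteq> f ` topspace X" using K by blast
    have "{x \<in> topspace X. f x \<in> \<Union>K} = (\<Union>S\<in>K. {x \<in> topspace X. f x \<in> S})" by blast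
    then show "openin X {x \<in> topspace X. f x \<in> \<Union>K}" using K by auto
  qed
  then show ?thesis unfolding quotient_topology_def by simp
qed

text \<open>For open \<open>S\<close>, \<open>Ck_on k f S\<close> says that \<open>f\<close> is \<open>k\<close> times continuously differentiable on \<open>S\<close>.\<close>

primrec Ck_on :: "nat \<Rightarrow> ('e::euclidean_space \<Rightarrow> real) \<Rightarrow> 'e set \<Rightarrow> bool" where
  "Ck_on 0 f S \<longleftrightarrow> continuous_on S f"
| "Ck_on (Suc k) f S \<longleftrightarrow>
     (\<forall>x\<in>S. f differentiable (at x)) \<and>
     (\<forall>u. Ck_on k (\<lambda>x. frechet_derivative f (at x) u) S)"

definition smooth_on :: "('e::euclidean_space \<Rightarrow> real) \<Rightarrow> 'e set \<Rightarrow> bool" where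
  "smooth_on f S \<longleftrightarrow> (\<forall>k. Ck_on k f S)"


section \<open>Riemannian and Kaehler metrics on a manifold given by local parametrizations\<close>

text \<open>
  A chart is a pair \<open>(W, \<psi>)\<close> of an open set \<open>W\<close> of a Euclidean space and an injective
  parametrization \<open>\<psi>\<close> of a part \<open>\<psi> ` W\<close> of the manifold (so \<open>\<psi>\<close> is the inverse of a coordinate
  map). A manifold is represented by its set of charts \<open>\<A>\<close>; its points are the points of the
  images \<open>\<psi> ` W\<close>, and a set \<open>S\<close> of points is open iff \<open>{x \<in> W. \<psi> x \<in> S}\<close> is open for every chart.
\<close>

type_synonym ('e, 'p) chart = "'e set \<times> ('e \<Rightarrow> 'p)"

text \<open>\<open>g x u v\<close> is the inner product of the tangent vectors \<open>u\<close>, \<open>v\<close> at \<open>x\<close>.\<close>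

type_synonym 'e metric_tensor = "'e \<Rightarrow> 'e \<Rightarrow> 'e \<Rightarrow> real"

text \<open>The Levi-Civita connection in coordinates: \<open>christoffel g x u v\<close> is the covariant derivative
  at \<open>x\<close>, in direction \<open>u\<close>, of the constant vector field \<open>v\<close>, given by the Koszul formula.\<close>

definition christoffel :: "'e::euclidean_space metric_tensor \<Rightarrow> 'e \<Rightarrow> 'e \<Rightarrow> 'e \<Rightarrow> 'e" where
  "christoffel g x u v =
     (THE k. \<forall>w. 2 * g x k w =
        frechet_derivative (\<lambda>y. g y v w) (at x) u
        + frechet_derivative (\<lambda>y. g y u w) (at x) v
        - frechet_derivative (\<lambda>y. g y u v) (at x) w)"

text \<open>\<open>R(u,v)w = \<nabla>\<^sub>u\<nabla>\<^sub>v w - \<nabla>\<^sub>v\<nabla>\<^sub>u w\<close> for constant vector fields \<open>u\<close>, \<open>v\<close>, \<open>w\<close>.\<close>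

definition curvature_tensor ::
  "'e::euclidean_space metric_tensor \<Rightarrow> 'e \<Rightarrow> 'e \<Rightarrow> 'e \<Rightarrow> 'e \<Rightarrow> 'e" where
  "curvature_tensor g x u v w =
     frechet_derivative (\<lambda>y. christoffel g y v w) (at x) u
     - frechet_derivative (\<lambda>y. christoffel g y u w) (at x) v
     + christoffel g x u (christoffel g x v w)
     - christoffel g x v (christoffel g x u w)"

definition sectional_curvature ::
  "'e::euclidean_space metric_tensor \<Rightarrow> 'e \<Rightarrow> 'e \<Rightarrow> 'e \<Rightarrow> real" where
  "sectional_curvature g x u v =
     g x (curvature_tensor g x u v v) u / (g x u u * g x v v - (g x u v)\<^sup>2)"

definition riemannian_metric ::
  "('e::euclidean_space, 'p) chart set \<Rightarrow> (('e, 'p) chart \<Rightarrow> 'e metric_tensor) \<Rightarrow> bool" where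
  "riemannian_metric \<A> G \<longleftrightarrow>
     (\<forall>(W, \<psi>)\<in>\<A>.
        (\<forall>u v. smooth_on (\<lambda>x. G (W, \<psi>) x u v) W) \<and>
        (\<forall>x\<in>W. bilinear (G (W, \<psi>) x) \<and>
           (\<forall>u v. G (W, \<psi>) x u v = G (W, \<psi>) x v u) \<and>
           (\<forall>u. u \<noteq> 0 \<longrightarrow> G (W, \<psi>) x u u > 0))) \<and>
     (\<forall>(W, \<psi>)\<in>\<A>. \<forall>(W', \<psi>')\<in>\<A>. \<forall>x\<in>W. \<psi> x \<in> \<psi>' ` W' \<longrightarrow>
        (let \<tau> = inv_into W' \<psi>' \<circ> \<psi>; D = frechet_derivative \<tau> (at x)
         in \<forall>u v. G (W, \<psi>) x u v = G (W', \<psi>') (\<tau> x) (D u) (D v)))"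

definition nonpositive_sectional_curvature ::
  "('e::euclidean_space, 'p) chart set \<Rightarrow> (('e, 'p) chart \<Rightarrow> 'e metric_tensor) \<Rightarrow> bool" where
  "nonpositive_sectional_curvature \<A> G \<longleftrightarrow>
     (\<forall>(W, \<psi>)\<in>\<A>. \<forall>x\<in>W. \<forall>u v. u \<noteq> v \<and> independent {u, v} \<longrightarrow>
        sectional_curvature (G (W, \<psi>)) x u v \<le> 0)"

text \<open>A Kaehler metric on a complex manifold (charts in \<open>\<complex>\<^sup>n\<close>): a Riemannian metric for which
  multiplication by \<open>\<i>\<close> is an isometry and whose fundamental 2-form is closed.\<close>

definition fundamental_form ::
  "(complex^'n) metric_tensor \<Rightarrow> complex^'n \<Rightarrow> complex^'n \<Rightarrow> complex^'n \<Rightarrow> real" where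
  "fundamental_form g x u v = g x (\<i> *s u) v"

definition closed_2form_on ::
  "'e::euclidean_space set \<Rightarrow> ('e \<Rightarrow> 'e \<Rightarrow> 'e \<Rightarrow> real) \<Rightarrow> bool" where
  "closed_2form_on W \<omega> \<longleftrightarrow>
     (\<forall>x\<in>W. \<forall>u v w.
        frechet_derivative (\<lambda>y. \<omega> y v w) (at x) u
        - frechet_derivative (\<lambda>y. \<omega> y u w) (at x) v
        + frechet_derivative (\<lambda>y. \<omega> y u v) (at x) w = 0)"

definition kaehler_metric ::
  "(complex^'n, 'p) chart set \<Rightarrow> ((complex^'n, 'p) chart \<Rightarrow> (complex^'n) metric_tensor) \<Rightarrow> bool"
  where
  "kaehler_metric \<A> G \<longleftrightarrow>
     riemannian_metric \<A> G \<and>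
     (\<forall>(W, \<psi>)\<in>\<A>.
        (\<forall>x\<in>W. \<forall>u v. G (W, \<psi>) x (\<i> *s u) (\<i> *s v) = G (W, \<psi>) x u v) \<and>
        closed_2form_on W (fundamental_form (G (W, \<psi>))))"


section \<open>Complex hyperbolic space\<close>

text \<open>
  Throughout, \<open>\<complex>\<^bsup>n-1\<^esup>\<close> is \<open>complex^'m\<close>, so \<open>n = CARD('m) + 1 \<ge> 2\<close>; accordingly \<open>\<complex>\<^sup>n\<close> is
  \<open>complex^('m option)\<close>, a pair \<open>(a, w)\<close> in \<open>\<complex> \<times> \<complex>\<^bsup>n-1\<^esup>\<close> having \<open>a\<close> at index \<open>None\<close> and \<open>w\<close> at the
  indices \<open>Some i\<close>; and \<open>\<complex>\<^bsup>n+1\<^esup>\<close> is \<open>complex^('m option option)\<close>, the vector \<open>a f\<^sub>1 + b f\<^sub>2 + w\<close> having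
  \<open>b\<close> at index \<open>None\<close> and \<open>(a, w)\<close> at the indices \<open>Some j\<close>.
\<close>

type_synonym 'm Cn = "complex^('m option)"
type_synonym 'm vec_n1 = "complex^('m option option)"
type_synonym 'm mat_n1 = "complex^('m option option)^('m option option)"
type_synonym 'm line = "'m vec_n1 set"
type_synonym 'm pu = "'m mat_n1 set"

definition pair :: "complex \<Rightarrow> complex^'m \<Rightarrow> 'm::finite Cn" where
  "pair a w = (\<chi> k. case k of None \<Rightarrow> a | Some i \<Rightarrow> w $ i)"

definition tail :: "'m::finite Cn \<Rightarrow> complex^'m" where
  "tail z = (\<chi> i. z $ Some i)"

definition lift :: "'m::finite Cn \<Rightarrow> 'm vec_n1" where
  "lift z = (\<chi> k. case k of None \<Rightarrow> 1 | Some j \<Rightarrow> z $ j)"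

text \<open>The Hermitian form: \<open>f\<^sub>1\<close>, \<open>f\<^sub>2\<close> are isotropic with product 1 and span a hyperbolic plane
  (signature (1,1)), whose orthogonal complement is \<open>\<complex>\<^bsup>n-1\<^esup>\<close> with its standard product. The
  signature is \<open>(n,1)\<close>.\<close>

definition herm :: "'m::finite vec_n1 \<Rightarrow> 'm vec_n1 \<Rightarrow> complex" where
  "herm x y = x $ Some None * cnj (y $ None) + x $ None * cnj (y $ Some None)
              + (\<Sum>i\<in>UNIV. x $ Some (Some i) * cnj (y $ Some (Some i)))"

definition line :: "'m::finite vec_n1 \<Rightarrow> 'm line" where
  "line v = range (\<lambda>c. c *s v)"

definition proj_top :: "'m::finite line topology" where
  "proj_top = quotient_topology (top_of_set (- {0})) line"

definition CH :: "'m::finite line set" where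
  "CH = {line v |v. Re (herm v v) < 0}"

definition CH_boundary :: "'m::finite line set" where
  "CH_boundary = {line v |v. v \<noteq> 0 \<and> herm v v = 0}"


section \<open>The group PU(n,1) and its lattices\<close>

definition U_n1 :: "'m::finite mat_n1 monoid" where
  "U_n1 = \<lparr>carrier = {A. \<forall>x y. herm (A *v x) (A *v y) = herm x y}, monoid.mult = (**), one = mat 1\<rparr>"

definition U_scalars :: "'m::finite mat_n1 set" where
  "U_scalars = {mat c |c. cmod c = 1}"

definition PU :: "'m::finite pu monoid" where
  "PU = U_n1 Mod U_scalars"

definition PU_top :: "'m::finite pu topology" where
  "PU_top = quotient_topology (top_of_set (carrier U_n1)) (\<lambda>A. U_scalars #>\<^bsub>U_n1\<^esub> A)"

text \<open>All the representatives of \<open>g\<close> map a line onto one and the same line.\<close>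

definition act :: "'m::finite pu \<Rightarrow> 'm line \<Rightarrow> 'm line" where
  "act g L = (\<Union>A\<in>g. (*v) A ` L)"

definition orbit :: "'m::finite pu set \<Rightarrow> 'm line \<Rightarrow> 'm line set" where
  "orbit \<Gamma> L = (\<lambda>g. act g L) ` \<Gamma>"

definition CH_quotient :: "'m::finite pu set \<Rightarrow> 'm line set topology" where
  "CH_quotient \<Gamma> = quotient_topology (subtopology proj_top CH) (orbit \<Gamma>)"

text \<open>Affine coordinates identify \<open>CH\<close> with the Siegel domain
  \<open>{(a, w). 2 Re a + \<parallel>w\<parallel>\<^sup>2 < 0}\<close>.\<close>

definition siegel :: "'m::finite Cn set" where
  "siegel = {z. 2 * Re (z $ None) + (norm (tail z))\<^sup>2 < 0}"

text \<open>The volume form of complex hyperbolic space is, up to a constant factor,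
  \<open>(-2 Re a - \<parallel>w\<parallel>\<^sup>2)\<^bsup>-(n+1)\<^esup>\<close> times Lebesgue measure.\<close>

definition siegel_volume :: "'m::finite Cn set \<Rightarrow> ennreal" where
  "siegel_volume F =
     (\<integral>\<^sup>+z\<in>F. ennreal (1 / (- 2 * Re (z $ None) - (norm (tail z))\<^sup>2) ^ (CARD('m) + 2)) \<partial>lborel)"

text \<open>The volume of the quotient is the volume of a Borel set of orbit representatives.\<close>

definition finite_covolume :: "'m::finite pu set \<Rightarrow> bool" where
  "finite_covolume \<Gamma> \<longleftrightarrow>
     (\<exists>F. F \<in> sets borel \<and> F \<subseteq> siegel \<and> siegel_volume F < \<infinity> \<and>
          (\<forall>L\<in>CH. \<exists>!z. z \<in> F \<and> line (lift z) \<in> orbit \<Gamma> L))"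

definition lattice_PU :: "'m::finite pu set \<Rightarrow> bool" where
  "lattice_PU \<Gamma> \<longleftrightarrow>
     subgroup \<Gamma> PU \<and> subtopology PU_top \<Gamma> = discrete_topology \<Gamma> \<and> finite_covolume \<Gamma>"

definition nonuniform_lattice :: "'m::finite pu set \<Rightarrow> bool" where
  "nonuniform_lattice \<Gamma> \<longleftrightarrow> lattice_PU \<Gamma> \<and> \<not> compact_space (CH_quotient \<Gamma>)"

definition torsion_free :: "'m::finite pu set \<Rightarrow> bool" where
  "torsion_free \<Gamma> \<longleftrightarrow> (\<forall>g\<in>\<Gamma>. \<forall>k::nat. k > 0 \<and> g [^]\<^bsub>PU\<^esub> k = \<one>\<^bsub>PU\<^esub> \<longrightarrow> g = \<one>\<^bsub>PU\<^esub>)"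

definition parabolic :: "'m::finite pu \<Rightarrow> bool" where
  "parabolic g \<longleftrightarrow>
     g \<in> carrier PU \<and> (\<forall>L\<in>CH. act g L \<noteq> L) \<and> (\<exists>!\<xi>. \<xi> \<in> CH_boundary \<and> act g \<xi> = \<xi>)"

text \<open>An element of PU(n,1) is unipotent if it has a representative \<open>A\<close> in U(n,1) with \<open>A - 1\<close>
  nilpotent.\<close>

definition unipotent :: "'m::finite pu \<Rightarrow> bool" where
  "unipotent g \<longleftrightarrow>
     g \<in> carrier PU \<and> (\<exists>A\<in>g. \<exists>k. \<forall>x. (((*v) (A - mat 1)) ^^ k) x = 0)"

definition admits_toroidal_compactification :: "'m::finite pu set \<Rightarrow> bool" where
  "admits_toroidal_compactification \<Gamma> \<longleftrightarrow>
     nonuniform_lattice \<Gamma> \<and> torsion_free \<Gamma> \<and> (\<forall>g\<in>\<Gamma>. parabolic g \<longrightarrow> unipotent g)"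


section \<open>Cusps\<close>

text \<open>A choice of \<open>\<xi>\<close>, of isotropic vectors \<open>f\<^sub>1 \<in> \<xi>\<close> and \<open>f\<^sub>2\<close> with product 1, and of an isometry
  of the orthogonal complement of their span with \<open>\<complex>\<^bsup>n-1\<^esup>\<close> is the same thing as an element of
  U(n,1), namely the matrix \<open>A\<close> mapping the standard basis to the chosen one.\<close>

definition frame_pt :: "'m::finite mat_n1 \<Rightarrow> 'm Cn \<Rightarrow> 'm line" where
  "frame_pt A z = line (A *v lift z)"

definition cusp_pt :: "'m::finite mat_n1 \<Rightarrow> 'm line" where
  "cusp_pt A = line (A *v axis (Some None) 1)"

definition horoball :: "'m::finite mat_n1 \<Rightarrow> real \<Rightarrow> 'm line set" where
  "horoball A c = {frame_pt A z |z. Re (z $ None) < - (norm (tail z))\<^sup>2 / 2 - c}"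

text \<open>The product \<open>\<^sup>t\<close>conj\<open>(v) w\<close>.\<close>

definition std_herm :: "complex^'m \<Rightarrow> complex^'m \<Rightarrow> complex" where
  "std_herm v w = (\<Sum>i\<in>UNIV. cnj (v $ i) * w $ i)"

definition heis :: "real \<Rightarrow> complex^'m \<Rightarrow> 'm::finite Cn \<Rightarrow> 'm Cn" where
  "heis s v z =
     pair (z $ None - of_real ((norm v)\<^sup>2 / 2) - \<i> * of_real s - std_herm v (tail z)) (tail z + v)"

text \<open>The parameters \<open>(s, v)\<close> of the elements \<open>n\<^bsub>(s,v)\<^esub>\<close> of \<open>\<Gamma> \<inter> N\<^sub>\<xi>\<close>.\<close>

definition cusp_group :: "'m::finite pu set \<Rightarrow> 'm mat_n1 \<Rightarrow> (real \<times> (complex^'m)) set" where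
  "cusp_group \<Gamma> A =
     {(s, v). \<exists>g\<in>\<Gamma>. \<forall>z\<in>siegel. act g (frame_pt A z) = frame_pt A (heis s v z)}"

text \<open>The commutator subgroup of \<open>N\<^sub>\<xi>\<close> consists of the \<open>n\<^bsub>(s,0)\<^esub>\<close>.\<close>

definition central_period :: "'m::finite pu set \<Rightarrow> 'm mat_n1 \<Rightarrow> real" where
  "central_period \<Gamma> A =
     (THE l. l > 0 \<and> {s. (s, 0) \<in> cusp_group \<Gamma> A} = range (\<lambda>k::int. of_int k * l))"

text \<open>\<open>C\<close> is a finite set of frames, one for each cusp, and \<open>c\<close> assigns to each a horoball parameter,
  such that the quotient is the union of a compact set and the pairwise disjoint cusps
  \<open>H / Stab\<^sub>\<Gamma>(\<xi>)\<close>. The penultimate condition says that these embed and are pairwise disjoint.\<close>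

definition cusp_decomposition ::
  "'m::finite pu set \<Rightarrow> 'm mat_n1 set \<Rightarrow> ('m mat_n1 \<Rightarrow> real) \<Rightarrow> bool" where
  "cusp_decomposition \<Gamma> C c \<longleftrightarrow>
     finite C \<and> C \<subseteq> carrier U_n1 \<and>
     (\<forall>A\<in>C. c A > 0 \<and> (\<exists>g\<in>\<Gamma>. parabolic g \<and> act g (cusp_pt A) = cusp_pt A)) \<and>
     (\<forall>A\<in>C. \<forall>B\<in>C. \<forall>g\<in>\<Gamma>. act g ` horoball A (c A) \<inter> horoball B (c B) \<noteq> {} \<longrightarrow>
        A = B \<and> act g (cusp_pt A) = cusp_pt A) \<and>
     (\<exists>K. compactin (CH_quotient \<Gamma>) K \<and>
          topspace (CH_quotient \<Gamma>) = K \<union> (\<Union>A\<in>C. orbit \<Gamma> ` horoball A (c A)))"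


section \<open>The toroidal compactification\<close>

text \<open>A point is either a point of \<open>CH / \<Gamma>\<close>, or a point of the boundary torus
  \<open>\<complex>\<^bsup>n-1\<^esup> / \<rho>(\<Lambda>)\<close> of the cusp with frame \<open>A\<close>, labelled by \<open>A\<close>.\<close>

type_synonym 'm toroidal_pt = "'m line set + 'm mat_n1 \<times> (complex^'m) set"

definition interior_param :: "'m::finite pu set \<Rightarrow> 'm Cn \<Rightarrow> 'm toroidal_pt" where
  "interior_param \<Gamma> z = Inl (orbit \<Gamma> (line (lift z)))"

definition torus_pt :: "'m::finite pu set \<Rightarrow> 'm mat_n1 \<Rightarrow> complex^'m \<Rightarrow> (complex^'m) set" where
  "torus_pt \<Gamma> A w = (\<lambda>(s, v). w + v) ` cusp_group \<Gamma> A"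

definition disk_domain :: "'m::finite pu set \<Rightarrow> 'm mat_n1 \<Rightarrow> real \<Rightarrow> 'm Cn set" where
  "disk_domain \<Gamma> A c =
     (let l = central_period \<Gamma> A
      in {z. cmod (z $ None) < exp (- 2 * pi * c / l) * exp (- pi * (norm (tail z))\<^sup>2 / l)})"

text \<open>The quotient map from \<open>disk_domain\<close> to the disk bundle over the torus, in the coordinates
  \<open>(b, w)\<close>. For \<open>b \<noteq> 0\<close>, the value \<open>a = (l / 2\<pi>) Ln b\<close> is one of the solutions of
  \<open>b = exp (2\<pi>a / l)\<close>; they all give the same orbit.\<close>

definition cusp_param :: "'m::finite pu set \<Rightarrow> 'm mat_n1 \<Rightarrow> 'm Cn \<Rightarrow> 'm toroidal_pt" where
  "cusp_param \<Gamma> A z =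
     (if z $ None = 0 then Inr (A, torus_pt \<Gamma> A (tail z))
      else Inl (orbit \<Gamma>
        (frame_pt A (pair (of_real (central_period \<Gamma> A / (2 * pi)) * Ln (z $ None)) (tail z)))))"

text \<open>The complex manifold \<open>X\<^sub>\<Gamma>\<close>, given by all restrictions of these maps to open sets on which they
  are injective.\<close>

definition toroidal_compactification ::
  "'m::finite pu set \<Rightarrow> 'm mat_n1 set \<Rightarrow> ('m mat_n1 \<Rightarrow> real) \<Rightarrow> ('m Cn, 'm toroidal_pt) chart set"
  where
  "toroidal_compactification \<Gamma> C c =
     {(W, interior_param \<Gamma>) |W. open W \<and> W \<subseteq> siegel \<and> inj_on (interior_param \<Gamma>) W} \<union>
     {(W, cusp_param \<Gamma> A) |W A. A \<in> C \<and> open W \<and> W \<subseteq> disk_domain \<Gamma> A (c A) \<and>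
        inj_on (cusp_param \<Gamma> A) W}"

end

theory Submission
  imports Defs
begin

text \<open>
  Let \<open>\<xi>\<close> be one of the cusps, which exist as the quotient is not compact. Near its boundary torus, the
  manifold is the quotient of a neighbourhood of the hyperplane \<open>b = 0\<close>, in the coordinates \<open>(b, w)\<close>,
  by a lattice \<open>\<Lambda>\<close> of the Heisenberg group. A Kaehler metric of nonpositive curvature pulls back to a
  \<open>\<Lambda>\<close>-invariant one there. Along the torus, three facts conflict.

  First, the torus has constant holomorphic vector fields \<open>u\<close>. In nonpositive curvature \<open>ln |u|\<^sup>2\<close> is
  subharmonic, and the only subharmonic functions on a torus are constants; so the holomorphic
  sectional curvature of \<open>u\<close> would have to vanish. Second, the sectional curvature of the plane
  spanned by \<open>u + q n\<close> and \<open>J (u - q n)\<close> only involves the curvatures \<open>R(u, J u)\<close> and \<open>R(n, J n)\<close>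
  (\<open>curvature_skew_plane\<close>), and for small \<open>q\<close> its sign forces the bisectional curvature of \<open>u\<close> and \<open>n\<close>
  to vanish with the holomorphic sectional curvature of \<open>u\<close>. Third, the normal bundle is not flat: \<open>\<Lambda>\<close>
  acts on it by the factors of a theta function, so that invariant squared lengths of the constant
  normal vector grow like \<open>exp (2 \<pi> |w|\<^sup>2 / l)\<close>.

  The integration over the torus hidden in this argument is avoided by looking at one point. The
  logarithm of the length of a normal vector, corrected by \<open>- 2 \<pi> |w|\<^sup>2 / l\<close> and by a large negative
  multiple \<open>- \<mu> ln |u|\<^sup>2\<close>, is \<open>\<Lambda>\<close>-invariant and has a minimum. The Laplacian there is nonnegative, which
  makes the mixed curvature large both absolutely and in terms of the curvature of \<open>u\<close>
  (\<open>bisec_bound_at_min\<close>); this contradicts a quantitative form of the second fact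
  (\<open>mixed_curvature_bound\<close>). The result is \<open>no_theta_periodic_metric\<close>.

  What has to be known about the group is that the translation parts of \<open>\<Lambda>\<close> are cocompact and discrete
  in \<open>\<complex>\<^bsup>n-1\<^esup>\<close>, that the centre of \<open>\<Lambda>\<close> is infinite cyclic, and that the elements of \<open>\<Gamma>\<close> fixing \<open>\<xi>\<close>
  are Heisenberg translations. For the last point, an element scaling the horoballs would contract a
  translation to the identity (\<open>no_contraction\<close>), and an element that fixes a point of the complex
  hyperbolic space has finite order; all the others are parabolic and by assumption unipotent.
  Cocompactness comes from the compactness of the complement of the cusps: the points of a horosphere
  can be moved into a compact set, and two of the movements differ by an element fixing \<open>\<xi>\<close>
  (\<open>translations_cocompact\<close>).
\<close>

section \<open>The Hermitian form and the group U(n,1)\<close>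

text \<open>The coordinates of the vector \<open>a f\<^sub>1 + b f\<^sub>2 + w\<close>.\<close>

abbreviation ca :: "'m::finite vec_n1 \<Rightarrow> complex" where "ca x \<equiv> x $ Some None"
abbreviation cb :: "'m::finite vec_n1 \<Rightarrow> complex" where "cb x \<equiv> x $ None"
definition cw :: "'m::finite vec_n1 \<Rightarrow> complex^'m" where "cw x = (\<chi> i. x $ Some (Some i))"

definition vec3 :: "complex \<Rightarrow> complex \<Rightarrow> complex^'m \<Rightarrow> 'm::finite vec_n1" where
  "vec3 b a w = (\<chi> k. case k of None \<Rightarrow> b | Some None \<Rightarrow> a | Some (Some i) \<Rightarrow> w $ i)"

lemma vec3_simps [simp]: "cb (vec3 b a w) = b" "ca (vec3 b a w) = a" "cw (vec3 b a w) = w"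
  by (simp_all add: vec3_def cw_def)

lemma vec_n1_eq_iff: "x = y \<longleftrightarrow> cb x = cb y \<and> ca x = ca y \<and> cw x = cw y"
proof -
  have "(\<forall>k. x $ k = y $ k) \<longleftrightarrow> cb x = cb y \<and> (\<forall>j. x $ Some j = y $ Some j)"
    by (metis not_None_eq)
  also have "(\<forall>j. x $ Some j = y $ Some j) \<longleftrightarrow> ca x = ca y \<and> (\<forall>i. x $ Some (Some i) = y $ Some (Some i))"
    by (metis not_None_eq)
  finally show ?thesis by (simp add: vec_eq_iff cw_def)
qed

lemma cw_simps [simp]:
  "cw (x + y) = cw x + cw y" "cw (x - y) = cw x - cw y" "cw (- x) = - cw x"
  "cw (c *s x) = c *s cw x" "cw 0 = 0"
  by (simp_all add: cw_def vec_eq_iff)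

abbreviation f1 :: "'m::finite vec_n1" where "f1 \<equiv> axis (Some None) 1"
abbreviation f2 :: "'m::finite vec_n1" where "f2 \<equiv> axis None 1"

lemma norm_axis: "norm (axis k c :: complex^'n) = cmod c"
proof -
  have "(norm ((axis k c :: complex^'n) $ i))\<^sup>2 = (if i = k then (cmod c)\<^sup>2 else 0)" for i
    by (simp add: axis_def)
  then show ?thesis by (simp add: norm_vec_def L2_set_def)
qed

lemma f_simps [simp]: "cb f1 = 0" "ca f1 = 1" "cw f1 = 0" "cb f2 = 1" "ca f2 = 0" "cw f2 = 0"
  by (simp_all add: axis_def cw_def vec_eq_iff)

lemma herm_eq: "herm x y = ca x * cnj (cb y) + cb x * cnj (ca y) + std_herm (cw y) (cw x)"
  unfolding herm_def std_herm_def cw_def by (simp add: mult.commute)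

lemma std_herm_simps [simp]:
  "std_herm (v + v') w = std_herm v w + std_herm v' w" "std_herm v (w + w') = std_herm v w + std_herm v w'"
  "std_herm (v - v') w = std_herm v w - std_herm v' w" "std_herm v (w - w') = std_herm v w - std_herm v w'"
  "std_herm (- v) w = - std_herm v w" "std_herm v (- w) = - std_herm v w"
  "std_herm (c *s v) w = cnj c * std_herm v w" "std_herm v (c *s w) = c * std_herm v w"
  "std_herm 0 w = 0" "std_herm v 0 = 0"
  by (simp_all add: std_herm_def algebra_simps sum.distrib sum_subtractf sum_negf sum_distrib_left)

lemma std_herm_commute: "std_herm w v = cnj (std_herm v w)"
  by (simp add: std_herm_def mult.commute)

lemma std_herm_self: "std_herm v v = of_real ((norm v)\<^sup>2)"
  by (simp add: std_herm_def norm_vec_def L2_set_def sum_nonneg complex_norm_square mult.commute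
      del: of_real_power)

lemma Re_std_herm: "Re (std_herm v w) = v \<bullet> w"
  by (simp add: std_herm_def inner_vec_def inner_complex_def)

lemma norm_std_herm_le: "cmod (std_herm v w) \<le> norm v * norm w"
proof (cases "std_herm v w = 0")
  case False
  define c where "c = cnj (std_herm v w) / cmod (std_herm v w)"
  have "cmod c = 1" unfolding c_def using False by (simp add: norm_divide)
  then have n: "norm (c *s w) = norm w" by (simp add: norm_vec_def norm_mult)
  have "std_herm v (c *s w) = (std_herm v w * cnj (std_herm v w)) / cmod (std_herm v w)"
    unfolding c_def by simp
  also have "\<dots> = of_real (cmod (std_herm v w))"
    unfolding complex_norm_square[symmetric] using False by (simp add: power2_eq_square)
  finally have "std_herm v (c *s w) = of_real (cmod (std_herm v w))" .
  then have "cmod (std_herm v w) = v \<bullet> (c *s w)" by (simp flip: Re_std_herm)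
  also have "\<dots> \<le> norm v * norm w" using norm_cauchy_schwarz[of v "c *s w"] n by simp
  finally show ?thesis .
qed auto

lemma herm_simps [simp]:
  "herm (x + y) z = herm x z + herm y z" "herm x (y + z) = herm x y + herm x z"
  "herm (x - y) z = herm x z - herm y z" "herm x (y - z) = herm x y - herm x z"
  "herm (c *s x) y = c * herm x y" "herm x (c *s y) = cnj c * herm x y"
  "herm 0 y = 0" "herm x 0 = 0" "herm x f1 = cb x" "herm f1 x = cnj (cb x)"
  by (simp_all add: herm_eq algebra_simps)

lemma herm_commute: "herm y x = cnj (herm x y)"
  by (simp add: herm_eq std_herm_commute[of "cw x" "cw y"] algebra_simps)

lemma herm_real: "herm x x = of_real (Re (herm x x))"
  using herm_commute[of x x] by (simp add: complex_eq_iff)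

lemma herm_self: "Re (herm x x) = 2 * Re (ca x * cnj (cb x)) + (norm (cw x))\<^sup>2"
  by (simp add: herm_eq std_herm_self algebra_simps)

lemma herm_nondegenerate:
  assumes "\<And>y. herm x y = 0" shows "x = 0"
  using assms[of f1] assms[of f2] assms[of "vec3 0 0 (cw x)"]
  by (simp add: herm_eq std_herm_self vec_n1_eq_iff)

lemma smult_Re_herm: "Re (herm (c *s x) (c *s x)) = (cmod c)\<^sup>2 * Re (herm x x)"
proof -
  have "herm (c *s x) (c *s x) = (c * cnj c) * herm x x" by simp
  also have "\<dots> = of_real ((cmod c)\<^sup>2 * Re (herm x x))"
    by (subst herm_real) (simp add: complex_norm_square[symmetric])
  finally show ?thesis by simp
qed

text \<open>Subtract from \<open>y\<close> the multiple \<open>\<beta> x\<close> with the same \<open>f\<^sub>2\<close>-coordinate. The rest is in the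
  hyperplane \<open>b = 0\<close>, where the form is semidefinite, and orthogonality makes the mixed terms
  outweigh the negative square of \<open>\<beta> x\<close>.\<close>

lemma herm_pos_orthogonal:
  assumes x: "Re (herm x x) < 0" and y: "herm y x = 0" "y \<noteq> 0"
  shows "Re (herm y y) > 0"
proof -
  have bx: "cb x \<noteq> 0" using x by (auto simp: herm_self)
  define \<beta> where "\<beta> = cb y / cb x"
  define y' where "y' = y - \<beta> *s x"
  have b: "cb y' = 0" unfolding y'_def \<beta>_def using bx by simp
  have yy: "y = \<beta> *s x + y'" unfolding y'_def by simp
  have h: "herm y' x = - \<beta> * herm x x" using y unfolding y'_def by simp
  then have h': "herm x y' = - cnj \<beta> * herm x x" using herm_commute[of x y'] herm_real[of x]
    by (metis complex_cnj_complex_of_real complex_cnj_minus complex_cnj_mult)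
  have "herm y y = \<beta> * cnj \<beta> * herm x x + \<beta> * herm x y' + cnj \<beta> * herm y' x + herm y' y'"
    by (subst (1 2) yy) (simp add: algebra_simps)
  also have "\<dots> = - (\<beta> * cnj \<beta>) * herm x x + herm y' y'" unfolding h h' by (simp add: algebra_simps)
  finally have "Re (herm y y) = - (cmod \<beta>)\<^sup>2 * Re (herm x x) + (norm (cw y'))\<^sup>2"
  proof -
    assume "herm y y = - (\<beta> * cnj \<beta>) * herm x x + herm y' y'"
    also have "\<dots> = of_real (- (cmod \<beta>)\<^sup>2 * Re (herm x x)) + herm y' y'"
      by (subst herm_real[of x]) (simp add: complex_norm_square[symmetric])
    finally show ?thesis using herm_self[of y'] b by simp
  qed
  moreover have "\<beta> \<noteq> 0 \<or> cw y' \<noteq> 0"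
  proof (rule ccontr)
    assume "\<not> ?thesis"
    then have *: "\<beta> = 0" "cw y' = 0" by auto
    then have "y' = y" unfolding y'_def by simp
    moreover have "ca y' = 0" using h * b bx by (simp add: herm_eq)
    ultimately show False using * b y(2) by (simp add: vec_n1_eq_iff)
  qed
  moreover have "- (cmod \<beta>)\<^sup>2 * Re (herm x x) \<ge> 0" using x by (simp add: mult_nonneg_nonpos)
  moreover have "\<beta> \<noteq> 0 \<Longrightarrow> - (cmod \<beta>)\<^sup>2 * Re (herm x x) > 0" using x by (simp add: mult_pos_neg)
  ultimately show ?thesis by (metis add_nonneg_pos add_pos_nonneg zero_le_power2 zero_less_norm_iff zero_less_power)
qed

subsection \<open>Matrices preserving the form\<close>

definition Umat :: "'m::finite mat_n1 set" where "Umat = carrier U_n1"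

lemma Umat_iff: "M \<in> Umat \<longleftrightarrow> (\<forall>x y. herm (M *v x) (M *v y) = herm x y)"
  unfolding Umat_def U_n1_def by simp

lemma Umat_herm: "M \<in> Umat \<Longrightarrow> herm (M *v x) (M *v y) = herm x y"
  by (simp add: Umat_iff)

lemma Umat_1: "mat 1 \<in> Umat" by (simp add: Umat_iff)

lemma Umat_mult: "M \<in> Umat \<Longrightarrow> N \<in> Umat \<Longrightarrow> M ** N \<in> Umat"
  by (simp add: Umat_iff flip: matrix_vector_mul_assoc)

lemma Umat_inj: assumes "M \<in> Umat" "M *v x = M *v y" shows "x = y"
proof -
  have "herm (x - y) z = 0" for z
    using Umat_herm[OF assms(1), of "x - y" z] assms(2) by (simp add: matrix_vector_mult_diff_distrib)
  then have "x - y = 0" by (rule herm_nondegenerate)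
  then show ?thesis by simp
qed

lemma Umat_invertible: assumes "M \<in> Umat" shows "invertible M"
proof -
  have "inj ((*v) M)" using Umat_inj[OF assms] by (auto intro: injI)
  then obtain B where "B ** M = mat 1" using matrix_left_invertible_injective by blast
  then show ?thesis unfolding invertible_def using matrix_left_right_inverse by blast
qed

lemma Umat_matrix_inv:
  assumes "M \<in> Umat" shows "matrix_inv M ** M = mat 1" "M ** matrix_inv M = mat 1"
  using someI_ex[of "\<lambda>B. M ** B = mat 1 \<and> B ** M = mat 1"] Umat_invertible[OF assms]
  unfolding matrix_inv_def invertible_def by auto

lemma matrix_inv_vector [simp]:
  assumes "M \<in> Umat"
  shows "matrix_inv M *v (M *v x) = x" "M *v (matrix_inv M *v x) = x"
  using Umat_matrix_inv[OF assms]
  by (simp_all add: matrix_vector_mul_assoc)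

lemma Umat_inv: "M \<in> Umat \<Longrightarrow> matrix_inv M \<in> Umat"
  by (simp add: Umat_iff[of "matrix_inv M"]) (metis Umat_herm matrix_inv_vector(2))

lemma mat_vector: "mat c *v (x :: complex^'n) = c *s x"
  by (simp add: matrix_vector_mult_def mat_def vec_eq_iff if_distrib if_distribR cong: if_cong)

lemma mat_eqI: "(\<And>x. (M :: complex^'n^'n) *v x = N *v x) \<Longrightarrow> M = N"
  by (simp add: matrix_eq)

lemma smult_vector: "M *v (c *s x) = c *s ((M :: complex^'n^'n) *v x)"
  by (simp add: matrix_vector_mult_scaleR vec_eq_iff matrix_vector_mult_def sum_distrib_left algebra_simps)

lemma mat_scalar_Umat: "cmod c = 1 \<Longrightarrow> mat c \<in> Umat"
proof -
  assume "cmod c = 1"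
  then have "c * cnj c = 1" by (simp flip: complex_norm_square)
  then show ?thesis by (simp add: Umat_iff mat_vector mult.commute[of "cnj c"] flip: mult.assoc)
qed

lemma group_U_n1: "group (U_n1 :: 'm::finite mat_n1 monoid)"
proof (rule groupI)
  note c = Umat_def[symmetric]
  have U: "carrier U_n1 = Umat" "mult U_n1 = (**)" "one U_n1 = mat 1"
    unfolding Umat_def by (simp_all add: U_n1_def)
  show "x \<otimes>\<^bsub>U_n1\<^esub> y \<in> carrier U_n1" if "x \<in> carrier U_n1" "y \<in> carrier U_n1" for x y :: "'m mat_n1"
    using that Umat_mult unfolding U by blast
  show "\<one>\<^bsub>U_n1\<^esub> \<in> carrier (U_n1 :: 'm mat_n1 monoid)" unfolding U by (rule Umat_1)
  show "x \<otimes>\<^bsub>U_n1\<^esub> y \<otimes>\<^bsub>U_n1\<^esub> z = x \<otimes>\<^bsub>U_n1\<^esub> (y \<otimes>\<^bsub>U_n1\<^esub> z)" for x y z :: "'m mat_n1"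
    unfolding U by (simp add: matrix_mul_assoc)
  show "\<one>\<^bsub>U_n1\<^esub> \<otimes>\<^bsub>U_n1\<^esub> x = x" for x :: "'m mat_n1" unfolding U by simp
  show "\<exists>y\<in>carrier U_n1. y \<otimes>\<^bsub>U_n1\<^esub> x = \<one>\<^bsub>U_n1\<^esub>" if "x \<in> carrier U_n1" for x :: "'m mat_n1"
    using that Umat_inv Umat_matrix_inv unfolding U by blast
qed

lemma U_scalars_normal: "U_scalars \<lhd> (U_n1 :: 'm::finite mat_n1 monoid)"
proof -
  interpret group "U_n1 :: 'm mat_n1 monoid" by (rule group_U_n1)
  have U: "carrier U_n1 = Umat" "mult U_n1 = (**)" "one U_n1 = mat 1"
    unfolding Umat_def by (simp_all add: U_n1_def)
  have inv: "inv\<^bsub>U_n1\<^esub> M = matrix_inv M" if "M \<in> Umat" for M :: "'m mat_n1"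
    using that inv_equality[of "matrix_inv M" M] Umat_inv Umat_matrix_inv unfolding U by metis
  have mm: "mat c ** mat d = (mat (c * d) :: 'm mat_n1)" for c d
    by (rule mat_eqI) (simp add: mat_vector flip: matrix_vector_mul_assoc)
  show ?thesis
  proof (rule normal_invI)
    show "subgroup U_scalars (U_n1 :: 'm mat_n1 monoid)"
    proof (rule subgroupI)
      show "U_scalars \<subseteq> carrier (U_n1 :: 'm mat_n1 monoid)" unfolding U U_scalars_def by (auto simp: mat_scalar_Umat)
      have "(mat 1 :: 'm mat_n1) \<in> U_scalars"
        unfolding U_scalars_def by (intro CollectI exI[of _ 1]) simp
      then show "U_scalars \<noteq> ({} :: 'm mat_n1 set)" by blast
      show "inv\<^bsub>U_n1\<^esub> a \<in> U_scalars" if aU: "a \<in> U_scalars" for a :: "'m mat_n1"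
      proof -
        obtain c where c: "a = mat c" "cmod c = 1" using aU unfolding U_scalars_def by auto
        then have "c \<noteq> 0" by auto
        have "inv\<^bsub>U_n1\<^esub> (mat c :: 'm mat_n1) = mat (inverse c)"
          by (rule inv_equality) (use c \<open>c \<noteq> 0\<close> in \<open>simp_all add: U mm norm_inverse mat_scalar_Umat\<close>)
        then show ?thesis unfolding U_scalars_def c by (auto simp: c norm_inverse)
      qed
      show "a \<otimes>\<^bsub>U_n1\<^esub> b \<in> U_scalars" if "a \<in> U_scalars" "b \<in> U_scalars" for a b :: "'m mat_n1"
        using that unfolding U U_scalars_def by (auto simp: mm norm_mult)
    qed
    show "x \<otimes>\<^bsub>U_n1\<^esub> h \<otimes>\<^bsub>U_n1\<^esub> inv\<^bsub>U_n1\<^esub> x \<in> U_scalars"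
      if x: "x \<in> carrier U_n1" and h: "h \<in> U_scalars" for x h :: "'m mat_n1"
    proof -
      obtain c where c: "h = mat c" "cmod c = 1" using h unfolding U_scalars_def by auto
      have "x ** mat c ** matrix_inv x = mat c"
        by (rule mat_eqI) (use x in \<open>simp add: U mat_vector smult_vector flip: matrix_vector_mul_assoc\<close>)
      then show ?thesis using x h inv[of x] unfolding U c by simp
    qed
  qed
qed

section \<open>Heisenberg translations\<close>

text \<open>The matrix of the translation \<open>n\<^bsub>(s,v)\<^esub>\<close>, with respect to \<open>f\<^sub>1\<close>, \<open>f\<^sub>2\<close> and the standard basis.\<close>

definition hmat :: "real \<Rightarrow> complex^'m \<Rightarrow> 'm::finite mat_n1" where
  "hmat s v = matrix (\<lambda>x. vec3 (cb x)
     (ca x + cb x * (- of_real ((norm v)\<^sup>2 / 2) - \<i> * of_real s) - std_herm v (cw x)) (cw x + cb x *s v))"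

lemma hmat_vector: "hmat s v *v x = vec3 (cb x)
    (ca x + cb x * (- of_real ((norm v)\<^sup>2 / 2) - \<i> * of_real s) - std_herm v (cw x)) (cw x + cb x *s v)"
  unfolding hmat_def
  by (rule matrix_works, unfold_locales)
    (simp_all add: vec_n1_eq_iff algebra_simps vector_add_ldistrib vector_sadd_rdistrib)

lemma norm_add_std_herm: "(norm (v + w))\<^sup>2 = (norm v)\<^sup>2 + (norm w)\<^sup>2 + 2 * Re (std_herm v w)"
  by (simp add: Re_std_herm power2_norm_eq_inner inner_add_left inner_add_right inner_commute)

lemma hmat_mult: "hmat s v ** hmat s' v' = hmat (s + s' + Im (std_herm v v')) (v + v')"
proof (rule mat_eqI)
  fix x
  have e: "std_herm v v' = of_real (Re (std_herm v v')) + \<i> * of_real (Im (std_herm v v'))"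
    by (simp add: complex_eq_iff)
  show "hmat s v ** hmat s' v' *v x = hmat (s + s' + Im (std_herm v v')) (v + v') *v x"
    by (subst matrix_vector_mul_assoc[symmetric], unfold hmat_vector norm_add_std_herm)
      (simp add: vec_n1_eq_iff vector_add_ldistrib algebra_simps, subst e, simp add: field_simps)
qed

lemma hmat_0 [simp]: "hmat 0 0 = mat 1"
  by (rule mat_eqI) (simp add: hmat_vector vec_n1_eq_iff)

lemma hmat_Umat: "hmat s v \<in> Umat"
proof -
  have "herm (hmat s v *v x) (hmat s v *v y) = herm x y" for x y
  proof -
    have "complex_of_real ((norm v)\<^sup>2) = std_herm v v" by (simp add: std_herm_self)
    then show ?thesis
      unfolding herm_eq hmat_vector using std_herm_commute[of "cw x" v] std_herm_commute[of "cw y" v]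
        std_herm_commute[of v v, symmetric]
      by (simp add: algebra_simps)
  qed
  then show ?thesis by (simp add: Umat_iff)
qed

lemma hmat_inv: "matrix_inv (hmat s v) = hmat (- s) (- v)"
proof -
  have "hmat (- s) (- v) ** hmat s v = mat 1" "hmat s v ** hmat (- s) (- v) = mat 1"
    by (simp_all add: hmat_mult std_herm_self flip: hmat_0)
  then show ?thesis using Umat_matrix_inv[OF hmat_Umat, of s v]
    by (metis matrix_mul_assoc matrix_mul_lid matrix_mul_rid)
qed

lemma hmat_inj:
  assumes "hmat s v = hmat s' v'" shows "s = s'" "v = v'"
proof -
  have e: "hmat s v *v f2 = hmat s' v' *v f2" using assms by simp
  from arg_cong[OF e, of cw] show "v = v'" by (simp add: hmat_vector)
  with arg_cong[OF e, of "\<lambda>x. Im (ca x)"] show "s = s'" by (simp add: hmat_vector)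
qed

lemma hmat_f1 [simp]: "hmat s v *v f1 = f1"
  by (simp add: hmat_vector vec_n1_eq_iff)

lemma lift_eq: "lift z = vec3 1 (z $ None) (tail z)"
  unfolding lift_def vec3_def tail_def by (simp add: vec_eq_iff split: option.split)

lemma pair_simps [simp]: "pair a w $ None = a" "tail (pair a w) = w"
  by (simp_all add: pair_def tail_def)

lemma Cn_eq_iff: "z = z' \<longleftrightarrow> z $ None = z' $ None \<and> tail z = tail z'"
proof -
  have "(\<forall>k. z $ k = z' $ k) \<longleftrightarrow> z $ None = z' $ None \<and> (\<forall>i. z $ Some i = z' $ Some i)"
    by (metis not_None_eq)
  then show ?thesis by (simp add: vec_eq_iff tail_def)
qed

lemma pair_eta [simp]: "pair (z $ None) (tail z) = z"
  by (simp add: Cn_eq_iff)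

lemma hmat_lift: "hmat s v *v lift z = lift (heis s v z)"
  unfolding hmat_vector lift_eq heis_def by (simp add: vec_n1_eq_iff)

lemma lift_inj: "c *s lift z = lift z' \<Longrightarrow> c = 1 \<and> z = z'"
  by (auto simp: lift_eq vec_n1_eq_iff Cn_eq_iff)

lemma siegel_iff: "z \<in> siegel \<longleftrightarrow> Re (herm (lift z) (lift z)) < 0"
  by (simp add: siegel_def herm_self lift_eq)

lemma negative_lift:
  assumes "Re (herm x x) < 0"
  obtains z where "z \<in> siegel" "x = cb x *s lift z" "cb x \<noteq> 0"
proof -
  have b: "cb x \<noteq> 0" using assms by (auto simp: herm_self)
  define z where "z = pair (ca x / cb x) (inverse (cb x) *s cw x)"
  have x: "x = cb x *s lift z" unfolding z_def using b by (simp add: lift_eq vec_n1_eq_iff vector_smult_assoc)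
  then have "Re (herm x x) = (cmod (cb x))\<^sup>2 * Re (herm (lift z) (lift z))"
    by (metis smult_Re_herm)
  then have "z \<in> siegel" using assms by (simp add: siegel_iff mult_less_0_iff)
  then show ?thesis using that x b by blast
qed

subsection \<open>Isometries fixing the cusp\<close>

lemma fixes_f1_cb:
  assumes M: "M \<in> Umat" "M *v f1 = \<mu> *s f1" and \<mu>: "\<mu> \<noteq> 0"
  shows "cb (M *v x) * cnj \<mu> = cb x"
  using Umat_herm[OF M(1), of x f1] by (simp add: M(2) mult.commute)

lemma fixes_f1_cw:
  assumes M: "M \<in> Umat" "M *v f1 = \<mu> *s f1" and \<mu>: "\<mu> \<noteq> 0" and x: "cb x = 0"
  shows "norm (cw (M *v x)) = norm (cw x)"
proof -
  have "cb (M *v x) = 0" using fixes_f1_cb[OF M \<mu>, of x] x \<mu> by simp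
  then have "(norm (cw (M *v x)))\<^sup>2 = (norm (cw x))\<^sup>2"
    using arg_cong[OF Umat_herm[OF M(1), of x x], of Re] x by (simp add: herm_self)
  then show ?thesis by simp
qed

text \<open>An isometry which fixes \<open>f\<^sub>1\<close> and acts on the last coordinates as a translation is a
  Heisenberg translation: its product with the image of \<open>f\<^sub>2\<close> determines the remaining
  coordinate.\<close>

lemma eq_hmatI:
  assumes M: "M \<in> Umat" "M *v f1 = f1" and v: "\<And>x. cw (M *v x) = cw x + cb x *s v"
  obtains s where "M = hmat s v"
proof -
  define s where "s = - Im (ca (M *v f2))"
  have b: "cb (M *v x) = cb x" for x using fixes_f1_cb[of M 1 x] M by simp
  have "Re (herm (M *v f2) (M *v f2)) = 0" unfolding Umat_herm[OF M(1)] by (simp add: herm_self)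
  then have "2 * Re (ca (M *v f2)) + (norm v)\<^sup>2 = 0" by (simp add: herm_self b v)
  then have a0: "ca (M *v f2) = - of_real ((norm v)\<^sup>2 / 2) - \<i> * of_real s"
    unfolding s_def by (simp add: complex_eq_iff)
  have "ca (M *v x) = ca x + cb x * (- of_real ((norm v)\<^sup>2 / 2) - \<i> * of_real s) - std_herm v (cw x)" for x
    using Umat_herm[OF M(1), of x f2]
    by (simp add: herm_eq b v a0 std_herm_self algebra_simps)
  then have "M *v x = hmat s v *v x" for x
    unfolding hmat_vector by (simp add: vec_n1_eq_iff b v)
  then have "M = hmat s v" by (rule mat_eqI)
  then show ?thesis by (rule that)
qed

definition nilpotent_mat :: "complex^'n^'n \<Rightarrow> bool" where
  "nilpotent_mat D \<longleftrightarrow> (\<exists>k. \<forall>x. (((*v) D) ^^ k) x = 0)"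

text \<open>A unipotent isometry fixing the line of \<open>f\<^sub>1\<close> fixes \<open>f\<^sub>1\<close> and acts unipotently and isometrically on
  the definite quotient of the hyperplane \<open>b = 0\<close> by \<open>f\<^sub>1\<close>, hence trivially: if \<open>D = M - 1\<close> kills
  \<open>D x\<close> there, invariance of the product of \<open>x\<close> and \<open>D x\<close> makes \<open>D x\<close> isotropic.\<close>

lemma unipotent_fixing_f1:
  assumes M: "M \<in> Umat" "M *v f1 = \<kappa> *s f1" and nil: "nilpotent_mat (M - mat 1)"
  obtains s v where "M = hmat s v"
proof -
  define D where "D = M - mat 1"
  have D: "D *v x = M *v x - x" for x
    unfolding D_def by (simp add: matrix_vector_mult_diff_rdistrib)
  obtain k where k: "\<And>x. (((*v) D) ^^ k) x = 0" using nil unfolding nilpotent_mat_def D_def by blast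
  have "(((*v) D) ^^ j) f1 = (\<kappa> - 1) ^ j *s f1" for j
  proof (induction j)
    case (Suc j)
    have "(((*v) D) ^^ Suc j) f1 = D *v ((\<kappa> - 1) ^ j *s f1)" using Suc by simp
    also have "\<dots> = (\<kappa> - 1) ^ Suc j *s f1"
      by (simp add: D M smult_vector vec_n1_eq_iff algebra_simps)
    finally show ?case .
  qed simp
  from this[of k] have "(\<kappa> - 1) ^ k = 0" using k by (metis f_simps(2) mult.right_neutral vector_smult_component zero_index)
  then have "\<kappa> = 1" by simp
  with M have f1: "M *v f1 = f1" by simp
  have b: "cb (M *v x) = cb x" for x using fixes_f1_cb[of M 1 x] M(1) f1 by simp
  have bD: "cb (((*v) D ^^ j) x) = 0" if "cb x = 0" for x j
    using that by (induction j) (simp_all add: D b)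
  have step: "cw (D *v x) = 0" if x: "cb x = 0" and DD: "cw (D *v (D *v x)) = 0" for x
  proof -
    have cD: "cb (D *v x) = 0" using bD[OF x, of 1] by simp
    then have cDD: "cb (D *v (D *v x)) = 0" using bD[OF x, of 2] by (simp add: eval_nat_numeral)
    have "herm (M *v x) (M *v (D *v x)) = herm (x + D *v x) (D *v x + D *v (D *v x))" by (simp add: D)
    then have "herm (D *v x) (D *v x) = 0"
      using Umat_herm[OF M(1), of x "D *v x"] x cD cDD DD by (simp add: herm_eq)
    then show ?thesis using cD by (simp add: herm_eq std_herm_self)
  qed
  have desc: "cw (((*v) D ^^ Suc j) x) = 0 \<Longrightarrow> cw (D *v x) = 0" if "cb x = 0" for j x
  proof (induction j)
    case (Suc j)
    have "cw (D *v (((*v) D ^^ j) x)) = 0"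
      by (rule step[OF bD[OF that]]) (use Suc.prems in simp)
    then show ?case using Suc.IH by simp
  qed simp
  have V: "cw (M *v x) = cw x" if "cb x = 0" for x
    using desc[OF that, of k] k[of x] by (simp add: D)
  have "cw (M *v x) = cw x + cb x *s cw (M *v f2)" for x
  proof -
    have "cw (M *v (x - cb x *s f2)) = cw (x - cb x *s f2)" by (rule V) simp
    then show ?thesis by (simp add: matrix_vector_mult_diff_distrib smult_vector diff_eq_eq)
  qed
  then show ?thesis using eq_hmatI[OF M(1) f1] that by metis
qed

text \<open>Conjugation with an isometry fixing the cusp whose multiplier is \<open>\<mu>\<close> scales the translation
  part by \<open>\<mu>\<close>, and the central part by \<open>\<mu>\<^sup>2\<close> up to an error linear in the translation part.\<close>

lemma hmat_conj:
  assumes M: "M \<in> Umat" "M *v f1 = \<mu> *s f1" and \<mu>: "\<mu> \<noteq> 0"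
  obtains s' v' where "M ** hmat s v ** matrix_inv M = hmat s' v'" "norm v' = cmod \<mu> * norm v"
    "\<bar>s'\<bar> \<le> (cmod \<mu>)\<^sup>2 * \<bar>s\<bar> + 2 * cmod \<mu> * norm v * norm (cw (matrix_inv M *v f2))"
proof -
  define q where "q = M ** hmat s v ** matrix_inv M"
  have qU: "q \<in> Umat" unfolding q_def by (intro Umat_mult Umat_inv M hmat_Umat)
  have qM: "q *v (M *v x) = M *v (hmat s v *v x)" for x
    unfolding q_def using M(1) by (simp flip: matrix_vector_mul_assoc)
  have qf1: "q *v f1 = f1"
  proof -
    have "\<mu> *s (q *v f1) = \<mu> *s f1" using qM[of f1] by (simp add: M smult_vector)
    then show ?thesis using \<mu> by (simp add: vector_mul_lcancel)
  qed
  define v' where "v' = cnj \<mu> *s cw (M *v vec3 0 0 v)"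
  have v': "cw (q *v y) = cw y + cb y *s v'" for y
  proof -
    define x where "x = matrix_inv M *v y"
    have y: "y = M *v x" unfolding x_def using M by simp
    have bx: "cb x = cb y * cnj \<mu>" using fixes_f1_cb[OF M \<mu>, of x] y by simp
    obtain t where "hmat s v *v x = x + cb x *s vec3 0 0 v + t *s f1"
    proof (rule that)
      show "hmat s v *v x = x + cb x *s vec3 0 0 v + (ca (hmat s v *v x) - ca x) *s f1"
        by (simp add: hmat_vector vec_n1_eq_iff)
    qed
    then have "cw (q *v y) = cw (M *v x) + cb x *s cw (M *v vec3 0 0 v)"
      unfolding y qM by (simp add: matrix_vector_right_distrib smult_vector M)
    then show ?thesis unfolding v'_def bx y by (simp add: vector_smult_assoc)
  qed
  obtain s' where s': "q = hmat s' v'" using eq_hmatI[OF qU qf1 v'] by blast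
  have nv: "norm v' = cmod \<mu> * norm v"
    unfolding v'_def using fixes_f1_cw[OF M \<mu>, of "vec3 0 0 v"]
    by (simp add: norm_vec_def norm_mult L2_set_left_distrib[symmetric] flip: L2_set_right_distrib)
  define x where "x = matrix_inv M *v f2"
  have bx: "cb x = cnj \<mu>" using fixes_f1_cb[OF M \<mu>, of x] unfolding x_def using M by simp
  have "herm (q *v f2) f2 = herm (hmat s v *v x) x"
    using qM[of x] Umat_herm[OF M(1), of "hmat s v *v x" x] unfolding x_def using M by simp
  moreover have "herm (hmat s v *v x) x = herm x x + cb x * cnj (cb x) * (- of_real ((norm v)\<^sup>2 / 2) - \<i> * of_real s)
      + (cb x * std_herm (cw x) v - cnj (cb x * std_herm (cw x) v))"
    using std_herm_commute[of "cw x" v] by (simp add: herm_eq hmat_vector algebra_simps)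
  moreover have "herm x x = 0" using Umat_herm[OF M(1), of x x] unfolding x_def using M by (simp add: herm_eq)
  ultimately have "- of_real ((norm v')\<^sup>2 / 2) - \<i> * of_real s' =
      of_real ((cmod \<mu>)\<^sup>2) * (- of_real ((norm v)\<^sup>2 / 2) - \<i> * of_real s)
      + (cb x * std_herm (cw x) v - cnj (cb x * std_herm (cw x) v))"
  proof -
    assume 1: "herm (q *v f2) f2 = herm (hmat s v *v x) x"
      and 2: "herm (hmat s v *v x) x = herm x x + cb x * cnj (cb x) * (- of_real ((norm v)\<^sup>2 / 2) - \<i> * of_real s)
      + (cb x * std_herm (cw x) v - cnj (cb x * std_herm (cw x) v))" and 3: "herm x x = 0"
    have "herm (q *v f2) f2 = - of_real ((norm v')\<^sup>2 / 2) - \<i> * of_real s'"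
      unfolding s' by (simp add: herm_eq hmat_vector)
    moreover have "cb x * cnj (cb x) = of_real ((cmod \<mu>)\<^sup>2)"
      unfolding complex_norm_square bx by simp
    ultimately show ?thesis using 1 unfolding 2 3 by simp
  qed
  from arg_cong[OF this, of Im]
  have "s' = (cmod \<mu>)\<^sup>2 * s - 2 * Im (cb x * std_herm (cw x) v)" by (simp del: of_real_power)
  moreover have "\<bar>Im (cb x * std_herm (cw x) v)\<bar> \<le> cmod \<mu> * (norm (cw x) * norm v)"
    using abs_Im_le_cmod[of "cb x * std_herm (cw x) v"] norm_std_herm_le[of "cw x" v]
    by (simp add: norm_mult bx) (metis mult_left_mono norm_ge_zero order_trans)
  moreover have "\<bar>(cmod \<mu>)\<^sup>2 * s\<bar> = (cmod \<mu>)\<^sup>2 * \<bar>s\<bar>" by (simp add: abs_mult)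
  ultimately have "\<bar>s'\<bar> \<le> (cmod \<mu>)\<^sup>2 * \<bar>s\<bar> + 2 * (cmod \<mu> * (norm (cw x) * norm v))" by linarith
  then show ?thesis using that[OF s'[unfolded q_def] nv] unfolding x_def by (simp add: mult_ac)
qed

section \<open>Discrete groups of isometries\<close>

lemma continuous_on_herm [continuous_intros]:
  "continuous_on S f \<Longrightarrow> continuous_on S h \<Longrightarrow> continuous_on S (\<lambda>x. herm (f x) (h x))"
  unfolding herm_def by (intro continuous_intros)

lemma tendsto_herm [tendsto_intros]:
  "(f \<longlongrightarrow> a) F \<Longrightarrow> (h \<longlongrightarrow> b) F \<Longrightarrow> ((\<lambda>x. herm (f x) (h x)) \<longlongrightarrow> herm a b) F"
  unfolding herm_def by (intro tendsto_intros)

lemma tendsto_matrix_vector [tendsto_intros]: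
  fixes f :: "'a \<Rightarrow> complex^'n^'k"
  assumes "(f \<longlongrightarrow> M) F" shows "((\<lambda>k. f k *v x) \<longlongrightarrow> M *v x) F"
  unfolding matrix_vector_mult_def by (intro tendsto_intros assms)

lemma matrix_vector_axis: "((M :: complex^'n^'k) *v axis j 1) $ i = M $ i $ j"
  by (simp add: matrix_vector_mult_def axis_def if_distrib if_distribR cong: if_cong)

lemma sum_UNIV_option: "(\<Sum>k\<in>UNIV. h k) = h None + (\<Sum>k\<in>UNIV. h (Some k))"
  for h :: "'b::finite option \<Rightarrow> real"
  by (simp add: UNIV_option_conv sum.reindex)

text \<open>The dual basis of the standard basis with respect to the form.\<close>

definition dual :: "'m::finite option option \<Rightarrow> 'm vec_n1" where
  "dual k = (case k of None \<Rightarrow> f1 | Some None \<Rightarrow> f2 | Some (Some i) \<Rightarrow> vec3 0 0 (axis i 1))"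

lemma herm_dual: "herm x (dual k) = x $ k"
proof -
  have "std_herm (axis i 1) w = w $ i" for i :: 'a and w
    by (simp add: std_herm_def axis_def if_distrib if_distribR cong: if_cong)
  then show ?thesis unfolding dual_def
    by (auto simp: herm_eq split: option.split) (simp add: cw_def)
qed

text \<open>The entries of \<open>M\<^sup>-\<^sup>1 N\<close> are products \<open>\<langle>N x, M y\<rangle>\<close>. So the quotients of the members of a
  convergent sequence tend to the identity.\<close>

lemma quotient_tendsto_1:
  fixes N :: "nat \<Rightarrow> 'm::finite mat_n1"
  assumes N: "\<And>k. N k \<in> Umat" "N \<longlonglongrightarrow> L"
  shows "((\<lambda>p. matrix_inv (N (fst p)) ** N (snd p)) \<longlongrightarrow> mat 1) (sequentially \<times>\<^sub>F sequentially)"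
proof (intro vec_tendstoI)
  fix i j
  have "herm (L *v x) (L *v y) = herm x y" for x y
  proof (rule LIMSEQ_unique)
    show "(\<lambda>k. herm (N k *v x) (N k *v y)) \<longlonglongrightarrow> herm (L *v x) (L *v y)" by (intro tendsto_intros N)
    show "(\<lambda>k. herm (N k *v x) (N k *v y)) \<longlonglongrightarrow> herm x y" by (simp add: Umat_herm[OF N(1)])
  qed
  from this[of "axis j 1" "dual i"]
  have L: "herm (L *v axis j 1) (L *v dual i) = mat 1 $ i $ j"
    unfolding herm_dual by (simp add: axis_def mat_def)
  have entry: "M $ i $ j = herm (M *v axis j 1) (dual i)" for M :: "'m mat_n1"
    unfolding herm_dual by (simp add: matrix_vector_axis)
  have e: "(matrix_inv (N k) ** N l) $ i $ j = herm (N l *v axis j 1) (N k *v dual i)" for k l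
    unfolding entry using Umat_herm[OF N(1), of k "matrix_inv (N k) *v (N l *v axis j 1)" "dual i"] N(1)
    by (simp flip: matrix_vector_mul_assoc)
  have "((\<lambda>p. herm (N (snd p) *v axis j 1) (N (fst p) *v dual i)) \<longlongrightarrow> herm (L *v axis j 1) (L *v dual i))
      (sequentially \<times>\<^sub>F sequentially)"
    by (intro tendsto_intros filterlim_compose[OF N(2)] filterlim_fst filterlim_snd)
  then show "((\<lambda>p. (matrix_inv (N (fst p)) ** N (snd p)) $ i $ j) \<longlongrightarrow> mat 1 $ i $ j)
      (sequentially \<times>\<^sub>F sequentially)" unfolding e L .
qed

text \<open>For a negative vector \<open>x\<close>, changing the sign of the form on the line of \<open>x\<close> gives a positive
  definite form. These forms are permuted by the isometries.\<close>

definition definite_form :: "'m::finite vec_n1 \<Rightarrow> 'm vec_n1 \<Rightarrow> real" where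
  "definite_form x y = Re (herm y y) - 2 * (cmod (herm y x))\<^sup>2 / Re (herm x x)"

lemma definite_form_pos:
  assumes x: "Re (herm x x) < 0" and y: "y \<noteq> 0"
  shows "definite_form x y > 0"
proof -
  define h where "h = Re (herm x x)"
  have h: "h < 0" "herm x x = of_real h" unfolding h_def using x herm_real by auto
  define c where "c = herm y x / herm x x"
  define y' where "y' = y - c *s x"
  have y'x: "herm y' x = 0" unfolding y'_def c_def using h by simp
  have yy: "y = c *s x + y'" unfolding y'_def by simp
  have "herm y x = c * of_real h" unfolding c_def using h by simp
  then have "(cmod (herm y x))\<^sup>2 = (cmod c)\<^sup>2 * h\<^sup>2" by (simp add: norm_mult power_mult_distrib)
  moreover have "Re (herm y y) = Re (herm (c *s x) (c *s x)) + Re (herm y' y')"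
    by (subst (1 2) yy) (use y'x herm_commute[of x y'] in simp)
  then have "Re (herm y y) = (cmod c)\<^sup>2 * h + Re (herm y' y')" unfolding smult_Re_herm h_def .
  ultimately have d: "definite_form x y = - (cmod c)\<^sup>2 * h + Re (herm y' y')"
    unfolding definite_form_def h_def[symmetric] using h by (simp add: power2_eq_square field_simps)
  have "- (cmod c)\<^sup>2 * h \<ge> 0" using h by (simp add: mult_nonneg_nonpos)
  moreover have "c \<noteq> 0 \<Longrightarrow> - (cmod c)\<^sup>2 * h > 0" using h by (simp add: mult_pos_neg)
  moreover have "y' \<noteq> 0 \<Longrightarrow> Re (herm y' y') > 0" by (rule herm_pos_orthogonal[OF x y'x])
  moreover have "c \<noteq> 0 \<or> y' \<noteq> 0" using yy y by auto
  ultimately show ?thesis unfolding d by (cases "y' = 0") auto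
qed

lemma definite_form_Umat: "M \<in> Umat \<Longrightarrow> definite_form (M *v x) (M *v y) = definite_form x y"
  unfolding definite_form_def by (simp add: Umat_herm)

lemma definite_form_scaleR: "definite_form x (r *\<^sub>R y) = r\<^sup>2 * definite_form x y"
proof -
  have r: "r *\<^sub>R y = of_real r *s y" by (simp add: vec_eq_iff complex_eq_iff)
  show ?thesis unfolding definite_form_def r smult_Re_herm
    by (simp add: norm_mult power_mult_distrib algebra_simps)
qed

text \<open>The group acts properly on the negative vectors: over a compact set of them, the associated
  definite forms are uniformly comparable to the Euclidean one, and \<open>M\<close> transports the form
  of \<open>x\<close> to the one of \<open>M x\<close>.\<close>

lemma Umat_proper:
  fixes x :: "'m::finite vec_n1"
  assumes x: "Re (herm x x) < 0"
  obtains B' where "\<And>M. M \<in> Umat \<Longrightarrow> norm (M *v x) \<le> B \<Longrightarrow> norm M \<le> B'"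
proof -
  define Z :: "'m vec_n1 set" where "Z = {z. norm z \<le> B \<and> Re (herm z z) = Re (herm x x)}"
  have "Z = cball 0 B \<inter> {z. Re (herm z z) = Re (herm x x)}" unfolding Z_def by auto
  moreover have "closed {z :: 'm vec_n1. Re (herm z z) = Re (herm x x)}" by (intro closed_Collect_eq continuous_intros)
  ultimately have Z: "compact Z" using compact_Int_closed[OF compact_cball] by simp
  have neg: "Re (herm z z) < 0" if "z \<in> Z" for z using that x unfolding Z_def by simp
  obtain m where m: "m > 0" "\<And>z y. z \<in> Z \<Longrightarrow> norm y = 1 \<Longrightarrow> m \<le> definite_form z y"
  proof (cases "Z = {}")
    case True then show ?thesis using that[of 1] by auto
  next
    case False
    let ?C = "Z \<times> sphere 0 1 :: ('m vec_n1 \<times> 'm vec_n1) set"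
    have "compact ?C" using Z by (intro compact_Times) auto
    moreover have "axis None 1 \<in> (sphere 0 1 :: 'm vec_n1 set)" by (simp add: norm_axis)
    then have "?C \<noteq> {}" using False by blast
    moreover have "continuous_on ?C (\<lambda>p. definite_form (fst p) (snd p))"
      unfolding definite_form_def by (intro continuous_intros) (use neg in fastforce)
    ultimately obtain p where p: "p \<in> ?C" "\<And>q. q \<in> ?C \<Longrightarrow> definite_form (fst p) (snd p) \<le> definite_form (fst q) (snd q)"
      using continuous_attains_inf by meson
    have "definite_form (fst p) (snd p) > 0" using p(1) neg by (intro definite_form_pos) auto
    then show ?thesis using that p(2) by fastforce
  qed
  have low: "m * (norm y)\<^sup>2 \<le> definite_form z y" if "z \<in> Z" for z y
  proof (cases "y = 0")
    case True then show ?thesis by (simp add: definite_form_def)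
  next
    case False
    have "m \<le> definite_form z (inverse (norm y) *\<^sub>R y)" using m(2)[OF that] False by simp
    then have "m \<le> definite_form z y / (norm y)\<^sup>2"
      unfolding definite_form_scaleR by (simp add: field_simps)
    then show ?thesis using False by (simp add: field_simps)
  qed
  define L where "L = Max (range (\<lambda>j :: 'm option option. definite_form x (axis j 1)))"
  have L: "definite_form x (axis j 1) \<le> L" for j unfolding L_def by (intro Max_ge) auto
  define B' where "B' = (\<Sum>i::'m option option\<in>UNIV. \<Sum>j::'m option option\<in>UNIV. sqrt (L / m))"
  have "norm M \<le> B'" if M: "M \<in> Umat" "norm (M *v x) \<le> B" for M
  proof -
    have z: "M *v x \<in> Z" unfolding Z_def using M by (simp add: Umat_herm)
    have entry: "norm (M $ i $ j) \<le> sqrt (L / m)" for i j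
    proof -
      have "m * (norm (M *v axis j 1))\<^sup>2 \<le> L"
        using low[OF z, of "M *v axis j 1"] L[of j] unfolding definite_form_Umat[OF M(1)] by simp
      then have "(norm (M *v axis j 1))\<^sup>2 \<le> L / m" using m(1) by (simp add: field_simps)
      then have "norm (M *v axis j 1) \<le> sqrt (L / m)" by (rule real_le_rsqrt)
      moreover have "norm (M $ i $ j) \<le> norm (M *v axis j 1)"
        using Finite_Cartesian_Product.norm_nth_le[of "M *v axis j 1" i]
        by (simp add: matrix_vector_axis)
      ultimately show ?thesis by simp
    qed
    have "norm M \<le> (\<Sum>i\<in>UNIV. norm (M $ i))" unfolding norm_vec_def[of M] by (intro L2_set_le_sum) auto
    also have "\<dots> \<le> (\<Sum>i\<in>UNIV. \<Sum>j\<in>UNIV. norm (M $ i $ j))"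
      unfolding norm_vec_def[of "M $ i" for i] by (intro sum_mono L2_set_le_sum) auto
    also have "\<dots> \<le> B'" unfolding B'_def by (intro sum_mono entry)
    finally show ?thesis .
  qed
  then show ?thesis by (rule that)
qed

text \<open>Matrices rather than elements of PU(n,1): the group contains all unit scalars, and it is
  discrete and torsion-free modulo these.\<close>

locale unitary_group =
  fixes P :: "'m::finite mat_n1 set"
  assumes P_Umat: "M \<in> P \<Longrightarrow> M \<in> Umat"
    and P_scalar: "cmod c = 1 \<Longrightarrow> mat c \<in> P"
    and P_mult: "M \<in> P \<Longrightarrow> N \<in> P \<Longrightarrow> M ** N \<in> P"
    and P_inv: "M \<in> P \<Longrightarrow> matrix_inv M \<in> P"
    and P_discrete: "\<exists>e>0. \<forall>M\<in>P. norm (M - mat 1) < e \<longrightarrow> M \<in> U_scalars"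
    and P_torsion_free: "M \<in> P \<Longrightarrow> k > 0 \<Longrightarrow> (((**) M) ^^ k) (mat 1) \<in> U_scalars \<Longrightarrow> M \<in> U_scalars"
begin

lemma repeats_mod_scalars:
  assumes N: "\<And>k :: nat. N k \<in> P" and B: "\<And>k. norm (N k) \<le> B"
  obtains i j where "i < j" "matrix_inv (N i) ** N j \<in> U_scalars"
proof -
  have "bounded (range N)" using B unfolding bounded_iff by auto
  then obtain L r where r: "strict_mono r" "(N \<circ> r) \<longlonglongrightarrow> L"
    using bounded_imp_convergent_subsequence by blast
  obtain e where e: "e > 0" "\<And>M. M \<in> P \<Longrightarrow> norm (M - mat 1) < e \<Longrightarrow> M \<in> U_scalars"
    using P_discrete by blast
  have "((\<lambda>p. matrix_inv ((N \<circ> r) (fst p)) ** (N \<circ> r) (snd p)) \<longlongrightarrow> mat 1) (sequentially \<times>\<^sub>F sequentially)"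
    by (rule quotient_tendsto_1[OF _ r(2)]) (use N P_Umat in auto)
  from tendstoD[OF this e(1)] obtain K where
    K: "\<And>m n. m \<ge> K \<Longrightarrow> n \<ge> K \<Longrightarrow> dist (matrix_inv ((N \<circ> r) n) ** (N \<circ> r) m) (mat 1) < e"
    unfolding eventually_prod_sequentially by auto
  have "matrix_inv (N (r K)) ** N (r (Suc K)) \<in> U_scalars"
    using K[of "Suc K" K] N by (intro e(2) P_mult P_inv) (auto simp: dist_norm)
  then show ?thesis using that r(1) by (metis lessI strict_mono_def)
qed

text \<open>The powers of \<open>M\<close> multiply \<open>x\<close> by unit scalars, so they are bounded. By discreteness, two of them
  coincide modulo scalars, and \<open>M\<close> has finite order modulo scalars.\<close>

lemma scalar_if_fixes_negative:
  assumes M: "M \<in> P" and x: "Re (herm x x) < 0" "M *v x = c *s x"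
  shows "M \<in> U_scalars"
proof -
  let ?N = "\<lambda>k. (((**) M) ^^ k) (mat 1)"
  have "(cmod c)\<^sup>2 * Re (herm x x) = Re (herm x x)"
    using Umat_herm[OF P_Umat[OF M], of x x] x(2) by (metis smult_Re_herm)
  then have "(cmod c)\<^sup>2 = 1" using x(1) by simp
  then have "cmod c = 1 \<or> cmod c = - 1" by (simp only: power2_eq_1_iff)
  then have c: "cmod c = 1" using norm_ge_zero[of c] by linarith
  have NP: "?N k \<in> P" for k
    using P_scalar[of 1] by (induction k) (auto intro: P_mult M)
  have Nx: "?N k *v x = c ^ k *s x" for k
    by (induction k) (simp_all add: x(2) smult_vector vector_smult_assoc mult.commute flip: matrix_vector_mul_assoc)
  have nx: "norm (c ^ k *s x) = norm x" for k
    using c by (simp add: norm_vec_def norm_mult norm_power)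
  obtain B where B: "\<And>M. M \<in> Umat \<Longrightarrow> norm (M *v x) \<le> norm x \<Longrightarrow> norm M \<le> B"
    using Umat_proper[OF x(1)] by blast
  obtain i j where ij: "i < j" "matrix_inv (?N i) ** ?N j \<in> U_scalars"
  proof (rule repeats_mod_scalars[of ?N B])
    show "?N k \<in> P" for k by (rule NP)
    show "norm (?N k) \<le> B" for k by (rule B[OF P_Umat[OF NP]]) (simp add: Nx nx)
  qed
  have add: "?N (m + n) = ?N m ** ?N n" for m n
    by (induction m) (simp_all add: matrix_mul_assoc)
  have "matrix_inv (?N i) ** ?N j = matrix_inv (?N i) ** (?N i ** ?N (j - i))"
    using ij(1) add[of i "j - i"] by simp
  also have "\<dots> = ?N (j - i)"
    using Umat_matrix_inv[OF P_Umat[OF NP]] by (simp add: matrix_mul_assoc)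
  finally show ?thesis using ij P_torsion_free[OF M, of "j - i"] by simp
qed

lemma finitely_many_translations: "finite {(s, v). hmat s v \<in> P \<and> \<bar>s\<bar> \<le> B \<and> norm v \<le> B}" (is "finite ?S")
proof (rule ccontr)
  assume inf: "infinite ?S"
  then obtain F :: "nat \<Rightarrow> real \<times> (complex^'m)" where F: "inj F" "range F \<subseteq> ?S"
    using infinite_countable_subset by blast
  define x :: "'m vec_n1" where "x = f2 - f1"
  have x: "Re (herm x x) < 0" unfolding x_def by (simp add: herm_self)
  define N where "N k = hmat (fst (F k)) (snd (F k))" for k
  have NP: "N k \<in> P" and FB: "\<bar>fst (F k)\<bar> \<le> B" "norm (snd (F k)) \<le> B" for k
    using F(2) unfolding N_def by (auto simp: subset_iff) (metis prod.collapse rangeI)+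
  have vb: "norm (vec3 b a w) \<le> cmod b + cmod a + norm w" for b a and w :: "complex^'m"
  proof -
    have "vec3 b a w = axis None b + axis (Some None) a + vec3 0 0 w"
      by (simp add: vec_n1_eq_iff) (simp add: axis_def vec3_def cw_def vec_eq_iff)
    moreover have "norm (vec3 0 0 w :: 'm vec_n1) = norm w"
    proof -
      have 1: "(\<Sum>k\<in>UNIV. f k) = f None + (f (Some None) + (\<Sum>i\<in>UNIV. f (Some (Some i))))"
        for f :: "'m option option \<Rightarrow> real"
        using sum_UNIV_option[of f] sum_UNIV_option[of "\<lambda>k. f (Some k)"] by simp
      show ?thesis unfolding norm_vec_def L2_set_def 1 by (simp add: vec3_def)
    qed
    ultimately show ?thesis
      using norm_triangle_ineq[of "axis None b + axis (Some None) a" "vec3 0 0 w :: 'm vec_n1"]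
        norm_triangle_ineq[of "axis None b :: 'm vec_n1" "axis (Some None) a"] by (simp add: norm_axis)
  qed
  define B1 where "B1 = 2 + (B\<^sup>2 / 2 + B) + B"
  have "norm (N k *v x) \<le> B1" for k
  proof -
    have 1: "N k *v x = vec3 1 (- 1 + (- of_real ((norm (snd (F k)))\<^sup>2 / 2) - \<i> * of_real (fst (F k)))) (snd (F k))"
      unfolding N_def x_def hmat_vector by (simp add: vec_n1_eq_iff)
    moreover have "cmod (- 1 + (- of_real ((norm (snd (F k)))\<^sup>2 / 2) - \<i> * of_real (fst (F k)))) \<le>
        1 + ((norm (snd (F k)))\<^sup>2 / 2 + \<bar>fst (F k)\<bar>)"
      by (intro norm_triangle_mono order_trans[OF norm_triangle_ineq4])
        (auto simp: norm_mult norm_divide norm_power)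
    moreover have "(norm (snd (F k)))\<^sup>2 \<le> B\<^sup>2" using FB(2)[of k] by (intro power_mono) auto
    ultimately show ?thesis
      using vb[of 1 "- 1 + (- of_real ((norm (snd (F k)))\<^sup>2 / 2) - \<i> * of_real (fst (F k)))" "snd (F k)"]
        FB[of k] unfolding B1_def 1 norm_one by linarith
  qed
  then obtain B2 where "\<And>k. norm (N k) \<le> B2" using Umat_proper[OF x, of B1] P_Umat[OF NP] by metis
  then obtain i j where ij: "i < j" "matrix_inv (N i) ** N j \<in> U_scalars"
    using repeats_mod_scalars[of N, OF NP] by blast
  then obtain c where c: "matrix_inv (N i) ** N j = mat c" unfolding U_scalars_def by auto
  have "c *s f1 = (f1 :: 'm vec_n1)"
    using arg_cong[OF c, of "\<lambda>M. M *v f1"] unfolding N_def hmat_inv by (simp add: mat_vector flip: matrix_vector_mul_assoc)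
  then have "c = 1" by (simp add: vec_n1_eq_iff)
  then have "N i = N j" using c Umat_matrix_inv(2)[OF P_Umat[OF NP], of i]
    by (metis matrix_mul_assoc matrix_mul_lid matrix_mul_rid)
  then have "F i = F j" unfolding N_def by (intro prod_eqI hmat_inj)
  then show False using F(1) ij by (metis injD less_irrefl)
qed

end

section \<open>The stabiliser of a cusp\<close>

text \<open>Fixed lines expressed by eigenvectors.\<close>

definition parabolic_mat :: "'m::finite mat_n1 \<Rightarrow> bool" where
  "parabolic_mat M \<longleftrightarrow> M \<in> Umat \<and> (\<forall>x c. Re (herm x x) < 0 \<longrightarrow> M *v x \<noteq> c *s x) \<and>
     (\<exists>y. y \<noteq> 0 \<and> herm y y = 0 \<and> (\<exists>c. M *v y = c *s y) \<and>
        (\<forall>z. z \<noteq> 0 \<and> herm z z = 0 \<and> (\<exists>c. M *v z = c *s z) \<longrightarrow> (\<exists>d. z = d *s y)))"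

locale cusped_group = unitary_group P for P :: "'m::finite mat_n1 set" +
  assumes parabolic_unipotent: "M \<in> P \<Longrightarrow> parabolic_mat M \<Longrightarrow> \<exists>c. cmod c = 1 \<and> nilpotent_mat (mat c ** M - mat 1)"
    and cusp: "\<exists>M\<in>P. parabolic_mat M \<and> (\<exists>\<kappa>. M *v f1 = \<kappa> *s f1)"
begin

lemma parabolic_fixing_f1_translation:
  assumes M: "M \<in> P" "parabolic_mat M" "M *v f1 = \<kappa> *s f1"
  obtains c s v where "cmod c = 1" "mat c ** M = hmat s v" "hmat s v \<in> P"
proof -
  obtain c where c: "cmod c = 1" "nilpotent_mat (mat c ** M - mat 1)" using parabolic_unipotent[OF M(1,2)] by blast
  have P: "mat c ** M \<in> P" using P_mult P_scalar c M by blast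
  have "mat c ** M *v f1 = (c * \<kappa>) *s f1" by (simp add: M(3) mat_vector vector_smult_assoc flip: matrix_vector_mul_assoc)
  from unipotent_fixing_f1[OF P_Umat[OF P] this c(2)] obtain s v where "mat c ** M = hmat s v" .
  then show ?thesis using that c P by metis
qed

lemma exists_translation: obtains s v where "hmat s v \<in> P" "(s, v) \<noteq> (0, 0)"
proof -
  obtain M \<kappa> where M: "M \<in> P" "parabolic_mat M" "M *v f1 = \<kappa> *s f1" using cusp by blast
  obtain c s v where c: "cmod c = 1" "mat c ** M = hmat s v" "hmat s v \<in> P"
    using parabolic_fixing_f1_translation[OF M] .
  have "(s, v) \<noteq> (0, 0)"
  proof
    assume "(s, v) = (0, 0)"
    then have "mat c ** M *v (f2 - f1) = f2 - f1" using c(2) by simp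
    then have 1: "c *s (M *v (f2 - f1)) = f2 - f1" by (simp add: mat_vector flip: matrix_vector_mul_assoc)
    have "c \<noteq> 0" using c by auto
    then have "M *v (f2 - f1) = inverse c *s (f2 - f1)"
      using arg_cong[OF 1, of "\<lambda>x. inverse c *s x"] by (simp only: vector_smult_assoc) simp
    moreover have "Re (herm (f2 - f1) (f2 - f1 :: 'm vec_n1)) < 0" by (simp add: herm_self)
    ultimately show False using M(2) unfolding parabolic_mat_def by blast
  qed
  then show ?thesis using that c(3) by blast
qed

text \<open>If an element of a discrete group fixes the cusp, it does not scale the horoballs there:
  conjugation with it would contract the translations in the group, of which only finitely many
  are bounded.\<close>

lemma no_contraction:
  assumes M: "M \<in> P" "M *v f1 = \<mu> *s f1" and \<mu>: "\<mu> \<noteq> 0" "cmod \<mu> < 1"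
  shows False
proof -
  define C where "C = 2 * cmod \<mu> * norm (cw (matrix_inv M *v f2))"
  define t where "t = (1 + cmod \<mu>) / 2"
  have t: "cmod \<mu> \<le> t" "0 < t" "t < 1" unfolding t_def using \<mu> by (auto simp: add_pos_nonneg)
  define k where "k = 1 + 2 * C / (1 - cmod \<mu>)"
  have C0: "C \<ge> 0" unfolding C_def by simp
  have k: "k > 0" "C + k * cmod \<mu> \<le> t * k"
  proof -
    show "k > 0" unfolding k_def using C0 \<mu> by (simp add: add_pos_nonneg)
    have "k * ((1 - cmod \<mu>) / 2) = (1 - cmod \<mu>) / 2 + C"
      unfolding k_def using \<mu> by (simp add: field_simps)
    then have "C \<le> k * ((1 - cmod \<mu>) / 2)" using \<mu> by simp
    then show "C + k * cmod \<mu> \<le> t * k" unfolding t_def by (simp add: field_simps)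
  qed
  define size where "size s v = \<bar>s\<bar> + k * norm v" for s :: real and v :: "complex^'m"
  have size0: "size s v \<ge> 0" for s v unfolding size_def using k by simp
  have size_pos: "size s v > 0" if "(s, v) \<noteq> (0, 0)" for s v
  proof -
    have "k * norm v \<ge> 0" using k by simp
    moreover have "v \<noteq> 0 \<Longrightarrow> k * norm v > 0" using k by simp
    ultimately show ?thesis using that unfolding size_def by (cases "v = 0") auto
  qed
  have step: "\<exists>s' v'. hmat s' v' \<in> P \<and> (s', v') \<noteq> (0, 0) \<and> size s' v' \<le> t * size s v"
    if h: "hmat s v \<in> P" "(s, v) \<noteq> (0, 0)" for s v
  proof -
    obtain s' v' where c: "M ** hmat s v ** matrix_inv M = hmat s' v'" "norm v' = cmod \<mu> * norm v"
      "\<bar>s'\<bar> \<le> (cmod \<mu>)\<^sup>2 * \<bar>s\<bar> + 2 * cmod \<mu> * norm v * norm (cw (matrix_inv M *v f2))"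
      using hmat_conj[OF P_Umat[OF M(1)] M(2) \<mu>(1)] by blast
    have "hmat s' v' \<in> P" using P_mult P_inv M h c(1) by metis
    moreover have "(s', v') \<noteq> (0, 0)"
    proof
      assume "(s', v') = (0, 0)"
      then have e: "M ** hmat s v ** matrix_inv M = mat 1" using c(1) by simp
      have "hmat s v *v x = x" for x
      proof -
        have "M *v (hmat s v *v x) = M *v x"
          using arg_cong[OF e, of "\<lambda>N. N *v (M *v x)"] P_Umat[OF M(1)] by (simp flip: matrix_vector_mul_assoc)
        then show ?thesis using Umat_inj[OF P_Umat[OF M(1)]] by blast
      qed
      then have "hmat s v = hmat 0 0" by (intro mat_eqI) simp
      then show False using hmat_inj h(2) by blast
    qed
    moreover have "size s' v' \<le> t * size s v"
    proof -
      have "(cmod \<mu>)\<^sup>2 \<le> t" using t \<mu> by (smt (verit) mult_left_le norm_ge_zero power2_eq_square)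
      then have "(cmod \<mu>)\<^sup>2 * \<bar>s\<bar> \<le> t * \<bar>s\<bar>" by (simp add: mult_right_mono)
      moreover have "(C + k * cmod \<mu>) * norm v \<le> (t * k) * norm v" using k by (simp add: mult_right_mono)
      ultimately show ?thesis using c(3) unfolding size_def c(2) C_def by (simp add: algebra_simps)
    qed
    ultimately show ?thesis by blast
  qed
  define S where "S = {size s v |s v. hmat s v \<in> P \<and> (s, v) \<noteq> (0, 0)}"
  obtain s0 v0 where 0: "hmat s0 v0 \<in> P" "(s0, v0) \<noteq> (0, 0)" by (rule exists_translation)
  define F where "F = {(s, v). hmat s v \<in> P \<and> (s, v) \<noteq> (0, 0) \<and> size s v \<le> size s0 v0}"
  have "finite F"
  proof (rule finite_subset[OF _ finitely_many_translations[of "max (size s0 v0) (size s0 v0 / k)"]])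
    have "norm v \<le> size s0 v0 / k" if "size s v \<le> size s0 v0" for s v
    proof -
      have "k * norm v \<le> size s0 v0" using that unfolding size_def by simp
      then show ?thesis using k by (simp add: pos_le_divide_eq mult.commute)
    qed
    moreover have "\<bar>s\<bar> \<le> size s0 v0" if "size s v \<le> size s0 v0" for s v
    proof -
      have "0 \<le> k * norm v" using k by simp
      then show ?thesis using that unfolding size_def by linarith
    qed
    ultimately show "F \<subseteq> {(s, v). hmat s v \<in> P \<and> \<bar>s\<bar> \<le> max (size s0 v0) (size s0 v0 / k) \<and>
        norm v \<le> max (size s0 v0) (size s0 v0 / k)}"
      unfolding F_def by (auto simp: le_max_iff_disj)
  qed
  moreover have "F \<noteq> {}" using 0 unfolding F_def by blast
  ultimately obtain p where p: "p \<in> F" "\<And>q. q \<in> F \<Longrightarrow> size (fst p) (snd p) \<le> size (fst q) (snd q)"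
    using arg_min_if_finite[of F "\<lambda>q. size (fst q) (snd q)"] by (metis (no_types, lifting) not_le_imp_less)
  obtain s v where sv: "p = (s, v)" by (cases p)
  have h: "hmat s v \<in> P" "(s, v) \<noteq> (0, 0)" "size s v \<le> size s0 v0" using p(1) unfolding F_def sv by auto
  obtain s' v' where h': "hmat s' v' \<in> P" "(s', v') \<noteq> (0, 0)" "size s' v' \<le> t * size s v"
    using step[OF h(1,2)] by blast
  have "t * size s v < size s v" using t size_pos[OF h(2)] by simp
  then have less: "size s' v' < size s v" using h'(3) by simp
  then have "(s', v') \<in> F" using h' h(3) unfolding F_def by simp
  then show False using p(2)[of "(s', v')"] less unfolding sv by simp
qed

lemma multiplier_unit:
  assumes M: "M \<in> P" "M *v f1 = \<mu> *s f1"
  shows "cmod \<mu> = 1"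
proof -
  have \<mu>: "\<mu> \<noteq> 0"
  proof
    assume "\<mu> = 0"
    then have "M *v f1 = M *v 0" using M by simp
    then have "f1 = (0 :: 'm vec_n1)" by (rule Umat_inj[OF P_Umat[OF M(1)]])
    then show False by (simp add: vec_n1_eq_iff)
  qed
  have "matrix_inv M *v (M *v f1) = matrix_inv M *v (\<mu> *s f1)" using M by simp
  then have "f1 = \<mu> *s (matrix_inv M *v f1)" using P_Umat[OF M(1)] by (simp add: smult_vector)
  then have "inverse \<mu> *s f1 = inverse \<mu> *s (\<mu> *s (matrix_inv M *v f1))" by simp
  then have inv: "matrix_inv M *v f1 = inverse \<mu> *s f1" using \<mu> by (simp only: vector_smult_assoc) simp
  show ?thesis
  proof (rule ccontr)
    assume "cmod \<mu> \<noteq> 1"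
    then consider "cmod \<mu> < 1" | "cmod \<mu> > 1" by linarith
    then show False
    proof cases
      case 1 then show False using no_contraction M \<mu> by blast
    next
      case 2
      then have "cmod (inverse \<mu>) < 1" by (simp add: norm_inverse inverse_less_1_iff)
      then show False using no_contraction[OF P_inv[OF M(1)] inv] \<mu> by simp
    qed
  qed
qed

text \<open>Rescaled by a unit scalar, an element fixing the cusp fixes \<open>f\<^sub>1\<close>. If it fixes a negative line, it
  is scalar. Otherwise it has no further isotropic fixed line, so it is parabolic, hence unipotent,
  hence a translation.\<close>

theorem stabiliser_translations:
  assumes M: "M \<in> P" "M *v f1 = \<mu> *s f1"
  obtains c s v where "cmod c = 1" "mat c ** M = hmat s v" "hmat s v \<in> P"
proof (cases "\<exists>x c. Re (herm x x) < 0 \<and> M *v x = c *s x")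
  case True
  then have "M \<in> U_scalars" using scalar_if_fixes_negative[OF M(1)] by blast
  then obtain d where d: "M = mat d" "cmod d = 1" unfolding U_scalars_def by auto
  then have "d \<noteq> 0" by auto
  then have "mat (inverse d) ** M = hmat 0 0"
    unfolding d hmat_0 by (intro mat_eqI) (simp add: mat_vector vector_smult_assoc flip: matrix_vector_mul_assoc)
  moreover have "cmod (inverse d) = 1" using d by (simp add: norm_inverse)
  ultimately show ?thesis using that[of "inverse d" 0 0] P_scalar[of 1] by simp
next
  case False
  have mu: "cmod \<mu> = 1" by (rule multiplier_unit[OF M])
  define N where "N = mat (cnj \<mu>) ** M"
  have mm: "cnj \<mu> * \<mu> = 1" using mu by (simp add: mult.commute flip: complex_norm_square)
  have NP: "N \<in> P" unfolding N_def using mu P_scalar P_mult M by simp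
  have N: "N *v x = cnj \<mu> *s (M *v x)" for x unfolding N_def by (simp add: mat_vector flip: matrix_vector_mul_assoc)
  have Nf1: "N *v f1 = f1" by (simp add: N M vector_smult_assoc mm)
  have b: "cb (N *v x) = cb x" for x using fixes_f1_cb[of N 1 x] P_Umat[OF NP] Nf1 by simp
  have MN: "M *v x = \<mu> *s (N *v x)" for x
    unfolding N vector_smult_assoc using mm by (simp add: mult.commute)
  \<comment> \<open>A second isotropic fixed vector would span with \<open>f\<^sub>1\<close> a plane of fixed vectors, some of
    which are negative.\<close>
  have "\<exists>d. z = d *s f1" if z: "z \<noteq> 0" "herm z z = 0" "M *v z = c *s z" for z c
  proof (rule ccontr)
    assume no: "\<nexists>d. z = d *s f1"
    have bz: "cb z \<noteq> 0"
    proof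
      assume b0: "cb z = 0"
      then have "cw z = 0" using z(2) by (simp add: herm_eq std_herm_self)
      then have "z = ca z *s f1" using b0 by (simp add: vec_n1_eq_iff)
      then show False using no by blast
    qed
    have Nz: "N *v z = (cnj \<mu> * c) *s z" unfolding N z(3) by (simp add: vector_smult_assoc)
    then have "cnj \<mu> * c = 1" using b[of z] bz by simp
    then have Nz: "N *v z = z" using Nz by simp
    define y where "y = inverse (cb z) *s z - f1"
    have "N *v y = y" unfolding y_def using Nz Nf1 by (simp add: matrix_vector_mult_diff_distrib smult_vector)
    then have "M *v y = \<mu> *s y" by (simp add: MN)
    moreover have "Re (herm y y) < 0"
      unfolding y_def using z(2) bz by simp
    ultimately show False using False by blast
  qed
  moreover have "f1 \<noteq> (0 :: 'm vec_n1)" by (simp add: vec_n1_eq_iff)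
  ultimately have "parabolic_mat M"
    unfolding parabolic_mat_def using False M P_Umat[OF M(1)]
    by (intro conjI exI[of _ f1]) auto
  then show ?thesis using parabolic_fixing_f1_translation[OF M(1) _ M(2)] that by blast
qed

definition \<Lambda> where "\<Lambda> = {(s, v). hmat s v \<in> P}"

lemma \<Lambda>_mult: "(s, v) \<in> \<Lambda> \<Longrightarrow> (s', v') \<in> \<Lambda> \<Longrightarrow> (s + s' + Im (std_herm v v'), v + v') \<in> \<Lambda>"
  unfolding \<Lambda>_def using P_mult hmat_mult by (metis (mono_tags, lifting) case_prod_conv mem_Collect_eq)

lemma \<Lambda>_inv: "(s, v) \<in> \<Lambda> \<Longrightarrow> (- s, - v) \<in> \<Lambda>"
  unfolding \<Lambda>_def using P_inv hmat_inv by (metis (mono_tags, lifting) case_prod_conv mem_Collect_eq)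

lemma \<Lambda>_0: "(0, 0) \<in> \<Lambda>"
  unfolding \<Lambda>_def using P_scalar[of 1] by simp

end

section \<open>The lattice of a cusp\<close>

definition horoset :: "real \<Rightarrow> 'm::finite Cn set" where
  "horoset c = {z. Re (z $ None) < - (norm (tail z))\<^sup>2 / 2 - c}"

lemma horoset_iff: "z \<in> horoset c \<longleftrightarrow> Re (herm (lift z) (lift z)) < - 2 * c"
  unfolding horoset_def by (simp add: herm_self lift_eq) auto

lemma heis_horoset: "z \<in> horoset c \<Longrightarrow> heis s v z \<in> horoset c"
  unfolding horoset_iff hmat_lift[symmetric] by (simp add: Umat_herm[OF hmat_Umat])

text \<open>The last assumption is how the compactness of the complement of the cusps enters: every point of
  the horosphere bounding the horoball can be moved by the group to a vector of bounded length.\<close>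

locale cusp_end = cusped_group P for P :: "'m::finite mat_n1 set" +
  fixes c :: real
  assumes c_pos: "c > 0"
    and precisely_invariant: "M \<in> P \<Longrightarrow> z \<in> horoset c \<Longrightarrow> z' \<in> horoset c \<Longrightarrow>
        M *v lift z = a *s lift z' \<Longrightarrow> \<exists>\<mu>. M *v f1 = \<mu> *s f1"
    and horosphere_recurrent: "\<exists>B. \<forall>w. \<exists>M\<in>P. norm (M *v lift (pair (- of_real (c + (norm w)\<^sup>2 / 2)) w)) \<le> B"
begin

text \<open>Move the points of the horosphere back into a compact set by elements of the group. In the
  limit, two of these elements differ by one which moves a point of the horoball to one of the
  horoball, and which therefore is a translation.\<close>

theorem translations_cocompact: "\<exists>r. \<forall>w. \<exists>(s, v)\<in>\<Lambda>. norm (w + v) \<le> r"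
proof (rule ccontr)
  assume "\<not> ?thesis"
  then have "\<exists>w. \<forall>(s, v)\<in>\<Lambda>. norm (w + v) > r" for r by (force simp: not_le)
  then obtain W where W: "\<And>r s v. (s, v) \<in> \<Lambda> \<Longrightarrow> norm (W r + v) > r" by (metis (mono_tags, lifting) case_prod_conv)
  obtain B where "\<And>w. \<exists>M\<in>P. norm (M *v lift (pair (- of_real (c + (norm w)\<^sup>2 / 2)) w)) \<le> B"
    using horosphere_recurrent by blast
  then obtain M where M: "\<And>w. M w \<in> P" "\<And>w. norm (M w *v lift (pair (- of_real (c + (norm w)\<^sup>2 / 2)) w)) \<le> B"
    by metis
  define p p' :: "'m vec_n1" where "p = vec3 1 (- of_real c) 0" and "p' = vec3 1 (- of_real (c + 1)) 0"
  have pneg: "Re (herm p p) < 0" unfolding p_def using c_pos by (simp add: herm_self)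
  define N where "N k = M (W (real k)) ** hmat 0 (W (real k))" for k :: nat
  have NU: "N k \<in> Umat" for k unfolding N_def by (intro Umat_mult P_Umat M hmat_Umat)
  have "norm (N k *v p) \<le> B" for k
  proof -
    have "hmat 0 w *v p = lift (pair (- of_real (c + (norm w)\<^sup>2 / 2)) w)" for w
      unfolding p_def hmat_vector lift_eq by (simp add: vec_n1_eq_iff)
    then show ?thesis unfolding N_def using M(2) by (simp flip: matrix_vector_mul_assoc)
  qed
  then obtain B' where "\<And>k. norm (N k) \<le> B'" using Umat_proper[OF pneg, of B] NU by metis
  then have "bounded (range N)" unfolding bounded_iff by auto
  then obtain L r where r: "strict_mono r" "(N \<circ> r) \<longlonglongrightarrow> L"
    using bounded_imp_convergent_subsequence by blast
  define E where "E j k = matrix_inv (N (r j)) ** N (r k)" for j k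
  let ?F = "sequentially \<times>\<^sub>F sequentially :: (nat \<times> nat) filter"
  have E1: "((\<lambda>q. E (fst q) (snd q)) \<longlongrightarrow> mat 1) ?F"
    using quotient_tendsto_1[OF _ r(2)] NU unfolding E_def by simp
  have "((\<lambda>q. (cmod (herm (E (fst q) (snd q) *v p') f1))\<^sup>2) \<longlongrightarrow> (cmod (herm (mat 1 *v p') f1))\<^sup>2) ?F"
    by (intro tendsto_intros E1)
  moreover have "(cmod (herm (mat 1 *v p') f1))\<^sup>2 < (c + 1) / c"
    unfolding p'_def using c_pos by simp
  ultimately have "\<forall>\<^sub>F q in ?F. (cmod (herm (E (fst q) (snd q) *v p') f1))\<^sup>2 < (c + 1) / c"
    by (rule order_tendstoD)
  moreover have "((\<lambda>q. cmod (herm (E (fst q) (snd q) *v f2) f2)) \<longlongrightarrow> cmod (herm (mat 1 *v f2) (f2 :: 'm vec_n1))) ?F"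
    by (intro tendsto_intros E1)
  then have "\<forall>\<^sub>F q in ?F. cmod (herm (E (fst q) (snd q) *v f2) f2) < 1"
    by (rule order_tendstoD) (simp add: herm_eq)
  ultimately have "\<forall>\<^sub>F q in ?F. (cmod (herm (E (fst q) (snd q) *v p') f1))\<^sup>2 < (c + 1) / c
      \<and> cmod (herm (E (fst q) (snd q) *v f2) f2) < 1" by (rule eventually_conj)
  then obtain K where K: "\<And>m n. m \<ge> K \<Longrightarrow> n \<ge> K \<Longrightarrow> (cmod (cb (E n m *v p')))\<^sup>2 < (c + 1) / c"
      "\<And>m n. m \<ge> K \<Longrightarrow> n \<ge> K \<Longrightarrow> cmod (ca (E n m *v f2)) < 1"
    unfolding eventually_prod_sequentially by (auto simp: herm_eq)
  define w where "w = W (real (r K))"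
  define k where "k = max K (nat \<lceil>norm w + 2\<rceil>)"
  have k: "k \<ge> K" "real k \<ge> norm w + 2" unfolding k_def by (auto simp: le_max_iff_disj) linarith
  define w' where "w' = W (real (r k))"
  have w': "norm (w' + v) > norm w + 2" if "(s, v) \<in> \<Lambda>" for s v
  proof -
    have "real k \<le> real (r k)" using seq_suble[OF r(1), of k] by simp
    then show ?thesis using W[OF that, of "real (r k)"] k unfolding w'_def by linarith
  qed
  define T where "T = matrix_inv (M w) ** M w'"
  have TP: "T \<in> P" unfolding T_def by (intro P_mult P_inv M)
  define e where "e = E K k"
  have Nw: "N (r K) = M w ** hmat 0 w" "N (r k) = M w' ** hmat 0 w'" unfolding N_def w_def w'_def by auto
  have T: "T *v (hmat 0 w' *v x) = hmat 0 w *v (e *v x)" for x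
  proof -
    have "M w *v (hmat 0 w *v (e *v x)) = M w' *v (hmat 0 w' *v x)"
      unfolding e_def E_def using NU[of "r K"]
      by (simp add: Nw matrix_vector_mul_assoc[symmetric] del: matrix_inv_vector)
        (metis Nw(1) matrix_inv_vector(2) matrix_vector_mul_assoc)
    then show ?thesis unfolding T_def
      using P_Umat[OF M(1)] by (metis matrix_inv_vector(1) matrix_vector_mul_assoc)
  qed
  have eU: "e \<in> Umat" unfolding e_def E_def by (intro Umat_mult Umat_inv NU)
  have p'H: "Re (herm p' p') = - 2 * (c + 1)" unfolding p'_def by (simp add: herm_self)
  have "Re (herm (e *v p') (e *v p')) < 0" unfolding Umat_herm[OF eU] p'H using c_pos by simp
  then obtain y where y: "y \<in> siegel" "e *v p' = cb (e *v p') *s lift y" "cb (e *v p') \<noteq> 0"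
    by (rule negative_lift)
  have "y \<in> horoset c"
  proof -
    define b where "b = (cmod (cb (e *v p')))\<^sup>2"
    have b: "0 < b" "b < (c + 1) / c" using y(3) K(1)[OF k(1), of K] unfolding b_def e_def by auto
    have "- 2 * (c + 1) = b * Re (herm (lift y) (lift y))"
      using smult_Re_herm[of "cb (e *v p')" "lift y"] unfolding y(2)[symmetric] Umat_herm[OF eU] p'H b_def by simp
    moreover have "b * c < c + 1" using b c_pos by (simp add: field_simps)
    ultimately have "b * Re (herm (lift y) (lift y)) < b * (- 2 * c)" by simp
    then show ?thesis unfolding horoset_iff using b by (simp only: mult_less_cancel_left_pos)
  qed
  have "lift (pair (- of_real (c + 1)) 0) = p'" unfolding p'_def lift_eq by simp
  then have "T *v lift (heis 0 w' (pair (- of_real (c + 1)) 0)) = cb (e *v p') *s lift (heis 0 w y)"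
    unfolding hmat_lift[symmetric] by (simp add: T) (metis smult_vector y(2))
  moreover have "pair (- of_real (c + 1)) 0 \<in> (horoset c :: 'm Cn set)" unfolding horoset_def by simp
  ultimately obtain \<mu> where "T *v f1 = \<mu> *s f1"
    using precisely_invariant[OF TP] heis_horoset \<open>y \<in> horoset c\<close> by blast
  then obtain d s v where d: "cmod d = 1" "mat d ** T = hmat s v" "hmat s v \<in> P"
    by (rule stabiliser_translations[OF TP])
  then have sv: "(s, v) \<in> \<Lambda>" unfolding \<Lambda>_def by simp
  have "d *s (e *v f2) = hmat 0 (- w) *v (d *s (hmat 0 w *v (e *v f2)))"
  proof -
    have "hmat 0 (- w) *v (hmat 0 w *v x) = x" for x
      using matrix_inv_vector(1)[OF hmat_Umat, of 0 w x] unfolding hmat_inv by simp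
    then show ?thesis by (simp add: smult_vector)
  qed
  also have "d *s (hmat 0 w *v (e *v f2)) = hmat s v *v (hmat 0 w' *v f2)"
    unfolding d(2)[symmetric] T[symmetric] by (simp add: mat_vector flip: matrix_vector_mul_assoc)
  also have "hmat 0 (- w) *v \<dots> = hmat 0 (- w) ** (hmat s v ** hmat 0 w') *v f2"
    by (simp flip: matrix_vector_mul_assoc)
  also obtain t where "hmat 0 (- w) ** (hmat s v ** hmat 0 w') = hmat t (- w + (v + w'))"
    unfolding hmat_mult by blast
  finally have "d *s (e *v f2) = hmat t (- w + (v + w')) *v f2" .
  from arg_cong[OF this, of ca]
  have "d * ca (e *v f2) = - of_real ((norm (- w + (v + w')))\<^sup>2 / 2) - \<i> * of_real t"
    by (simp add: hmat_vector)
  then have "\<bar>Re (- of_real ((norm (- w + (v + w')))\<^sup>2 / 2) - \<i> * of_real t)\<bar> \<le> cmod (d * ca (e *v f2))"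
    using abs_Re_le_cmod by metis
  also have "\<dots> < 1" using K(2)[OF k(1), of K] d(1) unfolding e_def by (simp add: norm_mult)
  finally have "(norm (- w + (v + w')))\<^sup>2 < 2\<^sup>2" by (simp del: of_real_power)
  then have "norm (- w + (v + w')) < 2" by (rule power_less_imp_less_base) simp
  then have "norm (w' + v) \<le> norm w + 2"
    using norm_triangle_ineq[of w "- w + (v + w')"] by (simp add: add.commute)
  then show False using w'[OF sv] by simp
qed

text \<open>Translations close to large multiples of \<open>e\<close> and \<open>\<i> e\<close>, for a unit vector \<open>e\<close>, do not commute;
  their commutator is central.\<close>

lemma exists_central: obtains s where "s > 0" "(s, 0) \<in> \<Lambda>"
proof -
  obtain r where r: "\<And>w. \<exists>(s, v)\<in>\<Lambda>. norm (w + v) \<le> r" using translations_cocompact by blast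
  have r0: "r \<ge> 0" using r[of 0] by (auto intro: order_trans[OF norm_ge_zero])
  define X where "X = 3 * r + 1"
  define x y :: "complex^'m" where "x = axis undefined (of_real X)" and "y = axis undefined (\<i> * of_real X)"
  have X0: "X \<ge> 0" unfolding X_def using r0 by simp
  then have nx: "norm x = X" "norm y = X" unfolding x_def y_def norm_axis by (simp_all add: norm_mult)
  have xy: "std_herm x y = \<i> * of_real (X * X)"
    unfolding x_def y_def std_herm_def by (simp add: axis_def if_distrib if_distribR cong: if_cong)
  obtain s1 v1 s2 v2 where 1: "(s1, v1) \<in> \<Lambda>" "norm (- x + v1) \<le> r" and 2: "(s2, v2) \<in> \<Lambda>" "norm (- y + v2) \<le> r"
    using r[of "- x"] r[of "- y"] by blast
  define d1 d2 where "d1 = - x + v1" and "d2 = - y + v2"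
  have v: "v1 = x + d1" "v2 = y + d2" unfolding d1_def d2_def by simp_all
  have d: "norm d1 \<le> r" "norm d2 \<le> r" using 1 2 unfolding d1_def d2_def by auto
  have "cmod (std_herm x d2) \<le> X * r" "cmod (std_herm d1 y) \<le> r * X" "cmod (std_herm d1 d2) \<le> r * r"
    using norm_std_herm_le[of x d2] norm_std_herm_le[of d1 y] norm_std_herm_le[of d1 d2]
      mult_left_mono[OF d(2) X0] mult_right_mono[OF d(1) X0] mult_mono[OF d r0 norm_ge_zero]
    unfolding nx by linarith+
  moreover have "Im (std_herm v1 v2) =
      X * X + Im (std_herm x d2) + Im (std_herm d1 y) + Im (std_herm d1 d2)"
    unfolding v by (simp add: xy)
  ultimately have "Im (std_herm v1 v2) \<ge> X * X - X * r - r * X - r * r"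
    using abs_Im_le_cmod[of "std_herm x d2"] abs_Im_le_cmod[of "std_herm d1 y"]
      abs_Im_le_cmod[of "std_herm d1 d2"] by linarith
  moreover have "X * X - X * r - r * X - r * r = 2 * (r * r) + 4 * r + 1" unfolding X_def by (simp add: algebra_simps)
  moreover have "r * r \<ge> 0" using r0 by simp
  ultimately have I: "Im (std_herm v1 v2) > 0" using r0 by linarith
  have sw: "Im (std_herm v2 v1) = - Im (std_herm v1 v2)" "Im (std_herm v1 v1) = 0" "Im (std_herm v2 v2) = 0"
    using std_herm_commute[of v2 v1] by (simp_all add: std_herm_self)
  have "(s1 + s2 + Im (std_herm v1 v2), v1 + v2) \<in> \<Lambda>" by (rule \<Lambda>_mult[OF 1(1) 2(1)])
  from \<Lambda>_mult[OF this \<Lambda>_inv[OF 1(1)]] have "(2 * Im (std_herm v1 v2) + s2, v2) \<in> \<Lambda>" by (simp add: sw)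
  from \<Lambda>_mult[OF this \<Lambda>_inv[OF 2(1)]] have "(2 * Im (std_herm v1 v2), 0) \<in> \<Lambda>" by (simp add: sw)
  then show ?thesis using that[of "2 * Im (std_herm v1 v2)"] I by simp
qed

text \<open>A discrete subgroup of the real line is generated by its least positive element.\<close>

lemma central_period_ex1:
  "\<exists>!l. l > 0 \<and> {s. (s, 0) \<in> \<Lambda>} = range (\<lambda>k::int. of_int k * l)"
proof -
  define S where "S = {s. (s, 0) \<in> \<Lambda>}"
  have S_add: "s + t \<in> S" if "s \<in> S" "t \<in> S" for s t using \<Lambda>_mult[of s 0 t 0] that unfolding S_def by simp
  have S_neg: "- s \<in> S" if "s \<in> S" for s using \<Lambda>_inv[of s 0] that unfolding S_def by simp
  have S_nat: "of_nat k * s \<in> S" if "s \<in> S" for k :: nat and s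
  proof (induction k)
    case 0 then show ?case using \<Lambda>_0 unfolding S_def by simp
  next
    case (Suc k)
    have "of_nat (Suc k) * s = s + of_nat k * s" by (simp add: algebra_simps)
    then show ?case using S_add[OF that Suc] by simp
  qed
  have S_int: "of_int k * s \<in> S" if "s \<in> S" for k :: int and s
    using S_nat[OF that, of "nat k"] S_neg[OF S_nat[OF that, of "nat (- k)"]]
    by (cases "k \<ge> 0") auto
  obtain s0 where s0: "s0 > 0" "s0 \<in> S" using exists_central unfolding S_def by blast
  define F where "F = {s \<in> S. 0 < s \<and> s \<le> s0}"
  have "(\<lambda>s. (s, 0)) ` F \<subseteq> {(s, v). hmat s v \<in> P \<and> \<bar>s\<bar> \<le> s0 \<and> norm v \<le> s0}"
    unfolding F_def S_def \<Lambda>_def by auto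
  then have "finite ((\<lambda>s. (s, 0 :: complex^'m)) ` F)" using finitely_many_translations finite_subset by blast
  then have F: "finite F" by (rule finite_imageD) (auto intro: inj_onI)
  have "s0 \<in> F" using s0 unfolding F_def by simp
  define l where "l = Min F"
  have "l \<in> F" unfolding l_def using F \<open>s0 \<in> F\<close> by (intro Min_in) auto
  then have l: "l > 0" "l \<in> S" "l \<le> s0" unfolding F_def by auto
  have least: "l \<le> s" if "s \<in> S" "s > 0" for s
  proof (cases "s \<le> s0")
    case True
    then show ?thesis unfolding l_def using F that by (intro Min_le) (auto simp: F_def)
  qed (use l in simp)
  have "S = range (\<lambda>k::int. of_int k * l)"
  proof
    show "range (\<lambda>k::int. of_int k * l) \<subseteq> S" using S_int[OF l(2)] by auto
    show "S \<subseteq> range (\<lambda>k::int. of_int k * l)"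
    proof
      fix s assume s: "s \<in> S"
      define k where "k = \<lfloor>s / l\<rfloor>"
      let ?t = "s - of_int k * l"
      have "?t \<in> S" using S_add[OF s S_neg[OF S_int[OF l(2)]]] by simp
      moreover have "?t < l" "?t \<ge> 0"
      proof -
        have "of_int k \<le> s / l" "s / l < of_int k + 1" unfolding k_def using floor_correct by auto
        then have "of_int k * l \<le> s" "s < of_int k * l + l"
          using l(1) by (simp_all add: field_simps)
        then show "?t < l" "?t \<ge> 0" by linarith+
      qed
      ultimately have "?t = 0" using least[of ?t] by linarith
      then show "s \<in> range (\<lambda>k::int. of_int k * l)" by auto
    qed
  qed
  moreover have "l' = l" if l': "l' > 0" "S = range (\<lambda>k::int. of_int k * l')" for l'
  proof (rule antisym)
    have "l' \<in> S" unfolding l'(2) by (intro image_eqI[of _ _ 1]) auto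
    then show "l \<le> l'" using least l' by blast
    obtain k :: int where k: "l = of_int k * l'" using l(2) unfolding l'(2) by blast
    then have "k > 0" using l(1) l'(1) by (simp add: zero_less_mult_iff)
    then have "1 * l' \<le> of_int k * l'" using l'(1) by (intro mult_right_mono) auto
    then show "l' \<le> l" using k by simp
  qed
  ultimately show ?thesis using l(1) unfolding S_def by (intro ex1I[of _ l]) auto
qed

definition period where "period = (THE l. l > 0 \<and> {s. (s, 0) \<in> \<Lambda>} = range (\<lambda>k::int. of_int k * l))"

lemma period: "period > 0" "{s. (s, 0) \<in> \<Lambda>} = range (\<lambda>k::int. of_int k * period)"
  using theI'[OF central_period_ex1] unfolding period_def by auto

text \<open>Central translations reduce \<open>s\<close> modulo the period without changing \<open>v\<close>, which leaves finitely many
  translations with \<open>v\<close> small.\<close>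

lemma translation_parts_discrete: obtains e where "e > 0" "\<And>s v. (s, v) \<in> \<Lambda> \<Longrightarrow> norm v < e \<Longrightarrow> v = 0"
proof -
  let ?B = "max 1 period"
  let ?F = "{(s, v). hmat s v \<in> P \<and> \<bar>s\<bar> \<le> ?B \<and> norm v \<le> ?B}"
  let ?E = "insert 1 ((\<lambda>p. norm (snd p)) ` ?F - {0})"
  have fin: "finite ?E" using finitely_many_translations[of ?B] by simp
  define e where "e = Min ?E"
  have "e \<in> ?E" unfolding e_def by (rule Min_in[OF fin]) simp
  then have e: "e > 0" by auto
  have e1: "e \<le> 1" unfolding e_def using fin by (intro Min_le) auto
  have "v = 0" if sv: "(s, v) \<in> \<Lambda>" "norm v < e" for s v
  proof (rule ccontr)
    assume v: "v \<noteq> 0"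
    define k where "k = \<lfloor>s / period\<rfloor>"
    have "- (of_int k * period) \<in> {s. (s, 0) \<in> \<Lambda>}"
      unfolding period(2) by (intro image_eqI[of _ _ "- k"]) auto
    then have "(- (of_int k * period), 0) \<in> \<Lambda>" by simp
    from \<Lambda>_mult[OF sv(1) this] have "(s - of_int k * period, v) \<in> \<Lambda>" by simp
    moreover have "\<bar>s - of_int k * period\<bar> \<le> period"
    proof -
      have "of_int k \<le> s / period" "s / period < of_int k + 1" unfolding k_def using floor_correct by auto
      then have "of_int k * period \<le> s" "s < of_int k * period + period"
        using period(1) by (simp_all add: field_simps)
      then show ?thesis by linarith
    qed
    ultimately have "(s - of_int k * period, v) \<in> ?F" using sv(2) e1 unfolding \<Lambda>_def by auto
    then have "norm v \<in> ?E" using v by (auto intro!: image_eqI[of _ _ "(s - of_int k * period, v)"])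
    then have "e \<le> norm v" unfolding e_def using fin by (intro Min_le)
    then show False using sv(2) by simp
  qed
  then show ?thesis using that e by blast
qed

end

section \<open>Representatives of subgroups of PU(n,1)\<close>

text \<open>The element of PU(n,1) represented by a matrix.\<close>

abbreviation cls :: "'m::finite mat_n1 \<Rightarrow> 'm pu" where "cls M \<equiv> U_scalars #>\<^bsub>U_n1\<^esub> M"

lemma U_n1_simps: "carrier U_n1 = Umat" "mult U_n1 = (**)" "one U_n1 = mat 1"
  unfolding Umat_def by (simp_all add: U_n1_def)

lemma mat_mat: "mat c ** mat d = (mat (c * d) :: complex^'n^'n)"
  by (rule mat_eqI) (simp add: mat_vector vector_smult_assoc flip: matrix_vector_mul_assoc)

lemma cls_iff: "N \<in> cls M \<longleftrightarrow> (\<exists>c. cmod c = 1 \<and> N = mat c ** M)"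
  unfolding r_coset_def U_scalars_def U_n1_simps by auto

lemma U_scalars_iff: "M \<in> U_scalars \<longleftrightarrow> (\<exists>c. cmod c = 1 \<and> M = mat c)"
  unfolding U_scalars_def by auto

lemma cls_self: "M \<in> cls M"
  unfolding cls_iff by (rule exI[of _ 1]) simp

lemma cls_scalar: assumes "cmod c = 1" shows "cls (mat c ** M) = cls M"
proof -
  have c: "c \<noteq> 0" using assms by auto
  have "N \<in> cls (mat c ** M) \<longleftrightarrow> N \<in> cls M" for N
  proof
    assume "N \<in> cls (mat c ** M)"
    then obtain d where "cmod d = 1" "N = mat (d * c) ** M" unfolding cls_iff by (auto simp: matrix_mul_assoc mat_mat)
    then show "N \<in> cls M" unfolding cls_iff using assms by (metis norm_mult mult_1)
  next
    assume "N \<in> cls M"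
    then obtain d where d: "cmod d = 1" "N = mat d ** M" unfolding cls_iff by auto
    have "N = mat (d * inverse c) ** (mat c ** M)" unfolding d(2) using c by (simp add: matrix_mul_assoc mat_mat mult.assoc)
    moreover have "cmod (d * inverse c) = 1" using d(1) assms by (simp add: norm_mult norm_inverse)
    ultimately show "N \<in> cls (mat c ** M)" unfolding cls_iff by blast
  qed
  then show ?thesis by blast
qed

lemma group_PU: "group (PU :: 'm::finite pu monoid)"
  unfolding PU_def by (rule normal.factorgroup_is_group[OF U_scalars_normal])

lemma carrier_PU: "carrier PU = cls ` Umat"
  unfolding PU_def FactGroup_def RCOSETS_def U_n1_simps by auto

lemma cls_1: "cls (mat 1) = U_scalars"
  by (simp add: set_eq_iff cls_iff U_scalars_iff)

lemma one_PU: "\<one>\<^bsub>PU\<^esub> = cls (mat 1)"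
  unfolding PU_def FactGroup_def by (simp add: cls_1)

lemma mult_PU: "M \<in> Umat \<Longrightarrow> N \<in> Umat \<Longrightarrow> cls M \<otimes>\<^bsub>PU\<^esub> cls N = cls (M ** N)"
  unfolding PU_def FactGroup_def using normal.rcos_sum[OF U_scalars_normal, of M N] by (simp add: U_n1_simps)

lemma inv_PU: assumes "M \<in> Umat" shows "inv\<^bsub>PU\<^esub> (cls M) = cls (matrix_inv M)"
proof (rule group.inv_equality[OF group_PU])
  show "cls (matrix_inv M) \<otimes>\<^bsub>PU\<^esub> cls M = \<one>\<^bsub>PU\<^esub>"
    using assms by (simp add: mult_PU Umat_inv Umat_matrix_inv one_PU)
qed (use assms Umat_inv in \<open>auto simp: carrier_PU\<close>)

lemma cls_one_iff: "cls M = \<one>\<^bsub>PU\<^esub> \<longleftrightarrow> M \<in> U_scalars"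
proof
  assume "cls M = \<one>\<^bsub>PU\<^esub>"
  then show "M \<in> U_scalars" using cls_self[of M] unfolding one_PU by (simp add: cls_iff U_scalars_iff)
next
  assume "M \<in> U_scalars"
  then obtain c where "cmod c = 1" "M = mat c ** mat 1" unfolding U_scalars_def by auto
  then show "cls M = \<one>\<^bsub>PU\<^esub>" unfolding one_PU using cls_scalar by metis
qed

lemma line_iff: "y \<in> line x \<longleftrightarrow> (\<exists>c. y = c *s x)"
  unfolding line_def by auto

lemma line_smult: "c \<noteq> 0 \<Longrightarrow> line (c *s x) = line x"
proof -
  assume c: "c \<noteq> 0"
  have "d *s x = (d * inverse c) *s (c *s x)" for d using c by (simp add: vector_smult_assoc)
  then show ?thesis unfolding set_eq_iff line_iff by (metis vector_smult_assoc)
qed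

lemma line_eqE:
  assumes "line x = line y" "x \<noteq> 0" obtains c where "c \<noteq> 0" "x = c *s y"
proof -
  have "x \<in> line x" unfolding line_iff by (rule exI[of _ 1]) simp
  then have "x \<in> line y" using assms by simp
  then obtain c where "x = c *s y" unfolding line_iff by blast
  then show ?thesis using that assms(2) by (cases "c = 0") auto
qed

lemma act_cls: "act (cls M) (line x) = line (M *v x)"
proof -
  have "y \<in> act (cls M) (line x) \<longleftrightarrow> y \<in> line (M *v x)" for y
  proof
    assume "y \<in> act (cls M) (line x)"
    then obtain B where B: "B \<in> cls M" "y \<in> (*v) B ` line x" unfolding act_def by blast
    obtain c where "B = mat c ** M" using B(1) cls_iff by blast
    moreover obtain d where "y = B *v (d *s x)" using B(2) unfolding line_def by blast
    ultimately have "y = mat c ** M *v (d *s x)" by simp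
    then have "y = (c * d) *s (M *v x)" by (simp add: mat_vector smult_vector vector_smult_assoc flip: matrix_vector_mul_assoc)
    then show "y \<in> line (M *v x)" unfolding line_iff by blast
  next
    assume "y \<in> line (M *v x)"
    then obtain c where "y = M *v (c *s x)" unfolding line_iff by (auto simp: smult_vector)
    then show "y \<in> act (cls M) (line x)" unfolding act_def line_def using cls_self by blast
  qed
  then show ?thesis by blast
qed

lemma Umat_nonzero: "M \<in> Umat \<Longrightarrow> x \<noteq> 0 \<Longrightarrow> M *v x \<noteq> 0"
  using Umat_inj[of M x 0] by auto

lemma line_fixed_iff:
  assumes "M \<in> Umat" "x \<noteq> 0"
  shows "line (M *v x) = line x \<longleftrightarrow> (\<exists>c. M *v x = c *s x)"
proof
  assume "line (M *v x) = line x"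
  then show "\<exists>c. M *v x = c *s x" using line_eqE Umat_nonzero[OF assms] by metis
next
  assume "\<exists>c. M *v x = c *s x"
  then obtain c where c: "M *v x = c *s x" by blast
  then have "c \<noteq> 0" using Umat_nonzero[OF assms] by auto
  then show "line (M *v x) = line x" unfolding c by (rule line_smult)
qed

lemma parabolic_iff:
  assumes M: "M \<in> Umat" shows "parabolic (cls M) \<longleftrightarrow> parabolic_mat M"
proof -
  have neg0: "x \<noteq> 0" if "Re (herm x x) < 0" for x :: "'a vec_n1" using that by auto
  have "(\<forall>L\<in>CH. act (cls M) L \<noteq> L) \<longleftrightarrow> (\<forall>x. Re (herm x x) < 0 \<longrightarrow> line (M *v x) \<noteq> line x)"
    unfolding CH_def by (auto simp: act_cls)
  also have "\<dots> \<longleftrightarrow> (\<forall>x c. Re (herm x x) < 0 \<longrightarrow> M *v x \<noteq> c *s x)"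
    using line_fixed_iff[OF M neg0] by blast
  finally have 1: "(\<forall>L\<in>CH. act (cls M) L \<noteq> L) \<longleftrightarrow> (\<forall>x c. Re (herm x x) < 0 \<longrightarrow> M *v x \<noteq> c *s x)" .
  have B: "\<xi> \<in> CH_boundary \<and> act (cls M) \<xi> = \<xi> \<longleftrightarrow>
      (\<exists>y. \<xi> = line y \<and> y \<noteq> 0 \<and> herm y y = 0 \<and> (\<exists>c. M *v y = c *s y))" for \<xi>
  proof
    assume "\<xi> \<in> CH_boundary \<and> act (cls M) \<xi> = \<xi>"
    then obtain y where y: "\<xi> = line y" "y \<noteq> 0" "herm y y = 0" "act (cls M) (line y) = line y"
      unfolding CH_boundary_def by blast
    then show "\<exists>y. \<xi> = line y \<and> y \<noteq> 0 \<and> herm y y = 0 \<and> (\<exists>c. M *v y = c *s y)"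
      using line_fixed_iff[OF M y(2)] unfolding act_cls by blast
  next
    assume "\<exists>y. \<xi> = line y \<and> y \<noteq> 0 \<and> herm y y = 0 \<and> (\<exists>c. M *v y = c *s y)"
    then obtain y where y: "\<xi> = line y" "y \<noteq> 0" "herm y y = 0" "\<exists>c. M *v y = c *s y" by blast
    then show "\<xi> \<in> CH_boundary \<and> act (cls M) \<xi> = \<xi>"
      using line_fixed_iff[OF M y(2)] unfolding CH_boundary_def y(1) act_cls by blast
  qed
  have "(\<exists>!\<xi>. \<xi> \<in> CH_boundary \<and> act (cls M) \<xi> = \<xi>) \<longleftrightarrow>
     (\<exists>y. y \<noteq> 0 \<and> herm y y = 0 \<and> (\<exists>c. M *v y = c *s y) \<and>
        (\<forall>z. z \<noteq> 0 \<and> herm z z = 0 \<and> (\<exists>c. M *v z = c *s z) \<longrightarrow> (\<exists>d. z = d *s y)))" (is "?L \<longleftrightarrow> ?R")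
  proof
    assume ?L
    then obtain \<xi> where \<xi>: "\<xi> \<in> CH_boundary \<and> act (cls M) \<xi> = \<xi>"
      "\<And>\<eta>. \<eta> \<in> CH_boundary \<and> act (cls M) \<eta> = \<eta> \<Longrightarrow> \<eta> = \<xi>" by (elim ex1E) blast
    obtain y where y: "\<xi> = line y" "y \<noteq> 0" "herm y y = 0" "\<exists>c. M *v y = c *s y" using \<xi>(1) unfolding B by blast
    have "\<exists>d. z = d *s y" if "z \<noteq> 0 \<and> herm z z = 0 \<and> (\<exists>c. M *v z = c *s z)" for z
    proof -
      have "line z = line y" using \<xi>(2)[of "line z"] that y(1) unfolding B by blast
      then show ?thesis using line_eqE that by metis
    qed
    then show ?R using y by blast
  next
    assume ?R
    then obtain y where y: "y \<noteq> 0" "herm y y = 0" "\<exists>c. M *v y = c *s y"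
      "\<And>z. z \<noteq> 0 \<and> herm z z = 0 \<and> (\<exists>c. M *v z = c *s z) \<Longrightarrow> \<exists>d. z = d *s y" by blast
    show ?L unfolding B
    proof (rule ex1I[of _ "line y"])
      show "\<exists>y'. line y = line y' \<and> y' \<noteq> 0 \<and> herm y' y' = 0 \<and> (\<exists>c. M *v y' = c *s y')" using y by blast
      fix \<eta> assume "\<exists>z. \<eta> = line z \<and> z \<noteq> 0 \<and> herm z z = 0 \<and> (\<exists>c. M *v z = c *s z)"
      then obtain z where z: "\<eta> = line z" "z \<noteq> 0" "herm z z = 0" "\<exists>c. M *v z = c *s z" by blast
      then obtain d where d: "z = d *s y" using y(4) by blast
      then have "d \<noteq> 0" using z(2) by auto
      then show "\<eta> = line y" unfolding z(1) d by (rule line_smult)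
    qed
  qed
  then show ?thesis
    unfolding parabolic_def parabolic_mat_def 1 using M by (auto simp: carrier_PU)
qed

lemma unipotent_cls: "unipotent (cls M) \<Longrightarrow> \<exists>c. cmod c = 1 \<and> nilpotent_mat (mat c ** M - mat 1)"
proof -
  assume "unipotent (cls M)"
  then obtain B where B: "B \<in> cls M" "nilpotent_mat (B - mat 1)"
    unfolding unipotent_def nilpotent_mat_def by blast
  obtain c where "cmod c = 1" "B = mat c ** M" using iffD1[OF cls_iff B(1)] by blast
  then show ?thesis using B(2) by blast
qed

text \<open>The negative vectors form an open set, and a linear map with an open set of eigenvectors is
  scalar: compare the eigenvalues at three points of a short segment.\<close>

lemma fixes_negative_lines_scalar:
  fixes N :: "'m::finite mat_n1"
  assumes N: "\<And>x. Re (herm x x) < 0 \<Longrightarrow> \<exists>c. N *v x = c *s x"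
  obtains c where "N = mat c"
proof -
  define x0 :: "'m vec_n1" where "x0 = f2 - f1"
  have x0: "Re (herm x0 x0) < 0" unfolding x0_def by (simp add: herm_self)
  then obtain c0 where c0: "N *v x0 = c0 *s x0" using N by blast
  have "N *v y = c0 *s y" for y
  proof (cases "\<exists>d. y = d *s x0")
    case True
    then show ?thesis using c0 by (auto simp: smult_vector vector_smult_assoc mult.commute)
  next
    case False
    have "((\<lambda>t :: real. Re (herm (x0 + of_real t *s y) (x0 + of_real t *s y))) \<longlongrightarrow>
        Re (herm (x0 + of_real 0 *s y) (x0 + of_real 0 *s y))) (at 0)"
      unfolding herm_simps by (intro tendsto_intros)
    then have "\<forall>\<^sub>F t :: real in at 0. Re (herm (x0 + of_real t *s y) (x0 + of_real t *s y)) < 0"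
      by (rule order_tendstoD(2)) (use x0 in simp)
    then obtain d where d: "d > 0" "\<And>t. t \<noteq> 0 \<Longrightarrow> \<bar>t\<bar> < d \<Longrightarrow> Re (herm (x0 + of_real t *s y) (x0 + of_real t *s y)) < 0"
      unfolding eventually_at by (auto simp: dist_real_def)
    define t where "t = d / 2"
    have t: "t \<noteq> 0" "\<bar>t\<bar> < d" "t / 2 \<noteq> 0" "\<bar>t / 2\<bar> < d" unfolding t_def using d(1) by auto
    obtain c c' where c: "N *v (x0 + of_real t *s y) = c *s (x0 + of_real t *s y)"
      "N *v (x0 + of_real (t / 2) *s y) = c' *s (x0 + of_real (t / 2) *s y)"
      using N[OF d(2)[OF t(1,2)]] N[OF d(2)[OF t(3,4)]] by blast
    define T where "T = complex_of_real t"
    have T: "T \<noteq> 0" unfolding T_def using t by simp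
    have e: "T *s (N *v y) = (c - c0) *s x0 + (c * T) *s y"
      "T *s (N *v y) = (2 * (c' - c0)) *s x0 + (c' * T) *s y"
    proof -
      have h: "2 *s x0 + T *s y = 2 *s (x0 + of_real (t / 2) *s y)"
        unfolding T_def by (simp add: vec_eq_iff)
      have "N *v (2 *s x0 + T *s y) = c' *s (2 *s x0 + T *s y)"
        unfolding h smult_vector c(2) by (simp add: vector_smult_assoc mult.commute)
      then show "T *s (N *v y) = (2 * (c' - c0)) *s x0 + (c' * T) *s y"
        by (simp add: matrix_vector_right_distrib smult_vector c0 vec_eq_iff algebra_simps)
      show "T *s (N *v y) = (c - c0) *s x0 + (c * T) *s y"
        using c(1) unfolding T_def[symmetric]
        by (simp add: matrix_vector_right_distrib smult_vector c0 vec_eq_iff algebra_simps)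
    qed
    have "(c - c0) *s x0 + (c * T) *s y = (2 * (c' - c0)) *s x0 + (c' * T) *s y" using e by simp
    then have "((c - c') * T) *s y = (2 * (c' - c0) - (c - c0)) *s x0"
      by (simp add: vec_eq_iff algebra_simps)
    moreover have "z *s y = w *s x0 \<Longrightarrow> z = 0" for z w
    proof (rule ccontr)
      assume zy: "z *s y = w *s x0" and z: "z \<noteq> 0"
      have "y = inverse z *s (z *s y)" using z by (simp add: vector_smult_assoc)
      then have "y = (inverse z * w) *s x0" unfolding zy by (simp add: vector_smult_assoc)
      then show False using False by blast
    qed
    ultimately have cc: "(c - c') * T = 0" "(2 * (c' - c0) - (c - c0)) *s x0 = 0" by (metis, metis vector_smult_lzero)
    have "x0 \<noteq> 0" using x0 by auto
    then have "2 * (c' - c0) - (c - c0) = 0" using cc(2) vector_mul_eq_0 by blast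
    moreover have "c = c'" using cc(1) T by simp
    ultimately have "c = c0" by simp
    then have "T *s (N *v y) = T *s (c0 *s y)" using e(1) by (simp add: vector_smult_assoc mult.commute)
    then show ?thesis using T vector_mul_lcancel by blast
  qed
  then have "N = mat c0" by (intro mat_eqI) (simp add: mat_vector)
  then show ?thesis by (rule that)
qed

section \<open>The cusps of the quotient\<close>

text \<open>The isometries representing elements of \<open>\<Gamma>\<close>, in the basis given by the frame \<open>A\<close>.\<close>

definition frame_group :: "'m::finite pu set \<Rightarrow> 'm mat_n1 \<Rightarrow> 'm mat_n1 set" where
  "frame_group \<Gamma> A = {N. A ** N ** matrix_inv A \<in> \<Union>\<Gamma>}"

lemma Union_iff:
  assumes "subgroup \<Gamma> PU" shows "M \<in> \<Union>\<Gamma> \<longleftrightarrow> M \<in> Umat \<and> cls M \<in> \<Gamma>"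
proof
  assume "M \<in> \<Union>\<Gamma>"
  then obtain g where g: "g \<in> \<Gamma>" "M \<in> g" by blast
  then have "g \<in> cls ` Umat" using subgroup.subset[OF assms] unfolding carrier_PU by blast
  then obtain N where N: "N \<in> Umat" "g = cls N" by blast
  obtain d where d: "cmod d = 1" "M = mat d ** N" using g(2) iffD1[OF cls_iff] unfolding N(2) by metis
  have "M \<in> Umat" unfolding d(2) by (rule Umat_mult[OF mat_scalar_Umat[OF d(1)] N(1)])
  moreover have "cls M = g" unfolding d(2) N(2) by (rule cls_scalar[OF d(1)])
  ultimately show "M \<in> Umat \<and> cls M \<in> \<Gamma>" using g by simp
qed (use cls_self in blast)

lemma conj_Umat [simp]: "A \<in> Umat \<Longrightarrow> A ** (matrix_inv A ** M ** A) ** matrix_inv A = M"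
  by (rule mat_eqI) (simp flip: matrix_vector_mul_assoc)

lemma matrix_inv_inv: assumes "A \<in> Umat" shows "matrix_inv (matrix_inv A) = A"
  using matrix_inv_vector(1)[OF Umat_inv[OF assms], of "A *v x" for x] assms
  by (intro mat_eqI) simp

lemma conj_vector:
  "A \<in> Umat \<Longrightarrow> (A ** N ** matrix_inv A) *v (A *v x) = A *v (N *v x)"
  by (simp flip: matrix_vector_mul_assoc)

lemma conj_mult:
  assumes "A \<in> Umat"
  shows "A ** (M ** N) ** matrix_inv A = (A ** M ** matrix_inv A) ** (A ** N ** matrix_inv A)"
  by (rule mat_eqI) (use assms in \<open>simp flip: matrix_vector_mul_assoc\<close>)

lemma conj_inv:
  assumes A: "A \<in> Umat" and N: "N \<in> Umat"
  shows "A ** matrix_inv N ** matrix_inv A = matrix_inv (A ** N ** matrix_inv A)"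
proof (rule mat_eqI)
  fix x
  let ?M = "A ** N ** matrix_inv A"
  have M: "?M \<in> Umat" by (intro Umat_mult Umat_inv A N)
  have "?M *v (A ** matrix_inv N ** matrix_inv A *v x) = x"
    using A N by (simp flip: matrix_vector_mul_assoc)
  then show "A ** matrix_inv N ** matrix_inv A *v x = matrix_inv ?M *v x"
    using matrix_inv_vector(1)[OF M] by metis
qed

lemma conj_scalar: "A \<in> Umat \<Longrightarrow> A ** mat c ** matrix_inv A = mat c"
  by (rule mat_eqI) (simp add: mat_vector smult_vector flip: matrix_vector_mul_assoc)

lemma conj_in_Umat: "A \<in> Umat \<Longrightarrow> A ** N ** matrix_inv A \<in> Umat \<longleftrightarrow> N \<in> Umat"
proof
  assume A: "A \<in> Umat" and M: "A ** N ** matrix_inv A \<in> Umat"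
  have "matrix_inv A ** (A ** N ** matrix_inv A) ** A \<in> Umat"
    by (rule Umat_mult[OF Umat_mult[OF Umat_inv[OF A] M] A])
  moreover have "matrix_inv A ** (A ** N ** matrix_inv A) ** A = N"
    by (rule mat_eqI) (use A in \<open>simp flip: matrix_vector_mul_assoc\<close>)
  ultimately show "N \<in> Umat" by simp
qed (intro Umat_mult Umat_inv)

lemma conj_in_scalars: assumes A: "A \<in> Umat" shows "A ** N ** matrix_inv A \<in> U_scalars \<longleftrightarrow> N \<in> U_scalars"
proof
  assume "A ** N ** matrix_inv A \<in> U_scalars"
  then obtain d where d: "cmod d = 1" "A ** N ** matrix_inv A = mat d" unfolding U_scalars_iff by blast
  have "A *v (N *v x) = A *v (mat d *v x)" for x
    using conj_vector[OF A, of N x] unfolding d(2) by (simp add: mat_vector smult_vector)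
  then have "N = mat d" using Umat_inj[OF A] by (intro mat_eqI) blast
  then show "N \<in> U_scalars" using d unfolding U_scalars_iff by blast
next
  assume "N \<in> U_scalars"
  then obtain d where "cmod d = 1" "N = mat d" unfolding U_scalars_iff by blast
  then show "A ** N ** matrix_inv A \<in> U_scalars" using conj_scalar[OF A, of d] unfolding U_scalars_iff by metis
qed

lemma conj_eigen: assumes A: "A \<in> Umat"
  shows "(A ** N ** matrix_inv A) *v (A *v x) = d *s (A *v x) \<longleftrightarrow> N *v x = d *s x"
proof -
  have "(A ** N ** matrix_inv A) *v (A *v x) = d *s (A *v x) \<longleftrightarrow> A *v (N *v x) = A *v (d *s x)"
    unfolding conj_vector[OF A] smult_vector ..
  then show ?thesis using Umat_inj[OF A] by metis
qed

lemma conj_parabolic: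
  assumes A: "A \<in> Umat" and N: "parabolic_mat N"
  shows "parabolic_mat (A ** N ** matrix_inv A)"
proof -
  let ?M = "A ** N ** matrix_inv A"
  have AA: "A *v (matrix_inv A *v x) = x" for x using A by simp
  have h: "herm (matrix_inv A *v x) (matrix_inv A *v y) = herm x y" for x y
    by (rule Umat_herm[OF Umat_inv[OF A]])
  have e: "?M *v x = d *s x \<longleftrightarrow> N *v (matrix_inv A *v x) = d *s (matrix_inv A *v x)" for x d
    using conj_eigen[OF A, of N "matrix_inv A *v x" d] unfolding AA .
  obtain y where y: "y \<noteq> 0" "herm y y = 0" "\<exists>d. N *v y = d *s y"
    "\<And>z. z \<noteq> 0 \<and> herm z z = 0 \<and> (\<exists>d. N *v z = d *s z) \<Longrightarrow> \<exists>d. z = d *s y"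
    using N unfolding parabolic_mat_def by blast
  have "?M *v x \<noteq> d *s x" if "Re (herm x x) < 0" for x d
    using N that unfolding parabolic_mat_def e by (metis h)
  moreover have "A *v y \<noteq> 0" by (rule Umat_nonzero[OF A y(1)])
  moreover have "herm (A *v y) (A *v y) = 0" using y(2) Umat_herm[OF A] by simp
  moreover have "\<exists>d. ?M *v (A *v y) = d *s (A *v y)" using y(3) unfolding conj_eigen[OF A] .
  moreover have "\<exists>d. z = d *s (A *v y)" if z: "z \<noteq> 0 \<and> herm z z = 0 \<and> (\<exists>d. ?M *v z = d *s z)" for z
  proof -
    have "matrix_inv A *v z \<noteq> 0" using Umat_nonzero[OF Umat_inv[OF A]] z by blast
    then obtain d where "matrix_inv A *v z = d *s y" using y(4)[of "matrix_inv A *v z"] z unfolding e h by blast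
    then have "z = d *s (A *v y)" using AA[of z] by (simp add: smult_vector)
    then show ?thesis by blast
  qed
  ultimately show ?thesis
    unfolding parabolic_mat_def using N conj_in_Umat[OF A] unfolding parabolic_mat_def by blast
qed

lemma conj_nilpotent:
  assumes A: "A \<in> Umat" and D: "nilpotent_mat (mat d ** (A ** N ** matrix_inv A) - mat 1)"
  shows "nilpotent_mat (mat d ** N - mat 1)"
proof -
  let ?D = "mat d ** (A ** N ** matrix_inv A) - mat 1" and ?E = "mat d ** N - mat 1"
  have s: "?D *v (A *v x) = A *v (?E *v x)" for x
  proof -
    have "?D *v (A *v x) = d *s (A *v (N *v x)) - A *v x"
      by (simp only: matrix_vector_mult_diff_rdistrib matrix_vector_mul_assoc[symmetric] mat_vector
        matrix_inv_vector(1)[OF A] vector_smult_lid)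
    also have "\<dots> = A *v (?E *v x)"
      by (simp only: matrix_vector_mult_diff_rdistrib matrix_vector_mul_assoc[symmetric] mat_vector
        matrix_vector_mult_diff_distrib smult_vector vector_smult_lid)
    finally show ?thesis .
  qed
  have p: "((*v) ?D ^^ k) (A *v x) = A *v (((*v) ?E ^^ k) x)" for k x
    by (induction k) (simp_all only: funpow.simps o_apply id_apply s)
  obtain k where k: "\<And>x. ((*v) ?D ^^ k) x = 0" using D unfolding nilpotent_mat_def by blast
  have "((*v) ?E ^^ k) x = 0" for x
  proof (rule Umat_inj[OF A])
    show "A *v (((*v) ?E ^^ k) x) = A *v 0"
      unfolding p[symmetric] k by (simp only: matrix_vector_mult_0_right)
  qed
  then show ?thesis unfolding nilpotent_mat_def by blast
qed

locale cusped_lattice =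
  fixes \<Gamma> :: "'m::finite pu set" and C :: "'m mat_n1 set" and c :: "'m mat_n1 \<Rightarrow> real"
  assumes lattice: "nonuniform_lattice \<Gamma>"
    and tf: "torsion_free \<Gamma>"
    and toroidal: "admits_toroidal_compactification \<Gamma>"
    and cusps: "cusp_decomposition \<Gamma> C c"
begin

lemma subgroup_\<Gamma>: "subgroup \<Gamma> PU"
  using lattice unfolding nonuniform_lattice_def lattice_PU_def by blast

lemma cusp_decompositionD:
  shows "finite C" "C \<subseteq> carrier U_n1"
    "\<forall>A\<in>C. c A > 0 \<and> (\<exists>g\<in>\<Gamma>. parabolic g \<and> act g (cusp_pt A) = cusp_pt A)"
    "\<forall>A\<in>C. \<forall>B\<in>C. \<forall>g\<in>\<Gamma>. act g ` horoball A (c A) \<inter> horoball B (c B) \<noteq> {} \<longrightarrow>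
        A = B \<and> act g (cusp_pt A) = cusp_pt A"
    "\<exists>K. compactin (CH_quotient \<Gamma>) K \<and>
          topspace (CH_quotient \<Gamma>) = K \<union> (\<Union>A\<in>C. orbit \<Gamma> ` horoball A (c A))"
  using cusps unfolding cusp_decomposition_def by - (elim conjE, assumption)+

lemma C_Umat: "A \<in> C \<Longrightarrow> A \<in> Umat"
  using cusp_decompositionD(2) unfolding Umat_def by blast

lemma c_positive: "A \<in> C \<Longrightarrow> c A > 0"
  using cusp_decompositionD(3) by blast

lemma Union_mult: "M \<in> \<Union>\<Gamma> \<Longrightarrow> N \<in> \<Union>\<Gamma> \<Longrightarrow> M ** N \<in> \<Union>\<Gamma>"
  unfolding Union_iff[OF subgroup_\<Gamma>]
  using subgroup.m_closed[OF subgroup_\<Gamma>, of "cls M" "cls N"] mult_PU Umat_mult by metis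

lemma Union_inv: "M \<in> \<Union>\<Gamma> \<Longrightarrow> matrix_inv M \<in> \<Union>\<Gamma>"
  unfolding Union_iff[OF subgroup_\<Gamma>]
  using subgroup.m_inv_closed[OF subgroup_\<Gamma>, of "cls M"] inv_PU Umat_inv by metis

lemma Union_scalar: assumes "cmod d = 1" shows "mat d \<in> \<Union>\<Gamma>"
proof -
  have "cls (mat d :: 'm mat_n1) = \<one>\<^bsub>PU\<^esub>" unfolding cls_one_iff U_scalars_iff using assms by blast
  then show ?thesis unfolding Union_iff[OF subgroup_\<Gamma>]
    using subgroup.one_closed[OF subgroup_\<Gamma>] mat_scalar_Umat[OF assms] by simp
qed

lemma Union_discrete: "\<exists>e>0. \<forall>M\<in>\<Union>\<Gamma>. norm (M - mat 1) < e \<longrightarrow> M \<in> U_scalars"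
proof -
  have one: "cls (mat 1) \<in> \<Gamma>" using subgroup.one_closed[OF subgroup_\<Gamma>] unfolding one_PU .
  have "subtopology PU_top \<Gamma> = discrete_topology \<Gamma>"
    using lattice unfolding nonuniform_lattice_def lattice_PU_def by blast
  then have "openin (subtopology PU_top \<Gamma>) {cls (mat 1)}" using one by simp
  then obtain T where T: "openin PU_top T" "{cls (mat 1)} = T \<inter> \<Gamma>" unfolding openin_subtopology by blast
  have "openin (top_of_set Umat) {x \<in> Umat. cls x \<in> T}"
    using T(1) unfolding PU_top_def openin_quotient_topology U_n1_simps by simp
  then obtain O' where O': "open O'" "{x \<in> Umat. cls x \<in> T} = Umat \<inter> O'" unfolding openin_open by blast
  have "mat 1 \<in> O'" using T(2) O'(2) Umat_1 by blast
  then obtain e where e: "e > 0" "ball (mat 1) e \<subseteq> O'" using O'(1) open_contains_ball by blast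
  have "M \<in> U_scalars" if M: "M \<in> \<Union>\<Gamma>" "norm (M - mat 1) < e" for M
  proof -
    have "M \<in> O'" using e(2) M(2) by (auto simp: dist_norm norm_minus_commute)
    then have "cls M \<in> T \<inter> \<Gamma>" using O'(2) M(1) unfolding Union_iff[OF subgroup_\<Gamma>] by blast
    then have "cls M = cls (mat 1)" unfolding T(2)[symmetric] by simp
    then show ?thesis unfolding one_PU[symmetric] cls_one_iff .
  qed
  then show ?thesis using e(1) by blast
qed

lemma matrix_power_commute: "(((**) M) ^^ k) (mat 1) ** M = M ** (((**) M) ^^ k) (mat 1)"
proof (induction k)
  case (Suc k)
  have "(M ** (((**) M) ^^ k) (mat 1)) ** M = M ** ((((**) M) ^^ k) (mat 1) ** M)"
    by (rule matrix_mul_assoc[symmetric])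
  then show ?case by (simp only: funpow.simps o_apply Suc.IH)
qed simp

lemma cls_power: assumes "M \<in> Umat"
  shows "(((**) M) ^^ k) (mat 1) \<in> Umat \<and> cls M [^]\<^bsub>PU\<^esub> k = cls ((((**) M) ^^ k) (mat 1))"
proof (induction k)
  case 0
  interpret group "PU :: 'm pu monoid" by (rule group_PU)
  show ?case by (simp add: Umat_1 one_PU)
next
  case (Suc k)
  interpret group "PU :: 'm pu monoid" by (rule group_PU)
  let ?N = "(((**) M) ^^ k) (mat 1)"
  have "?N ** M = M ** ?N" by (rule matrix_power_commute)
  then show ?case using Suc assms mult_PU[of ?N M] Umat_mult[of M ?N] by simp
qed

lemma Union_torsion_free:
  assumes "M \<in> \<Union>\<Gamma>" "k > 0" "(((**) M) ^^ k) (mat 1) \<in> U_scalars" shows "M \<in> U_scalars"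
proof -
  have M: "M \<in> Umat" "cls M \<in> \<Gamma>" using assms(1) unfolding Union_iff[OF subgroup_\<Gamma>] by auto
  have "cls M [^]\<^bsub>PU\<^esub> k = \<one>\<^bsub>PU\<^esub>" using cls_power[OF M(1), of k] assms(3) unfolding cls_one_iff[symmetric] by simp
  then have "cls M = \<one>\<^bsub>PU\<^esub>" using tf M(2) assms(2) unfolding torsion_free_def by blast
  then show ?thesis unfolding cls_one_iff .
qed

lemma cusped_group_frame: assumes A: "A \<in> C" shows "cusped_group (frame_group \<Gamma> A)"
proof
  note AU = C_Umat[OF A]
  let ?P = "frame_group \<Gamma> A"
  have U: "\<Union>\<Gamma> \<subseteq> Umat" using Union_iff[OF subgroup_\<Gamma>] by blast
  show PU: "M \<in> Umat" if "M \<in> ?P" for M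
    using that U conj_in_Umat[OF AU, of M] unfolding frame_group_def by blast
  show "mat d \<in> ?P" if "cmod d = 1" for d
    using Union_scalar[OF that] unfolding frame_group_def by (simp add: conj_scalar[OF AU])
  show "M ** N \<in> ?P" if "M \<in> ?P" "N \<in> ?P" for M N
    using that Union_mult unfolding frame_group_def mem_Collect_eq conj_mult[OF AU] by blast
  show "matrix_inv M \<in> ?P" if "M \<in> ?P" for M
    using Union_inv that PU[OF that] unfolding frame_group_def by (simp add: conj_inv[OF AU])
  show "\<exists>e>0. \<forall>M\<in>?P. norm (M - mat 1) < e \<longrightarrow> M \<in> U_scalars"
  proof -
    obtain e where e: "e > 0" "\<And>M. M \<in> \<Union>\<Gamma> \<Longrightarrow> norm (M - mat 1) < e \<Longrightarrow> M \<in> U_scalars"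
      using Union_discrete by blast
    have "continuous_on UNIV (\<lambda>N. A ** N ** matrix_inv A)"
      unfolding matrix_matrix_mult_def by (intro continuous_intros)
    then have "isCont (\<lambda>N. A ** N ** matrix_inv A) (mat 1)" by (simp add: continuous_on_eq_continuous_at)
    then obtain d where d: "d > 0" "\<And>N. dist N (mat 1) < d \<Longrightarrow> dist (A ** N ** matrix_inv A) (A ** mat 1 ** matrix_inv A) < e"
      using e(1) unfolding continuous_at_eps_delta by blast
    have "M \<in> U_scalars" if M: "M \<in> ?P" "norm (M - mat 1) < d" for M
    proof -
      have "norm (A ** M ** matrix_inv A - mat 1) < e"
        using d(2)[of M] M(2) unfolding conj_scalar[OF AU] by (simp add: dist_norm)
      then have "A ** M ** matrix_inv A \<in> U_scalars" using e(2) M(1) unfolding frame_group_def by blast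
      then show ?thesis unfolding conj_in_scalars[OF AU] .
    qed
    then show ?thesis using d(1) by blast
  qed
  show "M \<in> U_scalars" if "M \<in> ?P" "k > 0" "(((**) M) ^^ k) (mat 1) \<in> U_scalars" for M k
  proof -
    let ?N = "A ** M ** matrix_inv A"
    have "A ** (((**) M) ^^ k) (mat 1) ** matrix_inv A = (((**) ?N) ^^ k) (mat 1)"
    proof (induction k)
      case 0 show ?case by (simp only: funpow.simps id_apply conj_scalar[OF AU])
    next
      case (Suc k) then show ?case by (simp only: funpow.simps o_apply conj_mult[OF AU])
    qed
    then have "(((**) ?N) ^^ k) (mat 1) \<in> U_scalars" using that(3) conj_in_scalars[OF AU] by metis
    then have "?N \<in> U_scalars" using Union_torsion_free[OF _ that(2)] that(1) unfolding frame_group_def by blast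
    then show ?thesis unfolding conj_in_scalars[OF AU] .
  qed
  show "\<exists>d. cmod d = 1 \<and> nilpotent_mat (mat d ** M - mat 1)" if "M \<in> ?P" "parabolic_mat M" for M
  proof -
    let ?N = "A ** M ** matrix_inv A"
    have N: "?N \<in> Umat" "cls ?N \<in> \<Gamma>"
      using that(1) unfolding frame_group_def mem_Collect_eq Union_iff[OF subgroup_\<Gamma>] by auto
    have "parabolic (cls ?N)" unfolding parabolic_iff[OF N(1)] by (rule conj_parabolic[OF AU that(2)])
    then have "unipotent (cls ?N)" using toroidal N(2) unfolding admits_toroidal_compactification_def by blast
    then show ?thesis using unipotent_cls conj_nilpotent[OF AU] by blast
  qed
  show "\<exists>M\<in>?P. parabolic_mat M \<and> (\<exists>\<kappa>. M *v f1 = \<kappa> *s f1)"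
  proof -
    obtain g where g: "g \<in> \<Gamma>" "parabolic g" "act g (cusp_pt A) = cusp_pt A"
      using cusp_decompositionD(3) A by blast
    then have "g \<in> cls ` Umat" using subgroup.subset[OF subgroup_\<Gamma>] unfolding carrier_PU by blast
    then obtain M where M: "M \<in> Umat" "g = cls M" by blast
    let ?N = "matrix_inv A ** M ** A"
    have "M \<in> \<Union>\<Gamma>" using Union_iff[OF subgroup_\<Gamma>] M g by blast
    then have "?N \<in> ?P" unfolding frame_group_def by (simp add: conj_Umat[OF AU])
    moreover have "parabolic_mat M" using g(2) parabolic_iff[OF M(1)] M(2) by blast
    then have "parabolic_mat ?N"
      using conj_parabolic[OF Umat_inv[OF AU], of M] unfolding matrix_inv_inv[OF AU] by blast
    moreover have "line (M *v (A *v f1)) = line (A *v f1)"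
      using g(3) unfolding cusp_pt_def M(2) act_cls .
    then obtain \<kappa> where \<kappa>: "M *v (A *v f1) = \<kappa> *s (A *v f1)"
      using line_fixed_iff[OF M(1) Umat_nonzero[OF AU, of f1]] by (auto simp: vec_n1_eq_iff)
    then have "?N *v f1 = \<kappa> *s f1"
      using AU by (simp add: smult_vector flip: matrix_vector_mul_assoc)
    ultimately show ?thesis by blast
  qed
qed

end

lemma horoball_eq: "horoball A t = frame_pt A ` horoset t"
  unfolding horoball_def horoset_def by auto

lemma lift_nonzero: "lift z \<noteq> 0"
  by (simp add: lift_eq vec_n1_eq_iff)

lemma Umat_lift_nonzero: "A \<in> Umat \<Longrightarrow> A *v lift z \<noteq> 0"
  by (rule Umat_nonzero[OF _ lift_nonzero])

lemma frame_pt_eq_iff: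
  assumes A: "A \<in> Umat" shows "line (A *v x) = frame_pt A z \<and> x \<noteq> 0 \<longleftrightarrow> (\<exists>a. a \<noteq> 0 \<and> x = a *s lift z)"
proof
  assume l: "line (A *v x) = frame_pt A z \<and> x \<noteq> 0"
  then obtain a where "a \<noteq> 0" "A *v x = a *s (A *v lift z)"
    using line_eqE[of "A *v x" "A *v lift z"] Umat_nonzero[OF A] unfolding frame_pt_def by metis
  then show "\<exists>a. a \<noteq> 0 \<and> x = a *s lift z" using Umat_inj[OF A] by (metis smult_vector)
next
  assume "\<exists>a. a \<noteq> 0 \<and> x = a *s lift z"
  then obtain a where a: "a \<noteq> 0" "x = a *s lift z" by blast
  then show "line (A *v x) = frame_pt A z \<and> x \<noteq> 0"
    using lift_nonzero[of z] unfolding frame_pt_def by (simp add: smult_vector line_smult vector_mul_eq_0)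
qed

lemma line_neg_CH: "Re (herm x x) < 0 \<Longrightarrow> line x \<in> CH"
  unfolding CH_def by blast

lemma CH_lineE: assumes "L \<in> CH" obtains x where "L = line x" "Re (herm x x) < 0"
  using assms unfolding CH_def by blast

lemma frame_pt_CH: "A \<in> Umat \<Longrightarrow> z \<in> siegel \<Longrightarrow> frame_pt A z \<in> CH"
  unfolding frame_pt_def by (rule line_neg_CH) (simp add: Umat_herm siegel_iff)

lemma topspace_quotient_topology: "topspace (quotient_topology X f) = f ` topspace X"
proof
  have "openin (quotient_topology X f) (topspace (quotient_topology X f))" by simp
  then show "topspace (quotient_topology X f) \<subseteq> f ` topspace X"
    unfolding openin_quotient_topology by (rule conjunct1)
  have "{x \<in> topspace X. f x \<in> f ` topspace X} = topspace X" by blast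
  then have "openin (quotient_topology X f) (f ` topspace X)"
    unfolding openin_quotient_topology by simp
  then show "f ` topspace X \<subseteq> topspace (quotient_topology X f)" by (rule openin_subset)
qed

lemma topspace_CH: "topspace (subtopology proj_top CH) = CH"
proof -
  have "CH \<subseteq> line ` (- {0 :: 'a vec_n1})"
  proof
    fix L :: "'a line" assume "L \<in> CH"
    then obtain x where x: "L = line x" "Re (herm x x) < 0" by (rule CH_lineE)
    then have "x \<noteq> 0" by auto
    then show "L \<in> line ` (- {0})" unfolding x(1) by blast
  qed
  then show ?thesis
    unfolding topspace_subtopology proj_top_def topspace_quotient_topology by (simp add: Int_absorb1)
qed

lemma topspace_CH_quotient: "topspace (CH_quotient \<Gamma>) = orbit \<Gamma> ` CH"
  unfolding CH_quotient_def topspace_quotient_topology topspace_CH ..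

context cusped_lattice
begin

lemma \<Gamma>_clsE: assumes "g \<in> \<Gamma>" obtains M where "M \<in> \<Union>\<Gamma>" "g = cls M"
proof -
  have "g \<in> cls ` Umat" using subgroup.subset[OF subgroup_\<Gamma>] assms unfolding carrier_PU by blast
  then obtain M where M: "M \<in> Umat" "g = cls M" by blast
  then have "M \<in> \<Union>\<Gamma>" using assms Union_iff[OF subgroup_\<Gamma>] by blast
  then show ?thesis using that M by blast
qed

lemma orbit_line: "orbit \<Gamma> (line x) = (\<lambda>M. line (M *v x)) ` \<Union>\<Gamma>"
proof
  show "orbit \<Gamma> (line x) \<subseteq> (\<lambda>M. line (M *v x)) ` \<Union>\<Gamma>"
  proof
    fix L assume "L \<in> orbit \<Gamma> (line x)"
    then obtain g where g: "g \<in> \<Gamma>" "L = act g (line x)" unfolding orbit_def by blast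
    obtain M where M: "M \<in> \<Union>\<Gamma>" "g = cls M" using \<Gamma>_clsE[OF g(1)] .
    show "L \<in> (\<lambda>M. line (M *v x)) ` \<Union>\<Gamma>" unfolding g(2) M(2) act_cls using M(1) by blast
  qed
  show "(\<lambda>M. line (M *v x)) ` \<Union>\<Gamma> \<subseteq> orbit \<Gamma> (line x)"
  proof
    fix L assume "L \<in> (\<lambda>M. line (M *v x)) ` \<Union>\<Gamma>"
    then obtain M where M: "M \<in> \<Union>\<Gamma>" "L = act (cls M) (line x)" unfolding act_cls by blast
    then have "cls M \<in> \<Gamma>" using Union_iff[OF subgroup_\<Gamma>] by blast
    then show "L \<in> orbit \<Gamma> (line x)" unfolding M(2) orbit_def by blast
  qed
qed

lemma orbit_eq_iff: "orbit \<Gamma> (line x) = orbit \<Gamma> (line y) \<longleftrightarrow> (\<exists>M\<in>\<Union>\<Gamma>. line (M *v x) = line y)"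
proof
  assume eq: "orbit \<Gamma> (line x) = orbit \<Gamma> (line y)"
  have "line y \<in> orbit \<Gamma> (line y)"
    unfolding orbit_line using Union_scalar[of 1] by (intro image_eqI[of _ _ "mat 1"]) auto
  then have "line y \<in> orbit \<Gamma> (line x)" using eq by simp
  then obtain M where "M \<in> \<Union>\<Gamma>" "line y = line (M *v x)" unfolding orbit_line by (rule imageE)
  then show "\<exists>M\<in>\<Union>\<Gamma>. line (M *v x) = line y" by metis
next
  assume "\<exists>M\<in>\<Union>\<Gamma>. line (M *v x) = line y"
  then obtain M where M: "M \<in> \<Union>\<Gamma>" "line (M *v x) = line y" by blast
  have MU: "M \<in> Umat" using M(1) Union_iff[OF subgroup_\<Gamma>] by blast
  have cong: "line (N *v y) = line (N ** M *v x)" for N :: "'m mat_n1"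
    using M(2) act_cls[of N y] act_cls[of N "M *v x"] by (simp add: matrix_vector_mul_assoc)
  show "orbit \<Gamma> (line x) = orbit \<Gamma> (line y)"
  proof
    show "orbit \<Gamma> (line y) \<subseteq> orbit \<Gamma> (line x)" unfolding orbit_line cong using Union_mult M(1) by blast
    show "orbit \<Gamma> (line x) \<subseteq> orbit \<Gamma> (line y)"
    proof
      fix L assume "L \<in> orbit \<Gamma> (line x)"
      then obtain N where N: "N \<in> \<Union>\<Gamma>" "L = line (N *v x)" unfolding orbit_line by blast
      have "line (N *v x) = line ((N ** matrix_inv M) *v y)"
        unfolding cong using MU by (simp flip: matrix_vector_mul_assoc)
      then show "L \<in> orbit \<Gamma> (line y)" unfolding orbit_line N(2)
        using Union_mult[OF N(1) Union_inv[OF M(1)]] by blast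
    qed
  qed
qed

lemma orbit_frame_eq_iff:
  assumes A: "A \<in> C"
  shows "orbit \<Gamma> (frame_pt A z) = orbit \<Gamma> (frame_pt A z') \<longleftrightarrow>
    (\<exists>N\<in>frame_group \<Gamma> A. \<exists>a. a \<noteq> 0 \<and> N *v lift z = a *s lift z')" (is "?L \<longleftrightarrow> ?R")
proof
  note AU = C_Umat[OF A]
  assume ?L
  then obtain M where M: "M \<in> \<Union>\<Gamma>" "line (M *v (A *v lift z)) = line (A *v lift z')"
    unfolding frame_pt_def orbit_eq_iff by blast
  have MU: "M \<in> Umat" using M(1) Union_iff[OF subgroup_\<Gamma>] by blast
  define N where "N = matrix_inv A ** M ** A"
  have "N \<in> frame_group \<Gamma> A" unfolding frame_group_def N_def using M(1) by (simp add: conj_Umat[OF AU])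
  moreover have "M *v (A *v lift z) = A *v (N *v lift z)"
    unfolding N_def using AU by (simp flip: matrix_vector_mul_assoc)
  then have "line (A *v (N *v lift z)) = frame_pt A z'" using M(2) unfolding frame_pt_def by simp
  moreover have "N *v lift z \<noteq> 0"
    unfolding N_def by (intro Umat_lift_nonzero Umat_mult Umat_inv AU MU)
  ultimately show ?R using frame_pt_eq_iff[OF AU] by blast
next
  note AU = C_Umat[OF A]
  assume ?R
  then obtain N a where N: "N \<in> frame_group \<Gamma> A" "a \<noteq> 0" "N *v lift z = a *s lift z'" by blast
  let ?M = "A ** N ** matrix_inv A"
  have "?M \<in> \<Union>\<Gamma>" using N(1) unfolding frame_group_def by blast
  moreover have "line (?M *v (A *v lift z)) = line (A *v lift z')"
    unfolding conj_vector[OF AU] N(3) smult_vector by (rule line_smult[OF N(2)])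
  ultimately show ?L unfolding frame_pt_def orbit_eq_iff by blast
qed

lemma frame_group_act:
  assumes A: "A \<in> C" and N: "N \<in> frame_group \<Gamma> A"
  obtains g where "g \<in> \<Gamma>" "\<And>x. act g (line (A *v x)) = line (A *v (N *v x))"
proof -
  have "cls (A ** N ** matrix_inv A) \<in> \<Gamma>"
    using N Union_iff[OF subgroup_\<Gamma>] unfolding frame_group_def by blast
  then show ?thesis using that[of "cls (A ** N ** matrix_inv A)"] unfolding act_cls conj_vector[OF C_Umat[OF A]] by blast
qed

lemma horoball_invariant:
  assumes A: "A \<in> C" and N: "N \<in> frame_group \<Gamma> A" and z: "z \<in> horoset (c A)" "z' \<in> horoset (c A)"
    and e: "N *v lift z = a *s lift z'"
  shows "\<exists>\<mu>. N *v f1 = \<mu> *s f1"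
proof -
  note AU = C_Umat[OF A]
  interpret P: cusped_group "frame_group \<Gamma> A" by (rule cusped_group_frame[OF A])
  have NU: "N \<in> Umat" by (rule P.P_Umat[OF N])
  obtain g where g: "g \<in> \<Gamma>" "\<And>x. act g (line (A *v x)) = line (A *v (N *v x))"
    using frame_group_act[OF A N] by blast
  have "a \<noteq> 0" using e Umat_lift_nonzero[OF NU, of z] by auto
  then have "act g (frame_pt A z) = frame_pt A z'"
    unfolding frame_pt_def g(2) e smult_vector by (rule line_smult)
  then have "act g ` horoball A (c A) \<inter> horoball A (c A) \<noteq> {}"
    unfolding horoball_eq using z by blast
  then have "act g (cusp_pt A) = cusp_pt A" using cusp_decompositionD(4) A g(1) by blast
  then have "line (A *v (N *v f1)) = line (A *v f1)" unfolding cusp_pt_def g(2) .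
  moreover have "f1 \<noteq> (0 :: 'm vec_n1)" by (simp add: vec_n1_eq_iff)
  then have "A *v (N *v f1) \<noteq> 0" by (intro Umat_nonzero AU NU)
  ultimately obtain \<mu> where "A *v (N *v f1) = \<mu> *s (A *v f1)" by (rule line_eqE)
  then show ?thesis using Umat_inj[OF AU] by (metis smult_vector)
qed

text \<open>The orbits of the vectors of square \<open>h\<close> which the group moves to vectors of length less than \<open>n\<close>
  form an increasing sequence of open sets covering the quotient.\<close>

lemma compact_orbits_bounded:
  assumes K: "compactin (CH_quotient \<Gamma>) K" and h: "h < 0"
  obtains B where "\<And>x. Re (herm x x) = h \<Longrightarrow> orbit \<Gamma> (line x) \<in> K \<Longrightarrow> \<exists>M\<in>\<Union>\<Gamma>. norm (M *v x) \<le> B"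
proof -
  define V where "V n = {orbit \<Gamma> (line x) |x. Re (herm x x) = h \<and> (\<exists>M\<in>\<Union>\<Gamma>. norm (M *v x) < real n)}" for n :: nat
  have mem_V: "\<exists>M\<in>\<Union>\<Gamma>. norm (M *v x) < real n"
    if V: "orbit \<Gamma> (line x) \<in> V n" and x: "Re (herm x x) = h" for x n
  proof -
    obtain y M where y: "orbit \<Gamma> (line x) = orbit \<Gamma> (line y)" "Re (herm y y) = h" "M \<in> \<Union>\<Gamma>" "norm (M *v y) < real n"
      using V unfolding V_def by blast
    obtain N where N: "N \<in> \<Union>\<Gamma>" "line (N *v x) = line y" using y(1) unfolding orbit_eq_iff by blast
    have NU: "N \<in> Umat" using N(1) Union_iff[OF subgroup_\<Gamma>] by blast
    have "x \<noteq> 0" using x h by auto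
    then obtain d where d: "d \<noteq> 0" "N *v x = d *s y" using line_eqE[OF N(2)] Umat_nonzero[OF NU] by blast
    have "(cmod d)\<^sup>2 * h = h"
      using smult_Re_herm[of d y] unfolding d(2)[symmetric] Umat_herm[OF NU] x y(2) by simp
    then have "cmod d = 1" using h by (simp add: power2_eq_1_iff) (use norm_ge_zero[of d] in linarith)
    then have "norm (M *v (N *v x)) = norm (M *v y)"
      unfolding d(2) smult_vector by (simp add: norm_vec_def norm_mult)
    then have "norm (M ** N *v x) < real n" using y(4) by (simp add: matrix_vector_mul_assoc)
    then show ?thesis using Union_mult[OF y(3) N(1)] by blast
  qed
  have open_V: "openin (CH_quotient \<Gamma>) (V n)" for n
  proof -
    define W where "W = (\<Union>M\<in>\<Union>\<Gamma>. {x :: 'm vec_n1. Re (herm x x) < 0 \<and> (norm (M *v x))\<^sup>2 < (real n)\<^sup>2 * (Re (herm x x) / h) \<and> n > 0})"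
    have cM: "continuous_on UNIV (\<lambda>x. M *v x)" for M :: "'m mat_n1"
      unfolding matrix_vector_mult_def by (intro continuous_intros)
    have "open {x :: 'm vec_n1. Re (herm x x) < 0 \<and> (norm (M *v x))\<^sup>2 < (real n)\<^sup>2 * (Re (herm x x) / h) \<and> n > 0}" for M :: "'m mat_n1"
      using h by (intro open_Collect_conj open_Collect_less open_Collect_const continuous_intros cM) auto
    then have oW: "open W" unfolding W_def by (intro open_UN) auto
    have W_line: "c' *s x \<in> W" if "x \<in> W" "c' \<noteq> 0" for x c'
    proof -
      obtain M where M: "M \<in> \<Union>\<Gamma>" "Re (herm x x) < 0" "(norm (M *v x))\<^sup>2 < (real n)\<^sup>2 * (Re (herm x x) / h)" "n > 0"
        using \<open>x \<in> W\<close> unfolding W_def by blast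
      have c2: "(cmod c')\<^sup>2 > 0" using \<open>c' \<noteq> 0\<close> by simp
      have "norm (c' *s y) = cmod c' * norm y" for y :: "'m vec_n1"
        by (simp add: norm_vec_def norm_mult L2_set_right_distrib)
      then have "(norm (M *v (c' *s x)))\<^sup>2 = (cmod c')\<^sup>2 * (norm (M *v x))\<^sup>2"
        by (simp add: smult_vector power_mult_distrib)
      also have "\<dots> < (cmod c')\<^sup>2 * ((real n)\<^sup>2 * (Re (herm x x) / h))" using M(3) c2 by (rule mult_strict_left_mono)
      also have "\<dots> = (real n)\<^sup>2 * (Re (herm (c' *s x) (c' *s x)) / h)" unfolding smult_Re_herm by simp
      finally have 1: "(norm (M *v (c' *s x)))\<^sup>2 < (real n)\<^sup>2 * (Re (herm (c' *s x) (c' *s x)) / h)" .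
      have "Re (herm (c' *s x) (c' *s x)) < 0" unfolding smult_Re_herm using c2 M(2) by (rule mult_pos_neg)
      then show ?thesis unfolding W_def using M(1,4) 1 by blast
    qed
    have "openin proj_top (line ` W)"
      unfolding proj_top_def openin_quotient_topology
    proof
      have "0 \<notin> W" unfolding W_def by auto
      then show "line ` W \<subseteq> line ` topspace (top_of_set (- {0}))" by auto
      have "{x \<in> - {0}. line x \<in> line ` W} = W"
      proof
        show "W \<subseteq> {x \<in> - {0}. line x \<in> line ` W}" using \<open>0 \<notin> W\<close> by auto
        show "{x \<in> - {0}. line x \<in> line ` W} \<subseteq> W"
        proof
          fix x assume "x \<in> {x \<in> - {0}. line x \<in> line ` W}"
          then obtain y where y: "x \<noteq> 0" "y \<in> W" "line x = line y" by auto
          then obtain d where "d \<noteq> 0" "x = d *s y" using line_eqE by blast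
          then show "x \<in> W" using W_line y(2) by blast
        qed
      qed
      then show "openin (top_of_set (- {0})) {x \<in> topspace (top_of_set (- {0})). line x \<in> line ` W}"
        using open_subset[OF _ oW] \<open>0 \<notin> W\<close> by auto
    qed
    moreover have "{L \<in> CH. orbit \<Gamma> L \<in> V n} = CH \<inter> line ` W"
    proof
      show "{L \<in> CH. orbit \<Gamma> L \<in> V n} \<subseteq> CH \<inter> line ` W"
      proof
        fix L assume L: "L \<in> {L \<in> CH. orbit \<Gamma> L \<in> V n}"
        then obtain x where x: "L = line x" "Re (herm x x) < 0" using CH_lineE by blast
        define t where "t = sqrt (h / Re (herm x x))"
        have t: "t > 0" "t\<^sup>2 * Re (herm x x) = h" unfolding t_def using x(2) h by (simp_all add: zero_less_divide_iff divide_nonpos_neg)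
        define y where "y = of_real t *s x"
        have y: "Re (herm y y) = h" "L = line y"
          unfolding y_def smult_Re_herm x(1) using t line_smult[of "of_real t" x] by simp_all
        obtain M where M: "M \<in> \<Union>\<Gamma>" "norm (M *v y) < real n" using mem_V[of y n] L y by auto
        have "(norm (M *v y))\<^sup>2 < (real n)\<^sup>2" using M(2) by (intro power_strict_mono) auto
        moreover have "n > 0" using M(2) by (cases n) (use norm_ge_zero[of "M *v y"] in auto)
        ultimately have "y \<in> W" unfolding W_def using M(1) y(1) h by auto
        then show "L \<in> CH \<inter> line ` W" using L y(2) by blast
      qed
      show "CH \<inter> line ` W \<subseteq> {L \<in> CH. orbit \<Gamma> L \<in> V n}"
      proof
        fix L assume L: "L \<in> CH \<inter> line ` W"
        then obtain x where x: "x \<in> W" "L = line x" by blast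
        have x0: "Re (herm x x) < 0" using x(1) unfolding W_def by blast
        define t where "t = sqrt (h / Re (herm x x))"
        have t: "t > 0" "t\<^sup>2 * Re (herm x x) = h" unfolding t_def using x0 h by (simp_all add: zero_less_divide_iff divide_nonpos_neg)
        define y where "y = of_real t *s x"
        have y: "Re (herm y y) = h" "L = line y"
          unfolding y_def smult_Re_herm x(2) using t line_smult[of "of_real t" x] by simp_all
        have "y \<in> W" unfolding y_def by (rule W_line[OF x(1)]) (use t in simp)
        then obtain M where M: "M \<in> \<Union>\<Gamma>" "(norm (M *v y))\<^sup>2 < (real n)\<^sup>2 * (Re (herm y y) / h)" unfolding W_def by blast
        then have "(norm (M *v y))\<^sup>2 < (real n)\<^sup>2" using y(1) h by simp
        then have "norm (M *v y) < real n" by (rule power_less_imp_less_base) simp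
        then have "orbit \<Gamma> L \<in> V n" unfolding V_def y(2) using y(1) M(1) by blast
        then show "L \<in> {L \<in> CH. orbit \<Gamma> L \<in> V n}" using L by blast
      qed
    qed
    moreover have "V n \<subseteq> orbit \<Gamma> ` CH" unfolding V_def using h line_neg_CH by blast
    ultimately have "V n \<subseteq> orbit \<Gamma> ` topspace (subtopology proj_top CH)"
      "openin (subtopology proj_top CH) {L \<in> topspace (subtopology proj_top CH). orbit \<Gamma> L \<in> V n}"
      unfolding topspace_CH openin_subtopology by blast+
    then show ?thesis unfolding CH_quotient_def openin_quotient_topology by blast
  qed
  have "K \<subseteq> (\<Union>n. V n)"
  proof
    fix k assume k: "k \<in> K"
    then have "k \<in> orbit \<Gamma> ` CH" using compactin_subset_topspace[OF K] unfolding topspace_CH_quotient by blast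
    then obtain x where x: "k = orbit \<Gamma> (line x)" "Re (herm x x) < 0" using CH_lineE by (metis imageE)
    define t where "t = sqrt (h / Re (herm x x))"
    have t: "t > 0" "t\<^sup>2 * Re (herm x x) = h" unfolding t_def using x(2) h by (simp_all add: zero_less_divide_iff divide_nonpos_neg)
    define y where "y = of_real t *s x"
    have y: "Re (herm y y) = h" "k = orbit \<Gamma> (line y)"
      unfolding y_def smult_Re_herm x(1) using t line_smult[of "of_real t" x] by simp_all
    obtain n :: nat where n: "norm y < real n" using reals_Archimedean2 by blast
    have "mat 1 \<in> \<Union>\<Gamma>" using Union_scalar[of 1] by simp
    then have "k \<in> V n" unfolding V_def y(2) using y(1) n by (auto intro!: exI[of _ y] bexI[of _ "mat 1"])
    then show "k \<in> (\<Union>n. V n)" by blast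
  qed
  then have "\<exists>\<F>. finite \<F> \<and> \<F> \<subseteq> range V \<and> K \<subseteq> \<Union>\<F>"
    using K open_V unfolding compactin_def by (metis (no_types, lifting) imageE)
  then obtain \<F> where "finite \<F>" "\<F> \<subseteq> range V" "K \<subseteq> \<Union>\<F>" by blast
  then obtain I where I: "finite I" "K \<subseteq> (\<Union>n\<in>I. V n)" by (metis finite_subset_image)
  have "V n \<subseteq> V (Max I)" if "n \<in> I" for n
  proof -
    have "real n \<le> real (Max I)" using that I(1) by simp
    then show ?thesis unfolding V_def by (smt (verit) Collect_mono)
  qed
  then have KV: "K \<subseteq> V (Max I)" using I(2) by blast
  show ?thesis
  proof (rule that[of "real (Max I)"])
    fix x :: "'m vec_n1" assume "Re (herm x x) = h" "orbit \<Gamma> (line x) \<in> K"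
    then show "\<exists>M\<in>\<Union>\<Gamma>. norm (M *v x) \<le> real (Max I)" using mem_V[of x "Max I"] KV by (meson less_imp_le subsetD)
  qed
qed

lemma C_nonempty: "C \<noteq> {}"
proof
  assume "C = {}"
  then obtain K where "compactin (CH_quotient \<Gamma>) K" "topspace (CH_quotient \<Gamma>) = K"
    using cusp_decompositionD(5) by auto
  then have "compact_space (CH_quotient \<Gamma>)" unfolding compact_space_def by simp
  then show False using lattice unfolding nonuniform_lattice_def by blast
qed

text \<open>An element acting on the Siegel domain as a Heisenberg translation differs from it by an isometry
  which fixes all negative lines, and which therefore is scalar.\<close>

lemma cusp_group_eq:
  assumes A: "A \<in> C" shows "cusp_group \<Gamma> A = cusped_group.\<Lambda> (frame_group \<Gamma> A)"
proof -
  note AU = C_Umat[OF A]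
  interpret P: cusped_group "frame_group \<Gamma> A" by (rule cusped_group_frame[OF A])
  have "(s, v) \<in> cusp_group \<Gamma> A \<longleftrightarrow> hmat s v \<in> frame_group \<Gamma> A" for s v
  proof
    assume "hmat s v \<in> frame_group \<Gamma> A"
    then obtain g where g: "g \<in> \<Gamma>" "\<And>x. act g (line (A *v x)) = line (A *v (hmat s v *v x))"
      using frame_group_act[OF A] by blast
    have "act g (frame_pt A z) = frame_pt A (heis s v z)" for z
      unfolding frame_pt_def g(2) hmat_lift ..
    then show "(s, v) \<in> cusp_group \<Gamma> A" unfolding cusp_group_def using g(1) by blast
  next
    assume "(s, v) \<in> cusp_group \<Gamma> A"
    then obtain g where g: "g \<in> \<Gamma>" "\<And>z. z \<in> siegel \<Longrightarrow> act g (frame_pt A z) = frame_pt A (heis s v z)"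
      unfolding cusp_group_def by blast
    obtain M where M: "M \<in> \<Union>\<Gamma>" "g = cls M" using \<Gamma>_clsE[OF g(1)] .
    have MU: "M \<in> Umat" using M(1) Union_iff[OF subgroup_\<Gamma>] by blast
    let ?H = "A ** hmat s v"
    have HU: "?H \<in> Umat" by (intro Umat_mult AU hmat_Umat)
    define N where "N = matrix_inv ?H ** (M ** A)"
    have NU: "N \<in> Umat" unfolding N_def by (intro Umat_mult Umat_inv HU MU AU)
    have "\<exists>d. N *v x = d *s x" if x: "Re (herm x x) < 0" for x
    proof -
      obtain z where z: "z \<in> siegel" "x = cb x *s lift z" using negative_lift[OF x] by blast
      have "line (M *v (A *v lift z)) = line (?H *v lift z)"
        using g(2)[OF z(1)] unfolding M(2) frame_pt_def act_cls hmat_lift[symmetric] matrix_vector_mul_assoc .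
      moreover have "M *v (A *v lift z) \<noteq> 0" using Umat_nonzero[OF MU Umat_lift_nonzero[OF AU]] .
      ultimately obtain d where "M *v (A *v lift z) = d *s (?H *v lift z)" using line_eqE by blast
      then have "N *v lift z = d *s lift z"
        unfolding N_def matrix_vector_mul_assoc[symmetric, of "matrix_inv ?H"]
          matrix_vector_mul_assoc[symmetric, of M A] by (simp only: smult_vector matrix_inv_vector(1)[OF HU])
      then have "N *v x = d *s x" using z(2) by (metis smult_vector vector_smult_assoc mult.commute)
      then show ?thesis by blast
    qed
    then obtain d where d: "N = mat d" using fixes_negative_lines_scalar by blast
    have "(cmod d)\<^sup>2 * Re (herm (f2 - f1) (f2 - f1 :: 'm vec_n1)) = Re (herm (f2 - f1) (f2 - f1 :: 'm vec_n1))"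
      using Umat_herm[OF NU, of "f2 - f1" "f2 - f1"] unfolding d mat_vector by (metis smult_Re_herm)
    moreover have "Re (herm (f2 - f1) (f2 - f1 :: 'm vec_n1)) = - 2" by (simp add: herm_self)
    ultimately have "(cmod d)\<^sup>2 = 1" by simp
    then have "cmod d = 1 \<or> cmod d = - 1" by (simp only: power2_eq_1_iff)
    then have d1: "cmod d = 1" using norm_ge_zero[of d] by linarith
    then have d0: "d \<noteq> 0" by auto
    have "M *v (A *v x) = d *s (?H *v x)" for x
    proof -
      have "?H *v (N *v x) = M *v (A *v x)" 
        unfolding N_def matrix_vector_mul_assoc[symmetric, of "matrix_inv ?H"]
          matrix_vector_mul_assoc[symmetric, of M A] by (rule matrix_inv_vector(2)[OF HU])
      then show ?thesis unfolding d mat_vector smult_vector by simp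
    qed
    then have "mat (inverse d) ** M *v (A *v x) = A *v (hmat s v *v x)" for x
      using d0 by (simp add: mat_vector vector_smult_assoc matrix_vector_mul_assoc[symmetric])
    from this[of "matrix_inv A *v x" for x]
    have "mat (inverse d) ** M *v x = A ** hmat s v ** matrix_inv A *v x" for x
      using AU by (simp flip: matrix_vector_mul_assoc)
    then have "A ** hmat s v ** matrix_inv A = mat (inverse d) ** M" by (intro mat_eqI) simp
    moreover have "mat (inverse d) ** M \<in> \<Union>\<Gamma>"
      by (intro Union_mult Union_scalar M(1)) (use d1 in \<open>simp add: norm_inverse\<close>)
    ultimately show "hmat s v \<in> frame_group \<Gamma> A" unfolding frame_group_def by simp
  qed
  then show ?thesis unfolding P.\<Lambda>_def by auto
qed

lemma stabiliser_preserves_horoset: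
  assumes A: "A \<in> C" and N: "N \<in> frame_group \<Gamma> A" "N *v f1 = \<mu> *s f1"
    and e: "N *v lift z = a *s lift z'" "a \<noteq> 0" and z: "z' \<in> horoset t"
  shows "z \<in> horoset t"
proof -
  interpret P: cusped_group "frame_group \<Gamma> A" by (rule cusped_group_frame[OF A])
  obtain d s v where d: "cmod d = 1" "mat d ** N = hmat s v" using P.stabiliser_translations[OF N] by blast
  have "hmat s v *v lift z = (d * a) *s lift z'"
    unfolding d(2)[symmetric] using e(1) by (simp add: mat_vector vector_smult_assoc flip: matrix_vector_mul_assoc)
  then have "(d * a) *s lift z' = lift (heis s v z)" unfolding hmat_lift by simp
  then have z': "z' = heis s v z" using lift_inj by blast
  then show ?thesis using z unfolding horoset_iff hmat_lift[symmetric] by (simp add: hmat_lift Umat_herm[OF hmat_Umat, of s v, unfolded hmat_lift] flip: hmat_lift)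
qed

text \<open>The orbit of a point of the horosphere is outside all cusp neighbourhoods, hence in the compact
  part of the quotient; there, orbits have representatives of bounded length.\<close>

lemma cusp_end_frame: assumes A: "A \<in> C" shows "cusp_end (frame_group \<Gamma> A) (c A)"
proof -
  note AU = C_Umat[OF A]
  let ?P = "frame_group \<Gamma> A"
  interpret P: cusped_group ?P by (rule cusped_group_frame[OF A])
  define bdry where "bdry w = pair (- of_real (c A + (norm w)\<^sup>2 / 2)) w" for w :: "complex^'m"
  have b_herm: "Re (herm (lift (bdry w)) (lift (bdry w))) = - 2 * c A" for w
    unfolding bdry_def by (simp add: herm_self lift_eq)
  have cA: "c A > 0" by (rule c_positive[OF A])
  obtain K where K: "compactin (CH_quotient \<Gamma>) K"
      "topspace (CH_quotient \<Gamma>) = K \<union> (\<Union>A\<in>C. orbit \<Gamma> ` horoball A (c A))"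
    using cusp_decompositionD(5) by blast
  \<comment> \<open>If the point were in an open horoball of the family, so would be nearby points of the
    horoball at \<open>A\<close>; then the two horoballs are related by an element fixing the cusp.\<close>
  have inK: "orbit \<Gamma> (frame_pt A (bdry w)) \<in> K" for w
  proof (rule ccontr)
    assume nK: "orbit \<Gamma> (frame_pt A (bdry w)) \<notin> K"
    have "bdry w \<in> siegel" unfolding siegel_iff b_herm using cA by simp
    then have "orbit \<Gamma> (frame_pt A (bdry w)) \<in> topspace (CH_quotient \<Gamma>)"
      unfolding topspace_CH_quotient using frame_pt_CH[OF AU] by blast
    then obtain B where B: "B \<in> C" "orbit \<Gamma> (frame_pt A (bdry w)) \<in> orbit \<Gamma> ` horoball B (c B)"
      using nK unfolding K(2) by blast
    then obtain z where z: "z \<in> horoset (c B)" "orbit \<Gamma> (frame_pt A (bdry w)) = orbit \<Gamma> (frame_pt B z)"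
      unfolding horoball_eq by blast
    note BU = C_Umat[OF B(1)]
    obtain M where M: "M \<in> \<Union>\<Gamma>" "line (M *v (A *v lift (bdry w))) = line (B *v lift z)"
      using z(2) unfolding frame_pt_def orbit_eq_iff by blast
    have MU: "M \<in> Umat" and Mg: "cls M \<in> \<Gamma>" using M(1) Union_iff[OF subgroup_\<Gamma>] by auto
    define N where "N = matrix_inv B ** (M ** A)"
    have NU: "N \<in> Umat" unfolding N_def by (intro Umat_mult Umat_inv BU MU AU)
    have BN: "B *v (N *v x) = M *v (A *v x)" for x
      unfolding N_def using BU by (simp flip: matrix_vector_mul_assoc)
    obtain a where a: "a \<noteq> 0" "N *v lift (bdry w) = a *s lift z"
    proof -
      have "line (B *v (N *v lift (bdry w))) = frame_pt B z \<and> N *v lift (bdry w) \<noteq> 0"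
        unfolding BN frame_pt_def using M(2) Umat_lift_nonzero[OF NU] by blast
      then show ?thesis using frame_pt_eq_iff[OF BU] that by blast
    qed
    define y where "y t = lift (bdry w) - of_real t *s f1" for t :: real
    have y_lift: "y t = lift (pair (- of_real (c A + t + (norm w)\<^sup>2 / 2)) w)" for t
      unfolding y_def bdry_def by (simp add: lift_eq vec_n1_eq_iff)
    \<comment> \<open>The image of \<open>y t\<close> stays in the open horoball for small \<open>t\<close>.\<close>
    have y0: "y 0 = lift (bdry w)" unfolding y_def by simp
    have cb0: "cb (N *v y 0) = a" unfolding y0 a(2) by (simp add: lift_eq)
    have lim: "((\<lambda>t. Re (herm (y t) (y t)) + 2 * c B * (cmod (cb (N *v y t)))\<^sup>2) \<longlongrightarrow>
        Re (herm (y 0) (y 0)) + 2 * c B * (cmod (cb (N *v y 0)))\<^sup>2) (at_right 0)"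
      unfolding y_def matrix_vector_mult_diff_distrib smult_vector herm_simps
      by (auto intro!: tendsto_eq_intros)
    have "Re (herm (y 0) (y 0)) + 2 * c B * (cmod (cb (N *v y 0)))\<^sup>2 < 0"
    proof -
      have "Re (herm (y 0) (y 0)) = Re (herm (N *v y 0) (N *v y 0))" by (simp add: Umat_herm[OF NU])
      also have "N *v y 0 = a *s lift z" unfolding y0 by (rule a(2))
      also have "Re (herm (a *s lift z) (a *s lift z)) = (cmod a)\<^sup>2 * Re (herm (lift z) (lift z))" by (rule smult_Re_herm)
      also have "\<dots> < (cmod a)\<^sup>2 * (- 2 * c B)"
        using z(1) a(1) unfolding horoset_iff by (intro mult_strict_left_mono) auto
      finally show ?thesis unfolding cb0 by (simp add: mult_ac)
    qed
    then have "\<forall>\<^sub>F t in at_right 0. Re (herm (y t) (y t)) + 2 * c B * (cmod (cb (N *v y t)))\<^sup>2 < 0"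
      using order_tendstoD(2)[OF lim] by blast
    then obtain b where b: "b > 0" "\<And>t. t > 0 \<Longrightarrow> t < b \<Longrightarrow> Re (herm (y t) (y t)) + 2 * c B * (cmod (cb (N *v y t)))\<^sup>2 < 0"
      unfolding eventually_at_right_field by blast
    define t where "t = b / 2"
    have t: "t > 0" "t < b" unfolding t_def using b(1) by auto
    define x where "x = pair (- of_real (c A + t + (norm w)\<^sup>2 / 2)) w"
    have yx: "y t = lift x" unfolding x_def y_lift ..
    have xH: "x \<in> horoset (c A)" unfolding x_def horoset_def using t by simp
    have neg: "Re (herm (N *v y t) (N *v y t)) < - 2 * c B * (cmod (cb (N *v y t)))\<^sup>2"
      using b(2)[OF t] unfolding Umat_herm[OF NU] by simp
    have "Re (herm (N *v y t) (N *v y t)) < 0"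
      using neg c_positive[OF B(1)] by (smt (verit) mult_nonneg_nonneg mult_minus_left zero_le_power2)
    then obtain z' where z': "z' \<in> siegel" "N *v y t = cb (N *v y t) *s lift z'" "cb (N *v y t) \<noteq> 0"
      by (rule negative_lift)
    have z'H: "z' \<in> horoset (c B)"
    proof -
      have "(cmod (cb (N *v y t)))\<^sup>2 * Re (herm (lift z') (lift z')) < (cmod (cb (N *v y t)))\<^sup>2 * (- 2 * c B)"
        using neg smult_Re_herm[of "cb (N *v y t)" "lift z'"] unfolding z'(2)[symmetric] by (simp add: mult_ac)
      moreover have "0 < (cmod (cb (N *v y t)))\<^sup>2" using z'(3) by simp
      ultimately show ?thesis unfolding horoset_iff by (simp only: mult_less_cancel_left_pos)
    qed
    have "act (cls M) (frame_pt A x) = frame_pt B z'"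
      unfolding frame_pt_def act_cls BN[symmetric] yx[symmetric]
      by (subst z'(2)) (simp add: smult_vector line_smult[OF z'(3)])
    then have "act (cls M) ` horoball A (c A) \<inter> horoball B (c B) \<noteq> {}"
      unfolding horoball_eq using xH z'H by blast
    then have AB: "A = B" and "act (cls M) (cusp_pt A) = cusp_pt A"
      using cusp_decompositionD(4) A B(1) Mg by blast+
    have NP: "N \<in> ?P" unfolding frame_group_def N_def AB
      using M(1) conj_Umat[OF BU, of M] by (simp add: matrix_mul_assoc)
    obtain \<mu> where \<mu>: "N *v f1 = \<mu> *s f1"
      using horoball_invariant[OF A NP xH _ z'(2)[unfolded yx]] z'H AB by blast
    have "bdry w \<in> horoset (c A)"
      by (rule stabiliser_preserves_horoset[OF A NP \<mu> a(2,1)]) (use z(1) AB in simp)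
    then show False unfolding horoset_iff b_herm by simp
  qed
  obtain B where B: "\<And>x. Re (herm x x) = - 2 * c A \<Longrightarrow> orbit \<Gamma> (line x) \<in> K \<Longrightarrow> \<exists>M\<in>\<Union>\<Gamma>. norm (M *v x) \<le> B"
    using compact_orbits_bounded[OF K(1), of "- 2 * c A"] cA by auto
  have scaleR: "r *\<^sub>R x = of_real r *s x" for r and x :: "'m vec_n1"
    by (simp add: vec_eq_iff complex_eq_iff)
  have "bounded_linear ((*v) (matrix_inv A))"
    by (intro linear_conv_bounded_linear[THEN iffD1] linearI)
      (simp_all add: matrix_vector_right_distrib scaleR smult_vector)
  then obtain k where k: "k > 0" "\<And>x. norm (matrix_inv A *v x) \<le> norm x * k"
    using bounded_linear.pos_bounded by blast
  have "\<exists>N\<in>?P. norm (N *v lift (bdry w)) \<le> B * k" for w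
  proof -
    have "Re (herm (A *v lift (bdry w)) (A *v lift (bdry w))) = - 2 * c A" unfolding Umat_herm[OF AU] by (rule b_herm)
    moreover have "orbit \<Gamma> (line (A *v lift (bdry w))) \<in> K" using inK unfolding frame_pt_def .
    ultimately obtain M where M: "M \<in> \<Union>\<Gamma>" "norm (M *v (A *v lift (bdry w))) \<le> B" using B by blast
    have "matrix_inv A ** M ** A \<in> ?P" unfolding frame_group_def using M(1) by (simp add: conj_Umat[OF AU])
    moreover have "norm (matrix_inv A ** M ** A *v lift (bdry w)) \<le> B * k"
      using order_trans[OF k(2) mult_right_mono[OF M(2)]] k(1) by (simp flip: matrix_vector_mul_assoc)
    ultimately show ?thesis by blast
  qed
  then show ?thesis
    using horoball_invariant[OF A] cA unfolding bdry_def by unfold_locales blast+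
qed

end

section \<open>Derivatives of smooth functions\<close>

lemma frechet_derivative_cong_open:
  assumes "open S" "x \<in> S" "\<And>y. y \<in> S \<Longrightarrow> f y = h y"
  shows "frechet_derivative f (at x) = frechet_derivative h (at x)"
proof -
  have "(f has_derivative D) (at x) \<longleftrightarrow> (h has_derivative D) (at x)" for D
    using assms has_derivative_transform_within_open[of f D x UNIV S h]
      has_derivative_transform_within_open[of h D x UNIV S f] by auto
  then show ?thesis unfolding frechet_derivative_def by simp
qed

lemma Ck_on_cong:
  assumes "open S" "\<And>y. y \<in> S \<Longrightarrow> f y = h y"
  shows "Ck_on k f S \<longleftrightarrow> Ck_on k h S"
  using assms(2)
proof (induction k arbitrary: f h)
  case 0
  then show ?case by (auto intro: continuous_on_cong)
next
  case (Suc k)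
  have "(f has_derivative D) (at x) \<longleftrightarrow> (h has_derivative D) (at x)" if "x \<in> S" for D x
    using Suc.prems assms(1) that has_derivative_transform_within_open[of f D x UNIV S h]
      has_derivative_transform_within_open[of h D x UNIV S f] by auto
  then have 1: "f differentiable (at x) \<longleftrightarrow> h differentiable (at x)" if "x \<in> S" for x
    using that unfolding differentiable_def by auto
  have "Ck_on k (\<lambda>x. frechet_derivative f (at x) u) S = Ck_on k (\<lambda>x. frechet_derivative h (at x) u) S" for u
  proof (rule Suc.IH)
    show "frechet_derivative f (at x) u = frechet_derivative h (at x) u" if "x \<in> S" for x
      by (rule fun_cong[OF frechet_derivative_cong_open[OF assms(1) that]]) (rule Suc.prems)
  qed
  with 1 show ?case by auto
qed

lemma Ck_on_Union:
  assumes "\<And>S. S \<in> \<S> \<Longrightarrow> open S" "\<And>S. S \<in> \<S> \<Longrightarrow> Ck_on k f S"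
  shows "Ck_on k f (\<Union>\<S>)"
  using assms(2)
proof (induction k arbitrary: f)
  case 0
  then show ?case using assms(1) by (auto intro: continuous_on_open_Union)
next
  case (Suc k)
  then show ?case by auto
qed

lemma smooth_on_cong:
  assumes "open S" "\<And>y. y \<in> S \<Longrightarrow> f y = h y"
  shows "smooth_on f S \<longleftrightarrow> smooth_on h S"
  unfolding smooth_on_def using Ck_on_cong[OF assms] by simp

lemma smooth_on_Union:
  assumes "\<And>S. S \<in> \<S> \<Longrightarrow> open S" "\<And>S. S \<in> \<S> \<Longrightarrow> smooth_on f S"
  shows "smooth_on f (\<Union>\<S>)"
  using assms unfolding smooth_on_def by (auto intro: Ck_on_Union)

lemma DERIV_along_line:
  fixes f :: "'e::real_normed_vector \<Rightarrow> real"
  assumes "(f has_derivative D) (at (x + s *\<^sub>R u))"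
  shows "((\<lambda>s. f (x + s *\<^sub>R u)) has_real_derivative D u) (at s)"
proof -
  have "((\<lambda>s. x + s *\<^sub>R u) has_derivative (\<lambda>h. h *\<^sub>R u)) (at s)"
    by (auto intro!: derivative_eq_intros)
  from has_derivative_compose[OF this assms]
  have "((\<lambda>s. f (x + s *\<^sub>R u)) has_derivative (\<lambda>h. D (h *\<^sub>R u))) (at s)" .
  moreover have "(\<lambda>h. D (h *\<^sub>R u)) = (*) (D u)"
    using linear_scale[OF has_derivative_linear[OF assms]] by (simp add: fun_eq_iff)
  ultimately show ?thesis unfolding has_field_derivative_def by simp
qed

text \<open>The second difference of a \<open>C\<^sup>2\<close> function over a small parallelogram is \<open>h\<^sup>2\<close> times a mixed
  second derivative at an intermediate point: apply the mean value theorem once in each direction.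
  As the second difference is symmetric in the two directions, so are the mixed derivatives.\<close>

lemma second_difference_mean_value:
  fixes f :: "'e::real_normed_vector \<Rightarrow> real"
  assumes h: "h > 0"
    and sub: "\<And>s t. 0 \<le> s \<Longrightarrow> s \<le> h \<Longrightarrow> 0 \<le> t \<Longrightarrow> t \<le> h \<Longrightarrow> x + s *\<^sub>R u + t *\<^sub>R v \<in> S"
    and f: "\<And>y. y \<in> S \<Longrightarrow> f differentiable (at y)"
    and f': "\<And>y. y \<in> S \<Longrightarrow> (\<lambda>y. frechet_derivative f (at y) u) differentiable (at y)"
  shows "\<exists>s t. 0 < s \<and> s < h \<and> 0 < t \<and> t < h \<and>
    f (x + h *\<^sub>R u + h *\<^sub>R v) - f (x + h *\<^sub>R u) - f (x + h *\<^sub>R v) + f x =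
    h\<^sup>2 * frechet_derivative (\<lambda>y. frechet_derivative f (at y) u) (at (x + s *\<^sub>R u + t *\<^sub>R v)) v"
proof -
  let ?d = "\<lambda>y. frechet_derivative f (at y) u"
  let ?p = "\<lambda>s. f ((x + h *\<^sub>R v) + s *\<^sub>R u) - f (x + s *\<^sub>R u)"
  have 1: "(?p has_real_derivative ?d ((x + h *\<^sub>R v) + s *\<^sub>R u) - ?d (x + s *\<^sub>R u)) (at s)"
    if "0 \<le> s" "s \<le> h" for s
  proof -
    have "x + s *\<^sub>R u + h *\<^sub>R v \<in> S" "x + s *\<^sub>R u + 0 *\<^sub>R v \<in> S" using sub that h by (meson order.refl less_imp_le)+
    then have "(f has_derivative frechet_derivative f (at (x + h *\<^sub>R v + s *\<^sub>R u))) (at (x + h *\<^sub>R v + s *\<^sub>R u))"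
      "(f has_derivative frechet_derivative f (at (x + s *\<^sub>R u))) (at (x + s *\<^sub>R u))"
      using f frechet_derivative_works by (auto simp: algebra_simps)
    then show ?thesis by (intro DERIV_diff DERIV_along_line)
  qed
  from MVT2[OF h 1] obtain s where s: "0 < s" "s < h"
    "?p h - ?p 0 = h * (?d ((x + h *\<^sub>R v) + s *\<^sub>R u) - ?d (x + s *\<^sub>R u))" by auto
  let ?q = "\<lambda>t. ?d ((x + s *\<^sub>R u) + t *\<^sub>R v)"
  have 2: "(?q has_real_derivative frechet_derivative ?d (at ((x + s *\<^sub>R u) + t *\<^sub>R v)) v) (at t)"
    if "0 \<le> t" "t \<le> h" for t
  proof -
    have "x + s *\<^sub>R u + t *\<^sub>R v \<in> S" using sub that s by auto
    then have "(?d has_derivative frechet_derivative ?d (at (x + s *\<^sub>R u + t *\<^sub>R v))) (at (x + s *\<^sub>R u + t *\<^sub>R v))"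
      using f' frechet_derivative_works by blast
    then show ?thesis by (rule DERIV_along_line)
  qed
  from MVT2[OF h 2] obtain t where t: "0 < t" "t < h"
    "?q h - ?q 0 = h * frechet_derivative ?d (at ((x + s *\<^sub>R u) + t *\<^sub>R v)) v" by auto
  show ?thesis
    using s t by (intro exI[of _ s] exI[of _ t]) (simp add: algebra_simps power2_eq_square)
qed

lemma frechet_derivative_commute:
  fixes f :: "'e::euclidean_space \<Rightarrow> real"
  assumes S: "open S" "x \<in> S" and f: "Ck_on (Suc (Suc 0)) f S"
  shows "frechet_derivative (\<lambda>y. frechet_derivative f (at y) u) (at x) v =
         frechet_derivative (\<lambda>y. frechet_derivative f (at y) v) (at x) u"
proof -
  let ?D = "\<lambda>u v x. frechet_derivative (\<lambda>y. frechet_derivative f (at y) u) (at x) v"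
  have df: "f differentiable (at y)" if "y \<in> S" for y using f that by simp
  have ddf: "(\<lambda>y. frechet_derivative f (at y) u) differentiable (at y)" if "y \<in> S" for y u
    using f that by simp
  have cont: "continuous_on S (?D u v)" for u v using f by simp
  have close: "\<bar>?D u v x - ?D v u x\<bar> \<le> e" if e: "e > 0" for e
  proof -
    have "\<exists>d>0. \<forall>y\<in>S. dist y x < d \<longrightarrow> dist (?D u v y) (?D u v x) < e/2" for u v
      using cont[of u v] S(2) e unfolding continuous_on_iff by (meson half_gt_zero)
    then obtain d1 d2 where d: "d1 > 0" "d2 > 0"
      "\<And>y. y \<in> S \<Longrightarrow> dist y x < d1 \<Longrightarrow> dist (?D u v y) (?D u v x) < e/2"
      "\<And>y. y \<in> S \<Longrightarrow> dist y x < d2 \<Longrightarrow> dist (?D v u y) (?D v u x) < e/2" by metis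
    obtain d3 where d3: "d3 > 0" "ball x d3 \<subseteq> S" using S open_contains_ball by blast
    define r where "r = min d1 (min d2 d3)"
    have r: "r > 0" using d d3 r_def by auto
    define h where "h = r / (2 * (norm u + norm v + 1))"
    have h: "h > 0" unfolding h_def using r by (intro divide_pos_pos) (auto intro: add_nonneg_pos)
    have near: "dist (x + s *\<^sub>R u + t *\<^sub>R v) x < r" if "0 \<le> s" "s \<le> h" "0 \<le> t" "t \<le> h" for s t
    proof -
      have "dist (x + s *\<^sub>R u + t *\<^sub>R v) x = norm (s *\<^sub>R u + t *\<^sub>R v)" by (simp add: dist_norm)
      also have "\<dots> \<le> s * norm u + t * norm v" using norm_triangle_ineq[of "s *\<^sub>R u" "t *\<^sub>R v"] that by simp
      also have "\<dots> \<le> h * norm u + h * norm v" using that by (intro add_mono mult_right_mono) auto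
      also have "\<dots> < h * (2 * (norm u + norm v + 1))"
      proof -
        have "0 \<le> h * norm u" "0 \<le> h * norm v" using h by auto
        then show ?thesis using h unfolding distrib_left by linarith
      qed
      also have "\<dots> = r"
      proof -
        have "norm u + norm v + 1 > 0" by (simp add: add_nonneg_pos)
        then show ?thesis unfolding h_def by simp
      qed
      finally show ?thesis .
    qed
    have inS: "x + s *\<^sub>R u + t *\<^sub>R v \<in> S" if "0 \<le> s" "s \<le> h" "0 \<le> t" "t \<le> h" for s t
      using near[OF that] d3 unfolding r_def by (auto simp: dist_commute subset_iff)
    obtain s t where st: "0 < s" "s < h" "0 < t" "t < h"
      "f (x + h *\<^sub>R u + h *\<^sub>R v) - f (x + h *\<^sub>R u) - f (x + h *\<^sub>R v) + f x = h\<^sup>2 * ?D u v (x + s *\<^sub>R u + t *\<^sub>R v)"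
      using second_difference_mean_value[of h x u v S f, OF h inS df ddf] by blast
    have "x + s *\<^sub>R v + t *\<^sub>R u \<in> S" if "0 \<le> s" "s \<le> h" "0 \<le> t" "t \<le> h" for s t
      using inS[OF that(3,4,1,2)] by (simp add: algebra_simps)
    then obtain s' t' where st': "0 < s'" "s' < h" "0 < t'" "t' < h"
      "f (x + h *\<^sub>R v + h *\<^sub>R u) - f (x + h *\<^sub>R v) - f (x + h *\<^sub>R u) + f x = h\<^sup>2 * ?D v u (x + s' *\<^sub>R v + t' *\<^sub>R u)"
      using second_difference_mean_value[of h x v u S f, OF h _ df ddf] by blast
    have sw: "x + s' *\<^sub>R v + t' *\<^sub>R u = x + t' *\<^sub>R u + s' *\<^sub>R v" by simp
    have "h\<^sup>2 * ?D u v (x + s *\<^sub>R u + t *\<^sub>R v) = h\<^sup>2 * ?D v u (x + s' *\<^sub>R v + t' *\<^sub>R u)"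
      using st(5) st'(5) by (simp add: algebra_simps)
    then have eq: "?D u v (x + s *\<^sub>R u + t *\<^sub>R v) = ?D v u (x + t' *\<^sub>R u + s' *\<^sub>R v)" using h sw by simp
    have "dist (?D u v (x + s *\<^sub>R u + t *\<^sub>R v)) (?D u v x) < e/2"
      using d(3) inS near st by (simp add: r_def)
    moreover have "dist (?D v u (x + t' *\<^sub>R u + s' *\<^sub>R v)) (?D v u x) < e/2"
      using d(4) inS near st' by (simp add: r_def)
    ultimately show ?thesis using eq unfolding dist_real_def by linarith
  qed
  have "\<bar>?D u v x - ?D v u x\<bar> \<le> 0" by (rule field_le_epsilon) (use close in simp)
  then show ?thesis by simp
qed

section \<open>The Levi-Civita connection and the curvature tensor in coordinates\<close>

locale riemannian_region =
  fixes W :: "'e::euclidean_space set" and g :: "'e metric_tensor"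
  assumes open_W: "open W"
    and smooth_g: "smooth_on (\<lambda>x. g x u v) W"
    and bilinear_g: "x \<in> W \<Longrightarrow> bilinear (g x)"
    and sym_g: "x \<in> W \<Longrightarrow> g x u v = g x v u"
    and pos_g: "x \<in> W \<Longrightarrow> u \<noteq> 0 \<Longrightarrow> g x u u > 0"
begin

definition dg where "dg x u a b = frechet_derivative (\<lambda>y. g y a b) (at x) u"

definition ddg where "ddg x v u a b = frechet_derivative (\<lambda>y. dg y u a b) (at x) v"

abbreviation \<Gamma> where "\<Gamma> \<equiv> christoffel g"

lemma Ck_g: "Ck_on k (\<lambda>x. g x a b) W"
  using smooth_g unfolding smooth_on_def by blast

lemma has_derivative_g:
  assumes "x \<in> W" shows "((\<lambda>y. g y a b) has_derivative (\<lambda>u. dg x u a b)) (at x)"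
  using Ck_g[of "Suc 0" a b] assms unfolding dg_def by (simp add: frechet_derivative_works)

lemma has_derivative_dg:
  assumes "x \<in> W" shows "((\<lambda>y. dg y u a b) has_derivative (\<lambda>v. ddg x v u a b)) (at x)"
  using Ck_g[of "Suc (Suc 0)" a b] assms unfolding ddg_def dg_def by (simp add: frechet_derivative_works)

lemma continuous_on_ddg: "continuous_on W (\<lambda>x. ddg x v u a b)"
  using Ck_g[of "Suc (Suc 0)" a b] unfolding ddg_def dg_def by simp

lemma ddg_commute: "x \<in> W \<Longrightarrow> ddg x v u a b = ddg x u v a b"
  unfolding ddg_def dg_def by (rule frechet_derivative_commute[OF open_W _ Ck_g])

lemma linear_g1: "x \<in> W \<Longrightarrow> linear (\<lambda>a. g x a b)"
  using bilinear_g bilinear_def by blast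

lemma linear_g2: "x \<in> W \<Longrightarrow> linear (g x a)"
  using bilinear_g bilinear_def by blast

lemmas g_simps =
  bilinear_ladd[OF bilinear_g] bilinear_radd[OF bilinear_g] bilinear_lmul[OF bilinear_g]
  bilinear_rmul[OF bilinear_g] bilinear_lneg[OF bilinear_g] bilinear_rneg[OF bilinear_g]
  bilinear_lsub[OF bilinear_g] bilinear_rsub[OF bilinear_g] bilinear_lzero[OF bilinear_g]
  bilinear_rzero[OF bilinear_g]

lemma dg_cong:
  assumes "x \<in> W" "\<And>y. y \<in> W \<Longrightarrow> g y a b = F y" "(F has_derivative D) (at x)"
  shows "dg x u a b = D u"
proof -
  have "((\<lambda>y. g y a b) has_derivative D) (at x)"
    using has_derivative_transform_within_open[OF assms(3) open_W assms(1)] assms(2) by auto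
  then show ?thesis using has_derivative_unique[OF has_derivative_g[OF assms(1)]] by metis
qed

lemma ddg_cong:
  assumes "x \<in> W" "\<And>y. y \<in> W \<Longrightarrow> dg y u a b = F y" "(F has_derivative D) (at x)"
  shows "ddg x v u a b = D v"
proof -
  have "((\<lambda>y. dg y u a b) has_derivative D) (at x)"
    using has_derivative_transform_within_open[OF assms(3) open_W assms(1)] assms(2) by auto
  then show ?thesis using has_derivative_unique[OF has_derivative_dg[OF assms(1)]] by metis
qed

lemma dg_sym: "x \<in> W \<Longrightarrow> dg x u a b = dg x u b a"
  by (rule dg_cong[OF _ sym_g has_derivative_g])

lemma linear_dg1: "x \<in> W \<Longrightarrow> linear (\<lambda>u. dg x u a b)"
  using has_derivative_linear[OF has_derivative_g] by blast

lemma linear_dg2: assumes "x \<in> W" shows "linear (\<lambda>a. dg x u a b)"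
proof (rule linearI)
  show "dg x u (a + a') b = dg x u a b + dg x u a' b" for a a'
    by (rule dg_cong[OF assms _ has_derivative_add[OF has_derivative_g has_derivative_g]])
      (auto simp: g_simps assms)
  show "dg x u (c *\<^sub>R a) b = c *\<^sub>R dg x u a b" for c a
    by (rule dg_cong[OF assms _ has_derivative_scaleR_right[OF has_derivative_g]])
      (auto simp: g_simps assms)
qed

lemma linear_dg3: assumes "x \<in> W" shows "linear (\<lambda>b. dg x u a b)"
  using linear_dg2[OF assms, of u a] dg_sym[OF assms] by presburger

lemma linear_ddg1: "x \<in> W \<Longrightarrow> linear (\<lambda>v. ddg x v u a b)"
  using has_derivative_linear[OF has_derivative_dg] by blast

lemma linear_ddg2: "x \<in> W \<Longrightarrow> linear (\<lambda>u. ddg x v u a b)"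
  using linear_ddg1[of x v a b] ddg_commute[of x v _ a b] by presburger

lemma linear_ddg3: assumes "x \<in> W" shows "linear (\<lambda>a. ddg x v u a b)"
proof (rule linearI)
  show "ddg x v u (a + a') b = ddg x v u a b + ddg x v u a' b" for a a'
    by (rule ddg_cong[OF assms _ has_derivative_add[OF has_derivative_dg has_derivative_dg]])
      (auto simp: assms linear_add[OF linear_dg2])
  show "ddg x v u (c *\<^sub>R a) b = c *\<^sub>R ddg x v u a b" for c a
    by (rule ddg_cong[OF assms _ has_derivative_scaleR_right[OF has_derivative_dg]])
      (auto simp: assms linear_scale[OF linear_dg2])
qed

lemma ddg_sym: "x \<in> W \<Longrightarrow> ddg x v u a b = ddg x v u b a"
  by (rule ddg_cong[OF _ dg_sym has_derivative_dg])

lemma linear_ddg4: assumes "x \<in> W" shows "linear (\<lambda>b. ddg x v u a b)"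
  using linear_ddg3[OF assms, of v u a] ddg_sym[OF assms] by presburger

subsection \<open>Christoffel symbols\<close>

lemma g_nondegenerate:
  assumes "x \<in> W" "\<And>w. g x k w = g x k' w"
  shows "k = k'"
proof (rule ccontr)
  assume "k \<noteq> k'"
  then have "g x (k - k') (k - k') > 0" using pos_g assms(1) by simp
  then show False using assms by (simp add: g_simps)
qed

definition lower where "lower x k = (\<Sum>b\<in>Basis. g x k b *\<^sub>R b)"

lemma linear_lower: "x \<in> W \<Longrightarrow> linear (lower x)"
  unfolding lower_def
  by (auto intro!: linearI simp: g_simps scaleR_add_left sum.distrib scaleR_sum_right)

lemma inner_lower: "b \<in> Basis \<Longrightarrow> lower x k \<bullet> b = g x k b"
  unfolding lower_def by (simp add: inner_sum_left inner_Basis if_distrib cong: if_cong)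

lemma inj_lower: assumes "x \<in> W" shows "inj (lower x)"
proof (rule injI)
  fix k k' assume eq: "lower x k = lower x k'"
  then have "g x k b = g x k' b" if "b \<in> Basis" for b
    using inner_lower[OF that, of x] by metis
  then have "g x k w = g x k' w" for w
    using linear_eq_on[OF linear_g2[OF assms, of k] linear_g2[OF assms, of k'], of w Basis] by auto
  then show "k = k'" using g_nondegenerate[OF assms] by blast
qed

lemma riesz_ex1:
  assumes x: "x \<in> W" and l: "linear l"
  shows "\<exists>!k. \<forall>w. g x k w = l w"
proof -
  have "surj (lower x)"
    using linear_injective_imp_surjective linear_lower inj_lower x by blast
  then obtain k where k: "lower x k = (\<Sum>b\<in>Basis. l b *\<^sub>R b)" by (metis surjD)
  have "g x k b = l b" if "b \<in> Basis" for b
    using inner_lower[OF that, of x k] k that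
    by (simp add: inner_sum_left inner_Basis if_distrib cong: if_cong)
  then have "g x k w = l w" for w
    using linear_eq_on[OF linear_g2[OF x, of k] l, of w Basis] by auto
  then show ?thesis using g_nondegenerate[OF x] by metis
qed

lemma christoffel:
  assumes x: "x \<in> W"
  shows "2 * g x (\<Gamma> x u v) w = dg x u v w + dg x v u w - dg x w u v"
proof -
  let ?l = "\<lambda>w. (dg x u v w + dg x v u w - dg x w u v) / 2"
  have "linear ?l"
    by (auto intro!: linearI simp: linear_add[OF linear_dg1[OF x]] linear_add[OF linear_dg3[OF x]]
        linear_scale[OF linear_dg1[OF x]] linear_scale[OF linear_dg3[OF x]] field_simps)
  then have "\<exists>!k. \<forall>w. g x k w = ?l w" by (rule riesz_ex1[OF x])
  then have "\<exists>!k. \<forall>w. 2 * g x k w = dg x u v w + dg x v u w - dg x w u v"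
    by (simp add: field_simps)
  from theI'[OF this] show ?thesis unfolding christoffel_def dg_def by blast
qed

lemma christoffel_eqI:
  assumes "x \<in> W" "\<And>w. 2 * g x k w = dg x u v w + dg x v u w - dg x w u v"
  shows "\<Gamma> x u v = k"
  by (rule g_nondegenerate[OF assms(1)]) (use christoffel[OF assms(1)] assms(2) in \<open>smt (verit)\<close>)

lemma christoffel_commute: "x \<in> W \<Longrightarrow> \<Gamma> x u v = \<Gamma> x v u"
  by (rule christoffel_eqI) (auto simp: christoffel dg_sym)

lemma linear_christoffel2: assumes x: "x \<in> W" shows "linear (\<Gamma> x u)"
proof (rule linearI)
  note l = linear_add[OF linear_dg1[OF x]] linear_add[OF linear_dg2[OF x]] linear_add[OF linear_dg3[OF x]]
        linear_scale[OF linear_dg1[OF x]] linear_scale[OF linear_dg2[OF x]] linear_scale[OF linear_dg3[OF x]]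
  show "\<Gamma> x u (a + b) = \<Gamma> x u a + \<Gamma> x u b" for a b
    by (rule christoffel_eqI[OF x]) (simp add: g_simps x distrib_left christoffel l)
  show "\<Gamma> x u (c *\<^sub>R a) = c *\<^sub>R \<Gamma> x u a" for c a
  proof (rule christoffel_eqI[OF x])
    fix w
    have "2 * g x (c *\<^sub>R \<Gamma> x u a) w = c * (2 * g x (\<Gamma> x u a) w)" by (simp add: g_simps x)
    then show "2 * g x (c *\<^sub>R \<Gamma> x u a) w = dg x u (c *\<^sub>R a) w + dg x (c *\<^sub>R a) u w - dg x w u (c *\<^sub>R a)"
      by (simp add: christoffel[OF x] l algebra_simps)
  qed
qed

lemma linear_christoffel1: assumes x: "x \<in> W" shows "linear (\<lambda>u. \<Gamma> x u v)"
proof -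
  have "(\<lambda>u. \<Gamma> x u v) = \<Gamma> x v" using christoffel_commute[OF x] by blast
  then show ?thesis using linear_christoffel2[OF x] by metis
qed

lemma metric_compatible:
  assumes "x \<in> W"
  shows "dg x u a b = g x (\<Gamma> x u a) b + g x a (\<Gamma> x u b)"
  using christoffel[OF assms, of u a b] christoffel[OF assms, of u b a]
    sym_g[OF assms, of a "\<Gamma> x u b"] dg_sym[OF assms, of u a b] dg_sym[OF assms, of a b u]
    dg_sym[OF assms, of b a u] by linarith

lemma linear_expand:
  fixes L :: "'e \<Rightarrow> real"
  assumes "linear L" shows "L v = (\<Sum>i\<in>Basis. (v \<bullet> i) * L i)"
  using linear_sum[OF assms, of "\<lambda>i. (v \<bullet> i) *\<^sub>R i" Basis] linear_scale[OF assms]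
  by (simp add: euclidean_representation)

lemma has_derivative_g_field:
  assumes x: "x \<in> W" and k: "(k has_derivative k') (at x)"
  shows "((\<lambda>y. g y (k y) b) has_derivative (\<lambda>h. dg x h (k x) b + g x (k' h) b)) (at x)"
proof -
  have "((\<lambda>y. \<Sum>i\<in>Basis. (k y \<bullet> i) * g y i b) has_derivative
      (\<lambda>h. \<Sum>i\<in>Basis. (k x \<bullet> i) * dg x h i b + (k' h \<bullet> i) * g x i b)) (at x)"
    by (intro has_derivative_sum has_derivative_mult has_derivative_g x has_derivative_inner_left k)
  also have "(\<lambda>h. \<Sum>i\<in>Basis. (k x \<bullet> i) * dg x h i b + (k' h \<bullet> i) * g x i b) =
      (\<lambda>h. dg x h (k x) b + g x (k' h) b)"
    by (subst linear_expand[OF linear_dg2[OF x]], subst linear_expand[OF linear_g1[OF x]]) (simp add: sum.distrib)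
  finally show ?thesis
    by (rule has_derivative_transform_within_open[OF _ open_W x]) (use linear_expand[OF linear_g1] in metis)
qed

text \<open>A vector field is differentiable as soon as its products with the constant fields are:
  it is obtained from these by inverting \<open>(y, k) \<mapsto> (y, lower y k)\<close>.\<close>

lemma differentiable_raise:
  assumes x: "x \<in> W"
    and k: "\<And>y w. y \<in> W \<Longrightarrow> g y (k y) w = l w y"
    and l: "\<And>w. l w differentiable (at x)"
  shows "k differentiable (at x)"
proof -
  define F where "F = (\<lambda>p. (fst p, lower (fst p) (snd p)))"
  define G where "G = (\<lambda>p. (fst p, inv_into UNIV (lower (fst p)) (snd p)))"
  define F' where "F' = (\<lambda>y m p. (fst p, \<Sum>b\<in>Basis. (dg y (fst p) m b + g y (snd p) b) *\<^sub>R b))"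
  have F: "(F has_derivative F' y m) (at (y, m))" if "y \<in> W" for y m
  proof -
    have "((\<lambda>p. g (fst p) (snd p) b) has_derivative (\<lambda>p. dg y (fst p) m b + g y (snd p) b)) (at (y, m))" for b
    proof -
      have g1: "((\<lambda>p. g (fst p) i b) has_derivative (\<lambda>p. dg y (fst p) i b)) (at (y, m))" for i
        using has_derivative_compose[OF has_derivative_fst[OF has_derivative_ident, of "at (y, m)"],
            of "\<lambda>y. g y i b" "\<lambda>u. dg y u i b"] has_derivative_g[OF that] by simp
      have s1: "((\<lambda>p. snd p \<bullet> i) has_derivative (\<lambda>p. snd p \<bullet> i)) (at (y, m))" for i :: 'e
        by (intro has_derivative_inner_left has_derivative_snd has_derivative_ident)
      have "((\<lambda>p. \<Sum>i\<in>Basis. (snd p \<bullet> i) * g (fst p) i b) has_derivative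
        (\<lambda>p. \<Sum>i\<in>Basis. (snd (y, m) \<bullet> i) * dg y (fst p) i b + (snd p \<bullet> i) * g (fst (y, m)) i b)) (at (y, m))"
        by (intro has_derivative_sum has_derivative_mult g1 s1)
      also have "(\<lambda>p. \<Sum>i\<in>Basis. (snd (y, m) \<bullet> i) * dg y (fst p) i b + (snd p \<bullet> i) * g (fst (y, m)) i b)
         = (\<lambda>p. dg y (fst p) m b + g y (snd p) b)"
        by (rule ext, subst linear_expand[OF linear_dg2[OF that]], subst linear_expand[OF linear_g1[OF that]])
          (simp add: sum.distrib)
      finally show ?thesis
      proof (rule has_derivative_transform_within_open)
        show "open (W \<times> (UNIV :: 'e set))" using open_W by (intro open_Times) auto
        show "(y, m) \<in> W \<times> UNIV" using that by simp
        show "(\<Sum>i\<in>Basis. (snd p \<bullet> i) * g (fst p) i b) = g (fst p) (snd p) b" if "p \<in> W \<times> UNIV" for p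
          using linear_expand[OF linear_g1, of "fst p" "snd p" b] that by auto
      qed
    qed
    then show ?thesis unfolding F_def F'_def lower_def
      by (intro has_derivative_Pair has_derivative_fst has_derivative_ident has_derivative_sum
          has_derivative_scaleR_left)
  qed
  have openS: "open (W \<times> (UNIV :: 'e set))" using open_W by (intro open_Times) auto
  have contF: "continuous_on (W \<times> UNIV) F"
    by (rule continuous_at_imp_continuous_on) (use F has_derivative_continuous in fastforce)
  have GF: "G (F p) = p" if "p \<in> W \<times> UNIV" for p
    using that inj_lower unfolding F_def G_def by (auto simp: inv_f_f)
  define G' where "G' = (\<lambda>p. (fst p, inv_into UNIV (lower x) (snd p - (\<Sum>b\<in>Basis. dg x (fst p) (k x) b *\<^sub>R b))))"
  have surj: "surj (lower x)"
    using linear_injective_imp_surjective linear_lower inj_lower x by blast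
  have "F' x (k x) \<circ> G' = id"
  proof
    fix p :: "'e \<times> 'e"
    let ?q = "snd p - (\<Sum>b\<in>Basis. dg x (fst p) (k x) b *\<^sub>R b)"
    have "(\<Sum>b\<in>Basis. (dg x (fst p) (k x) b + g x (inv_into UNIV (lower x) ?q) b) *\<^sub>R b) =
       (\<Sum>b\<in>Basis. dg x (fst p) (k x) b *\<^sub>R b) + lower x (inv_into UNIV (lower x) ?q)"
      unfolding lower_def by (simp add: scaleR_add_left sum.distrib)
    also have "lower x (inv_into UNIV (lower x) ?q) = ?q" by (rule surj_f_inv_f[OF surj])
    finally show "(F' x (k x) \<circ> G') p = id p" unfolding F'_def G'_def by simp
  qed
  with F[OF x] GF have "(G has_derivative G') (at (F (x, k x)))"
    by (intro has_derivative_inverse_strong[OF openS _ contF]) (use x in auto)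
  then have "G differentiable (at (x, lower x (k x)))" unfolding F_def differentiable_def by auto
  moreover have lk: "lower y (k y) = (\<Sum>b\<in>Basis. l b y *\<^sub>R b)" if "y \<in> W" for y
    unfolding lower_def using k[OF that] by simp
  ultimately have G: "G differentiable (at (x, \<Sum>b\<in>Basis. l b x *\<^sub>R b))" using x by simp
  have "(\<lambda>y. (y, \<Sum>b\<in>Basis. l b y *\<^sub>R b)) differentiable (at x)"
  proof -
    have "((\<lambda>y. (y, \<Sum>b\<in>Basis. l b y *\<^sub>R b)) has_derivative
        (\<lambda>h. (h, \<Sum>b\<in>Basis. frechet_derivative (l b) (at x) h *\<^sub>R b))) (at x)"
      by (intro has_derivative_Pair has_derivative_ident has_derivative_sum has_derivative_scaleR_left
         l[THEN iffD1[OF frechet_derivative_works]])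
    then show ?thesis unfolding differentiable_def by blast
  qed
  then have "(G \<circ> (\<lambda>y. (y, \<Sum>b\<in>Basis. l b y *\<^sub>R b))) differentiable (at x)"
    using G by (intro differentiable_chain_at) auto
  then obtain D where "((G \<circ> (\<lambda>y. (y, \<Sum>b\<in>Basis. l b y *\<^sub>R b))) has_derivative D) (at x)"
    unfolding differentiable_def by blast
  then have "((\<lambda>y. snd ((G \<circ> (\<lambda>y. (y, \<Sum>b\<in>Basis. l b y *\<^sub>R b))) y)) has_derivative (\<lambda>h. snd (D h))) (at x)"
    by (rule has_derivative_snd)
  moreover have "snd ((G \<circ> (\<lambda>y. (y, \<Sum>b\<in>Basis. l b y *\<^sub>R b))) y) = k y" if "y \<in> W" for y
    using lk[OF that] inj_lower[OF that] unfolding G_def by (simp flip: lk[OF that] add: inv_f_f)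
  ultimately have "(k has_derivative (\<lambda>h. snd (D h))) (at x)"
    by (rule has_derivative_transform_within_open[OF _ open_W x])
  then show ?thesis unfolding differentiable_def by blast
qed

lemma differentiable_christoffel:
  assumes x: "x \<in> W" shows "(\<lambda>y. \<Gamma> y u v) differentiable (at x)"
proof (rule differentiable_raise[OF x])
  show "g y (\<Gamma> y u v) w = 1/2 * (dg y u v w + dg y v u w - dg y w u v)" if "y \<in> W" for y w
    using christoffel[OF that, of u v w] by simp
  show "(\<lambda>y. 1/2 * (dg y u v w + dg y v u w - dg y w u v)) differentiable (at x)" for w
  proof -
    have "((\<lambda>y. 1/2 * (dg y u v w + dg y v u w - dg y w u v)) has_derivative
        (\<lambda>h. 1/2 * (ddg x h u v w + ddg x h v u w - ddg x h w u v))) (at x)"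
      by (intro has_derivative_mult_right has_derivative_diff has_derivative_add has_derivative_dg x)
    then show ?thesis unfolding differentiable_def by blast
  qed
qed

subsection \<open>Second covariant derivatives and curvature\<close>

text \<open>\<open>\<nabla>\<^sub>u\<nabla>\<^sub>v w\<close> for constant vector fields.\<close>

definition nab where
  "nab x u v w = frechet_derivative (\<lambda>y. \<Gamma> y v w) (at x) u + \<Gamma> x u (\<Gamma> x v w)"

abbreviation R where "R \<equiv> curvature_tensor g"

lemma R_nab: "R x u v w = nab x u v w - nab x v u w"
  unfolding curvature_tensor_def nab_def by (simp add: algebra_simps)

lemma has_derivative_christoffel:
  assumes "x \<in> W"
  shows "((\<lambda>y. \<Gamma> y v w) has_derivative (\<lambda>u. nab x u v w - \<Gamma> x u (\<Gamma> x v w))) (at x)"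
  using differentiable_christoffel[OF assms, of v w] unfolding nab_def frechet_derivative_works by simp

lemma nab_cong:
  assumes x: "x \<in> W" and F: "\<And>y. y \<in> W \<Longrightarrow> \<Gamma> y v w = F y" "(F has_derivative D) (at x)"
  shows "nab x u v w = D u + \<Gamma> x u (\<Gamma> x v w)"
proof -
  have "((\<lambda>y. \<Gamma> y v w) has_derivative D) (at x)"
    using has_derivative_transform_within_open[OF F(2) open_W x] F(1) by auto
  then have "D = (\<lambda>u. nab x u v w - \<Gamma> x u (\<Gamma> x v w))"
    using has_derivative_unique[OF has_derivative_christoffel[OF x]] by metis
  then show ?thesis by simp
qed

lemmas christoffel_simps =
  linear_add[OF linear_christoffel1] linear_add[OF linear_christoffel2]
  linear_scale[OF linear_christoffel1] linear_scale[OF linear_christoffel2]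
  linear_diff[OF linear_christoffel1] linear_diff[OF linear_christoffel2]
  linear_neg[OF linear_christoffel1] linear_neg[OF linear_christoffel2]

lemma nab_commute: "x \<in> W \<Longrightarrow> nab x u v w = nab x u w v"
  by (subst nab_cong[OF _ christoffel_commute has_derivative_christoffel])
    (auto simp: christoffel_commute[of x v w])

lemma linear_nab1: assumes x: "x \<in> W" shows "linear (\<lambda>u. nab x u v w)"
proof -
  have "linear (\<lambda>u. (nab x u v w - \<Gamma> x u (\<Gamma> x v w)) + \<Gamma> x u (\<Gamma> x v w))"
    by (intro linear_compose_add has_derivative_linear[OF has_derivative_christoffel] linear_christoffel1 x)
  then show ?thesis by simp
qed

lemma linear_nab3: assumes x: "x \<in> W" shows "linear (\<lambda>w. nab x u v w)"
proof (rule linearI)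
  show "nab x u v (a + b) = nab x u v a + nab x u v b" for a b
    by (subst nab_cong[OF x _ has_derivative_add[OF has_derivative_christoffel[OF x] has_derivative_christoffel[OF x]]])
      (auto simp: christoffel_simps x)
  show "nab x u v (c *\<^sub>R a) = c *\<^sub>R nab x u v a" for c a
    by (subst nab_cong[OF x _ has_derivative_scaleR_right[OF has_derivative_christoffel[OF x]]])
      (auto simp: christoffel_simps x algebra_simps)
qed

lemma linear_nab2: assumes x: "x \<in> W" shows "linear (\<lambda>v. nab x u v w)"
proof -
  have "(\<lambda>v. nab x u v w) = nab x u w" using nab_commute[OF x] by blast
  then show ?thesis using linear_nab3[OF x] by metis
qed

lemma linear_R1: "x \<in> W \<Longrightarrow> linear (\<lambda>u. R x u v w)"
  unfolding R_nab by (intro linear_compose_sub linear_nab1 linear_nab2)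

lemma linear_R2: "x \<in> W \<Longrightarrow> linear (\<lambda>v. R x u v w)"
  unfolding R_nab by (intro linear_compose_sub linear_nab1 linear_nab2)

lemma linear_R3: "x \<in> W \<Longrightarrow> linear (\<lambda>w. R x u v w)"
  unfolding R_nab by (intro linear_compose_sub linear_nab3)

lemmas R_simps =
  linear_add[OF linear_R1] linear_add[OF linear_R2] linear_add[OF linear_R3]
  linear_diff[OF linear_R1] linear_diff[OF linear_R2] linear_diff[OF linear_R3]
  linear_neg[OF linear_R1] linear_neg[OF linear_R2] linear_neg[OF linear_R3]
  linear_scale[OF linear_R1] linear_scale[OF linear_R2] linear_scale[OF linear_R3]
  linear_0[OF linear_R1] linear_0[OF linear_R2] linear_0[OF linear_R3]

text \<open>Differentiate the compatibility of metric and connection once more.\<close>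

lemma ddg_nab:
  assumes x: "x \<in> W"
  shows "ddg x u v a b = g x (nab x u v a) b + g x (\<Gamma> x v a) (\<Gamma> x u b)
    + g x (\<Gamma> x u a) (\<Gamma> x v b) + g x a (nab x u v b)"
proof -
  let ?D = "\<lambda>a b h. dg x h (\<Gamma> x v a) b + g x (nab x h v a - \<Gamma> x h (\<Gamma> x v a)) b"
  have d: "((\<lambda>y. g y (\<Gamma> y v a) b) has_derivative ?D a b) (at x)" for a b
    by (rule has_derivative_g_field[OF x has_derivative_christoffel[OF x]])
  have "ddg x u v a b = ?D a b u + ?D b a u"
  proof (rule ddg_cong[OF x])
    show "((\<lambda>y. g y (\<Gamma> y v a) b + g y (\<Gamma> y v b) a) has_derivative (\<lambda>h. ?D a b h + ?D b a h)) (at x)"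
      by (rule has_derivative_add[OF d d])
    show "dg y v a b = g y (\<Gamma> y v a) b + g y (\<Gamma> y v b) a" if "y \<in> W" for y
      using metric_compatible[OF that] sym_g[OF that] by simp
  qed
  then show ?thesis
    by (simp add: metric_compatible[OF x] g_simps x sym_g[OF x, of _ a]
        sym_g[OF x, of "\<Gamma> x u a" "\<Gamma> x v b"])
qed

lemma R_skew12: "R x u v w = - R x v u w"
  by (simp add: R_nab)

text \<open>Second derivatives of \<open>g(a, b)\<close> commute; the terms with two first covariant derivatives
  are symmetric and drop out.\<close>

lemma R_skew34:
  assumes x: "x \<in> W"
  shows "g x (R x u v a) b = - g x (R x u v b) a"
  using ddg_commute[OF x, of u v a b] sym_g[OF x, of a]
  unfolding ddg_nab[OF x] R_nab by (simp add: g_simps x)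

lemma R_bianchi: "x \<in> W \<Longrightarrow> R x u v w + R x v w u + R x w u v = 0"
  unfolding R_nab using nab_commute[of x u v w] nab_commute[of x v w u] nab_commute[of x w u v] by simp

text \<open>The octahedron argument: add the Bianchi identities of the four faces.\<close>

lemma R_pair_commute:
  assumes x: "x \<in> W"
  shows "g x (R x u v a) b = g x (R x a b u) v"
proof -
  have B: "g x (R x u v w) z + g x (R x v w u) z + g x (R x w u v) z = 0" for u v w z
    using arg_cong[OF R_bianchi[OF x, of u v w], of "\<lambda>k. g x k z"] by (simp add: g_simps x)
  have S: "g x (R x u v w) z = - g x (R x v u w) z" for u v w z
    using arg_cong[OF R_skew12[of x u v w], of "\<lambda>k. g x k z"] by (simp add: g_simps x)
  note T = R_skew34[OF x]
  show ?thesis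
    using B[of u v a b] B[of v a b u] B[of a b u v] B[of b u v a]
      S[of u v a b] S[of v a u b] S[of a u v b] S[of v a b u] S[of a b v u] S[of b v a u]
      S[of a b u v] S[of b u a v] S[of u a b v] S[of b u v a] S[of u v b a] S[of v b u a]
      T[of u v a b] T[of v a u b] T[of a u v b] T[of a b u v] T[of b v a u] T[of b u a v]
      T[of a b v u] T[of b u v a] T[of u v b a] T[of v b u a] T[of v a b u] T[of u a b v]
    by linarith
qed

lemma cauchy_schwarz_strict:
  assumes x: "x \<in> W" and uv: "u \<noteq> v" "independent {u, v}"
  shows "g x u u * g x v v - (g x u v)\<^sup>2 > 0"
proof -
  have v0: "v \<noteq> 0" using uv dependent_zero[of "{u, v}"] by auto
  have u: "u \<notin> span {v}" using uv by (simp add: independent_insert)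
  let ?w = "u - (g x u v / g x v v) *\<^sub>R v"
  have vv: "g x v v > 0" using pos_g[OF x v0] .
  have "?w \<noteq> 0" using u by (metis eq_iff_diff_eq_0 span_base span_scale singletonI)
  then have "g x ?w ?w > 0" using pos_g[OF x] by blast
  moreover have "g x ?w ?w = g x u u - (g x u v)\<^sup>2 / g x v v"
    using vv by (simp add: g_simps x sym_g[OF x, of v u] power2_eq_square field_simps)
  ultimately have "g x v v * (g x u u - (g x u v)\<^sup>2 / g x v v) > 0" using vv by simp
  then show ?thesis using vv by (simp add: field_simps)
qed

text \<open>For linearly dependent vectors, whose sectional curvature is a quotient by zero, the numerator
  vanishes.\<close>

lemma curvature_nonpos:
  assumes x: "x \<in> W"
    and K: "\<And>u v. u \<noteq> v \<Longrightarrow> independent {u, v} \<Longrightarrow> sectional_curvature g x u v \<le> 0"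
  shows "g x (R x u v v) u \<le> 0"
proof (cases "u \<noteq> v \<and> independent {u, v}")
  case True
  then show ?thesis using K[of u v] cauchy_schwarz_strict[OF x, of u v]
    unfolding sectional_curvature_def by (simp add: divide_le_0_iff)
next
  case False
  have Rvv: "R x w w z = 0" for w z using R_skew12[of x w w z] by (simp add: eq_neg_iff_add_eq_0 flip: scaleR_2)
  consider "u = v" | "v = 0" | k where "u = k *\<^sub>R v"
    using False by (metis independent_insert independent_empty insert_not_empty singletonD span_singleton
       empty_iff span_empty rangeE)
  then show ?thesis
    by cases (auto simp: Rvv g_simps x R_simps)
qed

subsection \<open>Second derivatives of the squared length of a section along a line\<close>

text \<open>The section \<open>s + t \<tau>\<close> over the line \<open>x + t u\<close>.\<close>

definition sq_length where "sq_length x u s \<tau> t = g (x + t *\<^sub>R u) (s + t *\<^sub>R \<tau>) (s + t *\<^sub>R \<tau>)"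

definition sq_length' where "sq_length' x u s \<tau> t =
  dg (x + t *\<^sub>R u) u s s + (2 * g (x + t *\<^sub>R u) s \<tau> + 2 * t * dg (x + t *\<^sub>R u) u s \<tau>)
  + (2 * t * g (x + t *\<^sub>R u) \<tau> \<tau> + t\<^sup>2 * dg (x + t *\<^sub>R u) u \<tau> \<tau>)"

lemma eventually_line_in_W:
  assumes "x + t *\<^sub>R u \<in> W" shows "eventually (\<lambda>t. x + t *\<^sub>R u \<in> W) (nhds t)"
proof -
  have "open ((\<lambda>t. x + t *\<^sub>R u) -` W)"
    by (intro open_vimage open_W continuous_intros)
  then show ?thesis using assms eventually_nhds_in_open by fastforce
qed

lemma DERIV_sq_length:
  assumes W: "x + t *\<^sub>R u \<in> W"
  shows "(sq_length x u s \<tau> has_real_derivative sq_length' x u s \<tau> t) (at t)"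
proof -
  let ?F = "\<lambda>t. g (x + t *\<^sub>R u) s s + 2 * t * g (x + t *\<^sub>R u) s \<tau> + t\<^sup>2 * g (x + t *\<^sub>R u) \<tau> \<tau>"
  have d: "((\<lambda>t. g (x + t *\<^sub>R u) a b) has_real_derivative dg (x + t *\<^sub>R u) u a b) (at t)" for a b
    by (rule DERIV_along_line[OF has_derivative_g[OF W]])
  have "(?F has_real_derivative sq_length' x u s \<tau> t) (at t)"
    unfolding sq_length'_def by (auto intro!: derivative_eq_intros d)
  moreover have ev: "eventually (\<lambda>t. sq_length x u s \<tau> t = ?F t) (nhds t)"
    using eventually_line_in_W[OF W]
    by eventually_elim (auto simp: sq_length_def g_simps sym_g algebra_simps power2_eq_square)
  ultimately show ?thesis using DERIV_cong_ev[OF refl ev refl, THEN iffD2] by blast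
qed

lemma DERIV_sq_length':
  assumes W: "x \<in> W"
  shows "(sq_length' x u s \<tau> has_real_derivative ddg x u u s s + 4 * dg x u s \<tau> + 2 * g x \<tau> \<tau>) (at 0)"
proof -
  have W': "x + 0 *\<^sub>R u \<in> W" using W by simp
  have d: "((\<lambda>t. g (x + t *\<^sub>R u) a b) has_real_derivative dg x u a b) (at 0)" for a b
    using DERIV_along_line[OF has_derivative_g[OF W']] by simp
  have dd: "((\<lambda>t. dg (x + t *\<^sub>R u) u a b) has_real_derivative ddg x u u a b) (at 0)" for a b
    using DERIV_along_line[OF has_derivative_dg[OF W']] by simp
  show ?thesis unfolding sq_length'_def
    by (auto intro!: derivative_eq_intros d dd)
qed

lemma sq_length'_0:
  assumes x: "x \<in> W" shows "sq_length' x u s \<tau> 0 = 2 * g x (\<Gamma> x u s + \<tau>) s"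
  unfolding sq_length'_def using metric_compatible[OF x, of u s s] sym_g[OF x]
  by (simp add: g_simps x)

lemma sq_length'':
  assumes x: "x \<in> W"
  shows "ddg x u u s s + 4 * dg x u s \<tau> + 2 * g x \<tau> \<tau> =
    2 * g x (nab x u u s) s + 2 * g x (\<Gamma> x u s + \<tau>) (\<Gamma> x u s + \<tau>) + 4 * g x s (\<Gamma> x u \<tau>)"
  unfolding ddg_nab[OF x] metric_compatible[OF x]
  by (simp add: g_simps x sym_g[OF x, of s "nab x u u s"] sym_g[OF x, of \<tau> "\<Gamma> x u s"])

end

section \<open>Kaehler metrics of nonpositive curvature\<close>

abbreviation J :: "complex^'n \<Rightarrow> complex^'n" where "J u \<equiv> \<i> *s u"

lemma J_simps [simp]:
  "J (J u) = - u" "J (u + v) = J u + J v" "J (u - v) = J u - J v" "J (- u) = - J u"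
  "J (r *\<^sub>R u) = r *\<^sub>R J u" "J 0 = 0"
  by (simp_all add: vec_eq_iff scaleR_conv_of_real algebra_simps)

lemma bounded_linear_J: "bounded_linear J"
  by (intro linear_conv_bounded_linear[THEN iffD1] linearI) auto

lemma norm_J [simp]: "norm (J u) = norm u"
  by (simp add: norm_vec_def norm_mult)

lemma vector_smult_complex: "c *s u = Re c *\<^sub>R u + Im c *\<^sub>R J u"
  by (simp add: vec_eq_iff complex_eq_iff)

locale kaehler_region = riemannian_region W g for W :: "(complex^'n) set" and g +
  assumes g_J: "x \<in> W \<Longrightarrow> g x (J u) (J v) = g x u v"
    and closed: "closed_2form_on W (fundamental_form g)"
begin

lemma g_J1: "x \<in> W \<Longrightarrow> g x (J u) v = - g x u (J v)"
  using g_J[of x u "J v"] by (simp add: g_simps)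

lemma g_J_self: "x \<in> W \<Longrightarrow> g x (J u) u = 0" "x \<in> W \<Longrightarrow> g x u (J u) = 0"
  using g_J1[of x u u] sym_g[of x u "J u"] by simp_all

lemma dg_J: "x \<in> W \<Longrightarrow> dg x w (J u) (J v) = dg x w u v"
  by (rule dg_cong[OF _ g_J has_derivative_g])

lemma dg_J1: assumes "x \<in> W" shows "dg x w (J u) v = - dg x w u (J v)"
  using dg_J[OF assms, of w u "J v"] linear_neg[OF linear_dg3[OF assms]] by simp

lemma closed_dg: "x \<in> W \<Longrightarrow> dg x u (J v) w - dg x v (J u) w + dg x w (J u) v = 0"
  using closed unfolding closed_2form_on_def fundamental_form_def dg_def by blast

text \<open>Closedness of the fundamental form, applied to \<open>(v, w, u)\<close> and to \<open>(J v, J w, u)\<close>, says that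
  \<open>J\<close> is parallel.\<close>

lemma christoffel_J2:
  assumes x: "x \<in> W"
  shows "\<Gamma> x u (J v) = J (\<Gamma> x u v)"
proof (rule christoffel_eqI[OF x])
  fix w
  note s = dg_sym[OF x] dg_J1[OF x]
  have a: "dg x v (J w) u - dg x w (J v) u + dg x u (J v) w = 0" by (rule closed_dg[OF x])
  have "dg x (J v) (J (J w)) u - dg x (J w) (J (J v)) u + dg x u (J (J v)) (J w) = 0" by (rule closed_dg[OF x])
  then have b: "- dg x (J v) w u + dg x (J w) v u - dg x u v (J w) = 0"
    using linear_neg[OF linear_dg2[OF x]] by simp
  have "2 * g x (J (\<Gamma> x u v)) w = - (dg x u v (J w) + dg x v u (J w) - dg x (J w) u v)"
    using christoffel[OF x, of u v "J w"] g_J1[OF x] by simp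
  then show "2 * g x (J (\<Gamma> x u v)) w = dg x u (J v) w + dg x (J v) u w - dg x w u (J v)"
    using a b dg_sym[OF x, of v u "J w"] dg_sym[OF x, of "J w" u v] dg_sym[OF x, of "J v" u w]
      dg_sym[OF x, of w u "J v"] dg_J1[OF x, of u v w] by linarith
qed

lemma christoffel_J1: assumes x: "x \<in> W" shows "\<Gamma> x (J u) v = J (\<Gamma> x u v)"
  using christoffel_J2[OF x, of v u] christoffel_commute[OF x] by metis

lemma nab_J3: assumes x: "x \<in> W" shows "nab x u v (J w) = J (nab x u v w)"
  by (subst nab_cong[OF x christoffel_J2 bounded_linear.has_derivative[OF bounded_linear_J
          has_derivative_christoffel[OF x]]]) (auto simp: christoffel_J2[OF x])

lemma nab_J2: assumes x: "x \<in> W" shows "nab x u (J v) w = J (nab x u v w)"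
  using nab_J3[OF x, of u w v] nab_commute[OF x] by metis

lemma R_J3: assumes x: "x \<in> W" shows "R x u v (J w) = J (R x u v w)"
  unfolding R_nab by (simp add: nab_J3 x)

lemma R_J12: assumes x: "x \<in> W" shows "R x (J u) (J v) w = R x u v w"
proof (rule g_nondegenerate[OF x])
  show "g x (R x (J u) (J v) w) z = g x (R x u v w) z" for z
    unfolding R_pair_commute[OF x, of _ _ w z] by (simp add: R_J3 g_J x)
qed

lemma R_J_swap: assumes x: "x \<in> W" shows "R x v (J u) w = R x u (J v) w"
  using R_J12[OF x, of u "J v" w] R_skew12[of x v "J u" w] linear_neg[OF linear_R2[OF x]] by simp

text \<open>\<open>bisec x u v\<close> is the holomorphic bisectional curvature, up to normalisation.\<close>

definition bisec where "bisec x u v = g x (R x u (J u) (J v)) v"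

lemma bisec_commute: assumes x: "x \<in> W" shows "bisec x u v = bisec x v u"
  unfolding bisec_def R_pair_commute[OF x, of u] using R_skew34[OF x, of "J v" v u "J u"]
     arg_cong[OF R_skew12[of x "J v" v u], of "\<lambda>k. g x k (J u)"] R_skew34[OF x, of v "J v" u "J u"]
  by (simp add: g_simps x)

lemma bisec_scale: assumes x: "x \<in> W" shows "bisec x u (r *\<^sub>R v) = r\<^sup>2 * bisec x u v"
  unfolding bisec_def by (simp add: R_simps g_simps x power2_eq_square)

text \<open>The sectional curvature of the plane spanned by \<open>u + q v\<close> and \<open>J (u - q v)\<close> only involves
  bisectional curvatures. Its mixed term has the opposite sign of the two others, so that
  nonpositive curvature bounds the mixed term by the holomorphic sectional curvatures.\<close>

lemma curvature_skew_plane: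
  fixes u v :: "complex^'n"
  assumes x: "x \<in> W"
  defines "a \<equiv> \<lambda>q u v. u + q *\<^sub>R v" and "b \<equiv> \<lambda>q u v. J u - q *\<^sub>R J v"
  shows "g x (R x (a q u v) (b q u v) (b q u v)) (a q u v) =
    bisec x u u - 2 * q\<^sup>2 * bisec x u v + (q\<^sup>2)\<^sup>2 * bisec x v v"
proof -
  have R: "R x (a q u v) (b q u v) w = R x u (J u) w - q\<^sup>2 *\<^sub>R R x v (J v) w" for w
    unfolding a_def b_def using R_J_swap[OF x, of u v w]
    by (simp add: R_simps x algebra_simps power2_eq_square)
  have c: "g x (R x y (J y) (J u)) v = g x (R x y (J y) (J v)) u" for y
    using R_skew34[OF x, of y "J y" "J v" u] g_J1[OF x, of "R x y (J y) u" v]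
    by (simp add: R_J3 x)
  show ?thesis
    unfolding R unfolding a_def b_def
    using c[of u] c[of v] bisec_commute[OF x, of v u] unfolding bisec_def
    by (simp add: R_simps g_simps x algebra_simps power2_eq_square)
qed

text \<open>The sum of the second derivatives in the directions \<open>u\<close> and \<open>J u\<close> is the Laplacian on the complex
  line. As the connection commutes with \<open>J\<close>, the two second covariant derivatives of \<open>s\<close> combine to
  the curvature of the pair \<open>u\<close>, \<open>J u\<close>.\<close>

lemma sq_length''_J:
  fixes u s \<tau> :: "complex^'n"
  assumes x: "x \<in> W"
  defines "n \<equiv> \<Gamma> x u s + \<tau>"
  shows "(ddg x u u s s + 4 * dg x u s \<tau> + 2 * g x \<tau> \<tau>)
     + (ddg x (J u) (J u) s s + 4 * dg x (J u) s (J \<tau>) + 2 * g x (J \<tau>) (J \<tau>)) =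
    4 * g x n n - 2 * bisec x u s"
proof -
  have nJ: "\<Gamma> x (J u) s + J \<tau> = J n" unfolding n_def by (simp add: christoffel_J1 x)
  have "nab x (J u) (J u) s = J (nab x (J u) u s)" "nab x u u s = - J (nab x u (J u) s)"
    by (simp_all add: nab_J2 x)
  then have "nab x u u s + nab x (J u) (J u) s = - J (R x u (J u) s)"
    unfolding R_nab by simp
  then have "g x (nab x u u s) s + g x (nab x (J u) (J u) s) s = - bisec x u s"
    unfolding bisec_def by (simp add: R_J3 x g_simps flip: bilinear_ladd[OF bilinear_g[OF x]])
  then show ?thesis unfolding sq_length''[OF x] nJ
    by (simp add: christoffel_J1 christoffel_J2 x g_simps g_J flip: n_def)
qed

text \<open>Bessel's inequality for the orthogonal vectors \<open>u\<close> and \<open>J u\<close> of equal length.\<close>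

lemma cauchy_schwarz_complex:
  assumes x: "x \<in> W"
  shows "(g x v u)\<^sup>2 + (g x (J v) u)\<^sup>2 \<le> g x v v * g x u u"
proof (cases "u = 0")
  case False
  then have uu: "g x u u > 0" by (rule pos_g[OF x])
  let ?p = "g x v u" and ?q = "g x (J v) u"
  let ?w = "g x u u *\<^sub>R v - ?p *\<^sub>R u + ?q *\<^sub>R J u"
  have "0 \<le> g x ?w ?w" using pos_g[OF x, of ?w] by (cases "?w = 0") (auto simp: g_simps x)
  also have "g x ?w ?w = g x u u * (g x v v * g x u u - ?p\<^sup>2 - ?q\<^sup>2)"
    using g_J1[OF x, of v u] g_J1[OF x, of u v] g_J_self[OF x, of u] sym_g[OF x, of u v]
      sym_g[OF x, of u "J v"]
    by (simp add: g_simps x g_J algebra_simps power2_eq_square)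
  finally show ?thesis using uu by (simp add: zero_le_mult_iff)
qed (auto simp: g_simps x)

end

locale nonpositive_kaehler_region = kaehler_region W g for W :: "(complex^'n) set" and g +
  assumes nonpositive: "x \<in> W \<Longrightarrow> u \<noteq> v \<Longrightarrow> independent {u, v} \<Longrightarrow> sectional_curvature g x u v \<le> 0"
begin

lemma mixed_curvature_bound:
  assumes x: "x \<in> W" and Q: "Q \<ge> 0"
  shows "- 2 * Q * bisec x u v \<le> - bisec x u u - Q\<^sup>2 * bisec x v v"
  using curvature_skew_plane[OF x, where q = "sqrt Q" and u = u and v = v] Q
    curvature_nonpos[OF x nonpositive[OF x], of "u + sqrt Q *\<^sub>R v" "J u - sqrt Q *\<^sub>R J v"]
  by simp

lemma bisec_self_nonpos: "x \<in> W \<Longrightarrow> bisec x u u \<le> 0"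
  using mixed_curvature_bound[of x 0 u u] by simp

end

section \<open>A second variation argument on the boundary divisor\<close>

lemma second_derivative_nonneg_at_min:
  fixes f :: "real \<Rightarrow> real"
  assumes f: "eventually (\<lambda>t. (f has_real_derivative f' t) (at t)) (nhds 0)"
    and f': "(f' has_real_derivative D) (at 0)"
    and min: "eventually (\<lambda>t. f t \<ge> f 0) (nhds 0)"
  shows "D \<ge> 0"
proof (rule ccontr)
  assume "\<not> D \<ge> 0"
  then have D: "D < 0" by simp
  obtain d where d: "d > 0" "\<And>t. \<bar>t\<bar> < d \<Longrightarrow> (f has_real_derivative f' t) (at t)" "\<And>t. \<bar>t\<bar> < d \<Longrightarrow> f t \<ge> f 0"
    using eventually_conj[OF f min] unfolding eventually_nhds_metric by (auto simp: dist_real_def)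
  have f'0: "f' 0 = 0" by (rule DERIV_local_min[OF d(2) d(1)]) (use d in auto)
  obtain e where e: "e > 0" "\<And>h. 0 < h \<Longrightarrow> h < e \<Longrightarrow> f' h < 0"
    using DERIV_neg_dec_right[OF f' D] f'0 by auto
  define h where "h = min d e / 2"
  have h: "0 < h" "h < d" "h < e" using d(1) e(1) unfolding h_def by (auto simp: min_def)
  have "\<exists>z>0. z < h \<and> f h - f 0 = (h - 0) * f' z" by (rule MVT2) (use h d in auto)
  then obtain z where z: "0 < z" "z < h" "f h - f 0 = h * f' z" by auto
  then have "h * f' z < 0" using e(2)[of z] h by (simp add: mult_pos_neg)
  then show False using z(3) d(3)[of h] h by simp
qed

context riemannian_region
begin

lemma log_length_second_variation:
  assumes x: "x \<in> W" and s: "s \<noteq> 0" and w: "w \<noteq> 0"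
    and min: "eventually (\<lambda>t. ln (g x s s) - \<kappa> * (norm x)\<^sup>2 - \<mu> * ln (g x w w) \<le>
       ln (sq_length x u s \<tau> t) - \<kappa> * (norm (x + t *\<^sub>R u))\<^sup>2 - \<mu> * ln (g (x + t *\<^sub>R u) w w)) (nhds 0)"
  shows "2 * \<kappa> * (norm u)\<^sup>2 \<le>
      ((ddg x u u s s + 4 * dg x u s \<tau> + 2 * g x \<tau> \<tau>) * g x s s - (2 * g x (\<Gamma> x u s + \<tau>) s)\<^sup>2) / (g x s s)\<^sup>2
      - \<mu> * ((ddg x u u w w * g x w w - (2 * g x (\<Gamma> x u w) w)\<^sup>2) / (g x w w)\<^sup>2)"
proof -
  let ?F = "sq_length x u s \<tau>" and ?H = "sq_length x u w 0"
  let ?F' = "sq_length' x u s \<tau>" and ?H' = "sq_length' x u w 0"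
  let ?F'' = "ddg x u u s s + 4 * dg x u s \<tau> + 2 * g x \<tau> \<tau>"
  define f where "f t = ln (?F t) - \<kappa> * (x \<bullet> x + 2 * t * (x \<bullet> u) + t\<^sup>2 * (u \<bullet> u)) - \<mu> * ln (?H t)" for t
  define f' where "f' t = ?F' t / ?F t - \<kappa> * (2 * (x \<bullet> u) + 2 * t * (u \<bullet> u)) - \<mu> * (?H' t / ?H t)" for t
  have FH0: "?F 0 = g x s s" "?H 0 = g x w w" unfolding sq_length_def by auto
  have pos0: "g x s s > 0" "g x w w > 0" using pos_g x s w by auto
  have d0: "(?F has_real_derivative ?F' 0) (at 0)" "(?H has_real_derivative ?H' 0) (at 0)"
    using DERIV_sq_length[of x 0 u] x by auto
  have "(?F \<longlongrightarrow> ?F 0) (nhds 0)" "(?H \<longlongrightarrow> ?H 0) (nhds 0)"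
    using d0[THEN DERIV_isCont] unfolding isCont_def tendsto_at_iff_tendsto_nhds by auto
  then have "\<forall>\<^sub>F t in nhds 0. ?F t > 0" "\<forall>\<^sub>F t in nhds 0. ?H t > 0"
    using order_tendstoD(1) pos0 unfolding FH0 by blast+
  moreover have "\<forall>\<^sub>F t in nhds 0. x + t *\<^sub>R u \<in> W"
    using eventually_line_in_W[of x 0 u] x by simp
  ultimately have "\<forall>\<^sub>F t in nhds 0. (f has_real_derivative f' t) (at t)"
  proof eventually_elim
    case (elim t)
    show ?case unfolding f_def f'_def
      using elim by (auto intro!: derivative_eq_intros DERIV_sq_length)
  qed
  moreover have "(f' has_real_derivative (?F'' * g x s s - (?F' 0)\<^sup>2) / (g x s s)\<^sup>2 - 2 * \<kappa> * (u \<bullet> u)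
      - \<mu> * ((ddg x u u w w * g x w w - (?H' 0)\<^sup>2) / (g x w w)\<^sup>2)) (at 0)"
  proof -
    have h: "(?H' has_real_derivative ddg x u u w w) (at 0)"
      using DERIV_sq_length'[OF x, of u w 0] by (simp add: linear_0[OF linear_dg3[OF x]] g_simps x)
    show ?thesis unfolding f'_def
      using pos0 by (auto intro!: derivative_eq_intros d0 DERIV_sq_length'[OF x] h
          simp: FH0 power2_eq_square algebra_simps)
  qed
  moreover have "\<forall>\<^sub>F t in nhds 0. f 0 \<le> f t"
    using min
  proof eventually_elim
    case (elim t)
    have "(norm (x + t *\<^sub>R u))\<^sup>2 = x \<bullet> x + 2 * t * (x \<bullet> u) + t\<^sup>2 * (u \<bullet> u)"
      unfolding power2_norm_eq_inner by (simp add: algebra_simps inner_commute power2_eq_square)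
    moreover have "?H t = g (x + t *\<^sub>R u) w w" unfolding sq_length_def by simp
    ultimately show ?case using elim unfolding f_def FH0 by (simp add: power2_norm_eq_inner)
  qed
  ultimately have "0 \<le> (?F'' * g x s s - (?F' 0)\<^sup>2) / (g x s s)\<^sup>2 - 2 * \<kappa> * (u \<bullet> u)
      - \<mu> * ((ddg x u u w w * g x w w - (?H' 0)\<^sup>2) / (g x w w)\<^sup>2)"
    by (rule second_derivative_nonneg_at_min)
  then show ?thesis by (simp add: sq_length'_0[OF x] power2_norm_eq_inner)
qed

end

context nonpositive_kaehler_region
begin

lemma g_smult: assumes "x \<in> W" shows "g x (c *s y) (c *s y) = (cmod c)\<^sup>2 * g x y y"
  unfolding vector_smult_complex[of c y] cmod_power2
  using g_J_self[OF assms, of y]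
  by (simp add: g_simps assms g_J algebra_simps power2_eq_square)

text \<open>If \<open>\<tau>\<close> is chosen such that the section \<open>s + z \<tau>\<close> over the complex line \<open>x + z u\<close> has
  covariant derivative proportional to \<open>s\<close> at \<open>z = 0\<close>, then the Laplacian of the logarithm
  of its length there is a negative multiple of the bisectional curvature of \<open>u\<close> and \<open>s\<close>.
  For the constant section \<open>u\<close> it is at least the corresponding multiple.\<close>

lemma bisec_bound_at_min:
  fixes \<kappa> \<mu> :: real
  assumes x: "x \<in> W" and s: "s \<noteq> 0" and u: "u \<noteq> 0" and l: "\<mu> \<ge> 0"
    and \<tau>: "\<Gamma> x u s + \<tau> = c *s s"
  defines "\<theta> \<equiv> \<lambda>x s. ln (g x s s) - \<kappa> * (norm x)\<^sup>2 - \<mu> * ln (g x u u)"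
  assumes min: "\<And>t. \<theta> x s \<le> \<theta> (x + t *\<^sub>R u) (s + t *\<^sub>R \<tau>)"
      "\<And>t. \<theta> x s \<le> \<theta> (x + t *\<^sub>R J u) (s + t *\<^sub>R J \<tau>)"
  shows "2 * \<kappa> * (norm u)\<^sup>2 + \<mu> * (- bisec x u u / g x u u) \<le> - bisec x u s / g x s s"
proof -
  let ?S = "g x s s" and ?U = "g x u u"
  have pos: "?S > 0" "?U > 0" using pos_g x s u by auto
  define F1 F2 H1 H2 where "F1 = ddg x u u s s + 4 * dg x u s \<tau> + 2 * g x \<tau> \<tau>"
    and "F2 = ddg x (J u) (J u) s s + 4 * dg x (J u) s (J \<tau>) + 2 * g x (J \<tau>) (J \<tau>)"
    and "H1 = ddg x u u u u" and "H2 = ddg x (J u) (J u) u u"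
  define v where "v = \<Gamma> x u u"
  have c: "Re c = g x (c *s s) s / ?S" "- Im c = g x (J (c *s s)) s / ?S"
    using pos g_J_self[OF x, of s]
    by (simp_all add: vector_smult_complex[of c s] g_simps x)
  have "2 * \<kappa> * (norm u)\<^sup>2 \<le> (F1 * ?S - (2 * g x (\<Gamma> x u s + \<tau>) s)\<^sup>2) / ?S\<^sup>2
       - \<mu> * ((H1 * ?U - (2 * g x (\<Gamma> x u u) u)\<^sup>2) / ?U\<^sup>2)"
    unfolding F1_def H1_def
    by (rule log_length_second_variation[OF x s u])
      (use min(1) in \<open>simp add: \<theta>_def sq_length_def\<close>)
  then have 1: "2 * \<kappa> * (norm u)\<^sup>2 \<le> (F1 * ?S - (2 * (Re c * ?S))\<^sup>2) / ?S\<^sup>2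
       - \<mu> * ((H1 * ?U - (2 * g x v u)\<^sup>2) / ?U\<^sup>2)"
    using pos by (simp add: \<tau> c v_def)
  have "2 * \<kappa> * (norm (J u))\<^sup>2 \<le> (F2 * ?S - (2 * g x (\<Gamma> x (J u) s + J \<tau>) s)\<^sup>2) / ?S\<^sup>2
       - \<mu> * ((H2 * ?U - (2 * g x (\<Gamma> x (J u) u) u)\<^sup>2) / ?U\<^sup>2)"
    unfolding F2_def H2_def
    by (rule log_length_second_variation[OF x s u])
      (use min(2) in \<open>simp add: \<theta>_def sq_length_def\<close>)
  moreover have "\<Gamma> x (J u) s + J \<tau> = J (c *s s)" using \<tau> by (simp add: christoffel_J1 x flip: J_simps)
  moreover have "\<Gamma> x (J u) u = J v" by (simp add: christoffel_J1 x v_def)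
  ultimately have 2: "2 * \<kappa> * (norm u)\<^sup>2 \<le> (F2 * ?S - (2 * (- Im c * ?S))\<^sup>2) / ?S\<^sup>2
       - \<mu> * ((H2 * ?U - (2 * g x (J v) u)\<^sup>2) / ?U\<^sup>2)"
    using pos unfolding c by simp
  have "F1 + F2 = 4 * ((cmod c)\<^sup>2 * ?S) - 2 * bisec x u s"
    using sq_length''_J[OF x, of u s \<tau>] unfolding F1_def F2_def \<tau> g_smult[OF x] .
  then have F2: "F2 = 4 * (((Re c)\<^sup>2 + (Im c)\<^sup>2) * ?S) - 2 * bisec x u s - F1"
    unfolding cmod_power2 by simp
  then have FF: "(F1 * ?S - (2 * (Re c * ?S))\<^sup>2) / ?S\<^sup>2 + (F2 * ?S - (2 * (- Im c * ?S))\<^sup>2) / ?S\<^sup>2 =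
      - 2 * bisec x u s / ?S"
    using pos unfolding add_divide_distrib[symmetric]
    by (simp add: F2 field_simps power2_eq_square)
  have HH: "H1 + H2 = 4 * g x v v - 2 * bisec x u u"
    using sq_length''_J[OF x, of u u 0] unfolding H1_def H2_def v_def
    by (simp add: linear_0[OF linear_dg3[OF x]] g_simps x)
  have "- 2 * bisec x u u / ?U \<le> ((H1 + H2) * ?U - 4 * ((g x v u)\<^sup>2 + (g x (J v) u)\<^sup>2)) / ?U\<^sup>2"
  proof -
    have "- 2 * bisec x u u / ?U = (- 2 * bisec x u u * ?U) / ?U\<^sup>2"
      using pos by (simp add: power2_eq_square)
    also have "\<dots> \<le> ((H1 + H2) * ?U - 4 * ((g x v u)\<^sup>2 + (g x (J v) u)\<^sup>2)) / ?U\<^sup>2"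
      using cauchy_schwarz_complex[OF x, of v u] unfolding HH
      by (intro divide_right_mono) (auto simp: algebra_simps)
    finally show ?thesis .
  qed
  also have "\<dots> = (H1 * ?U - (2 * g x v u)\<^sup>2) / ?U\<^sup>2 + (H2 * ?U - (2 * g x (J v) u)\<^sup>2) / ?U\<^sup>2"
    unfolding add_divide_distrib[symmetric] by (simp add: algebra_simps)
  finally have "\<mu> * (- 2 * bisec x u u / ?U) \<le>
     \<mu> * ((H1 * ?U - (2 * g x v u)\<^sup>2) / ?U\<^sup>2) + \<mu> * ((H2 * ?U - (2 * g x (J v) u)\<^sup>2) / ?U\<^sup>2)"
    using l by (metis distrib_left mult_left_mono)
  then show ?thesis using 1 2 FF by (simp add: algebra_simps)
qed

text \<open>This bounds the holomorphic sectional curvature from below by second derivatives of the metric,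
  uniformly on compact sets.\<close>

lemma bisec_self_bound:
  assumes x: "x \<in> W"
  shows "- 2 * bisec x n n \<le> ddg x n n n n + ddg x (J n) (J n) n n"
proof -
  have "g x (\<Gamma> x n n) (\<Gamma> x n n) \<ge> 0"
    using pos_g[OF x, of "\<Gamma> x n n"] by (cases "\<Gamma> x n n = 0") (auto simp: g_simps x)
  then show ?thesis using sq_length''_J[OF x, of n n 0]
    by (simp add: linear_0[OF linear_dg3[OF x]] g_simps x)
qed

end

context riemannian_region
begin

lemma continuous_on_g: "continuous_on (W \<times> UNIV) (\<lambda>(x, a). g x a a)"
proof -
  have c: "continuous_on (W \<times> UNIV) (\<lambda>p. g (fst p) i j)" for i j
    using continuous_on_compose2[OF _ continuous_on_fst[OF continuous_on_id], of W "\<lambda>x. g x i j" "W \<times> UNIV"]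
      Ck_g[of 0 i j] by auto
  have "continuous_on (W \<times> UNIV)
      (\<lambda>p. \<Sum>i\<in>Basis. (snd p \<bullet> i) * (\<Sum>j\<in>Basis. (snd p \<bullet> j) * g (fst p) i j))"
    by (intro continuous_intros c)
  moreover have "(case p of (x, a) \<Rightarrow> g x a a) =
      (\<Sum>i\<in>Basis. (snd p \<bullet> i) * (\<Sum>j\<in>Basis. (snd p \<bullet> j) * g (fst p) i j))" if "p \<in> W \<times> UNIV" for p
    using that by (auto simp flip: linear_expand[OF linear_g1] linear_expand[OF linear_g2])
  ultimately show ?thesis using continuous_on_cong by (metis (no_types, lifting))
qed

lemma continuous_on_ddg2: "continuous_on (W \<times> UNIV) (\<lambda>(x, a, b). ddg x a a b b)"
proof -
  have c: "continuous_on (W \<times> UNIV) (\<lambda>p :: 'e \<times> 'e \<times> 'e. ddg (fst p) i j k l)" for i j k l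
    using continuous_on_compose2[OF continuous_on_ddg continuous_on_fst[OF continuous_on_id], of "W \<times> UNIV" i j k l]
    by auto
  let ?E = "\<lambda>p. \<Sum>i\<in>Basis. (fst (snd p) \<bullet> i) * (\<Sum>j\<in>Basis. (fst (snd p) \<bullet> j) *
        (\<Sum>k\<in>Basis. (snd (snd p) \<bullet> k) * (\<Sum>l\<in>Basis. (snd (snd p) \<bullet> l) * ddg (fst p) i j k l)))"
  have "continuous_on (W \<times> UNIV) ?E"
    by (intro continuous_intros c)
  moreover have "(case p of (x, a, b) \<Rightarrow> ddg x a a b b) = ?E p" if "p \<in> W \<times> UNIV" for p
    using that by (auto simp flip: linear_expand[OF linear_ddg1] linear_expand[OF linear_ddg2]
        linear_expand[OF linear_ddg3] linear_expand[OF linear_ddg4])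
  ultimately show ?thesis using continuous_on_cong by (metis (no_types, lifting))
qed

lemma g_lower_bound:
  assumes K: "compact K" "K \<subseteq> W"
  shows "\<exists>m>0. \<forall>x\<in>K. \<forall>a. m * (norm a)\<^sup>2 \<le> g x a a"
proof (cases "K = {}")
  case False
  let ?C = "K \<times> sphere 0 1 :: ('e \<times> 'e) set"
  have C: "compact ?C" using K by (intro compact_Times) auto
  have "?C \<noteq> {}" using False by auto
  have "continuous_on ?C (\<lambda>(x, a). g x a a)"
    by (rule continuous_on_subset[OF continuous_on_g]) (use K in auto)
  from continuous_attains_inf[OF C \<open>?C \<noteq> {}\<close> this] obtain x0 a0 where
    0: "x0 \<in> K" "norm a0 = 1" "\<And>x a. x \<in> K \<Longrightarrow> norm a = 1 \<Longrightarrow> g x0 a0 a0 \<le> g x a a" by fastforce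
  have "g x0 a0 a0 * (norm a)\<^sup>2 \<le> g x a a" if "x \<in> K" for x a
  proof (cases "a = 0")
    case False
    have xW: "x \<in> W" using that K by auto
    have "g x0 a0 a0 \<le> g x (a /\<^sub>R norm a) (a /\<^sub>R norm a)" using 0(3)[OF that, of "a /\<^sub>R norm a"] False by simp
    also have "\<dots> = g x a a / (norm a)\<^sup>2" by (simp add: g_simps xW power2_eq_square field_simps)
    finally show ?thesis using False by (simp add: pos_le_divide_eq)
  qed (use that K in \<open>auto simp: g_simps\<close>)
  moreover have "g x0 a0 a0 > 0" using pos_g[of x0 a0] 0(1,2) K(2) by fastforce
  ultimately show ?thesis by blast
qed (auto intro: exI[of _ 1])

lemma ddg_upper_bound:
  assumes K: "compact K" "K \<subseteq> W"
  shows "\<exists>M. \<forall>x\<in>K. \<forall>a b. norm a = 1 \<longrightarrow> norm b = 1 \<longrightarrow> ddg x a a b b \<le> M"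
proof -
  let ?C = "K \<times> sphere 0 1 \<times> sphere 0 1 :: ('e \<times> 'e \<times> 'e) set"
  have "compact ?C" using K by (intro compact_Times) auto
  moreover have "continuous_on ?C (\<lambda>(x, a, b). ddg x a a b b)"
    by (rule continuous_on_subset[OF continuous_on_ddg2]) (use K in auto)
  ultimately have "bounded ((\<lambda>(x, a, b). ddg x a a b b) ` ?C)"
    using compact_continuous_image compact_imp_bounded by blast
  then obtain M where M: "\<And>p. p \<in> ?C \<Longrightarrow> norm ((\<lambda>(x, a, b). ddg x a a b b) p) \<le> M"
    unfolding bounded_iff by blast
  have "ddg x a a b b \<le> M" if "x \<in> K" "norm a = 1" "norm b = 1" for x a b
    using M[of "(x, a, b)"] that by auto
  then show ?thesis by blast
qed

end

definition scale_coord :: "'n \<Rightarrow> complex \<Rightarrow> complex^'n \<Rightarrow> complex^'n" where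
  "scale_coord k e y = (\<chi> j. if j = k then e * y $ j else y $ j)"

context nonpositive_kaehler_region
begin

text \<open>The hyperplane \<open>x\<^sub>k = 0\<close> covers a torus; the deck transformations act on it by translations, and
  on its normal bundle by factors \<open>e\<close> with the growth of a theta function. They preserve the function
  \<open>\<theta>(x, s) = ln |s|\<^sup>2 - \<kappa> |x|\<^sup>2 - \<mu> ln |u|\<^sup>2\<close> of a point \<open>x\<close> of the hyperplane and a tangent vector
  \<open>s\<close> transverse to it, which is scaled to have \<open>k\<close>-th coordinate 1. So it has a minimum. Taking the
  minimum over the transverse vectors replaces the metric of the quotient bundle. At the minimum,
  the Laplacian in the direction \<open>u\<close> bounds a mixed curvature away from zero, against the bound of
  mixed curvatures by holomorphic sectional ones.\<close>

theorem no_theta_periodic_metric: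
  fixes V :: "(complex^'n) set" and i k :: 'n and \<kappa> r :: real
  assumes ik: "i \<noteq> k" and T: "{x. x $ k = 0} \<subseteq> W" and \<kappa>: "\<kappa> > 0"
    and V: "\<And>v. v \<in> V \<Longrightarrow> v $ k = 0"
    and deck: "\<And>v x. v \<in> V \<Longrightarrow> x $ k = 0 \<Longrightarrow>
        \<exists>e. (cmod e)\<^sup>2 = exp (- \<kappa> * ((norm v)\<^sup>2 + 2 * (x \<bullet> v))) \<and>
            (\<forall>y. g x y y = g (x + v) (scale_coord k e y) (scale_coord k e y))"
    and cocompact: "\<And>x. x $ k = 0 \<Longrightarrow> \<exists>v\<in>V. norm (x + v) \<le> r"
  shows False
proof -
  define T where "T = {x :: complex^'n. x $ k = 0}"
  define S where "S = {s :: complex^'n. s $ k = 1}"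
  define u :: "complex^'n" where "u = axis i 1"
  have uT: "u $ k = 0" "u \<noteq> 0" "norm u = 1"
    using ik unfolding u_def by (auto simp: axis_eq_0_iff norm_axis) (simp add: axis_def)
  define K where "K = T \<inter> cball 0 r"
  have "closed T" unfolding T_def by (intro closed_Collect_eq continuous_intros)
  then have cK: "compact K" unfolding K_def by (simp add: closed_Int_compact)
  have KW: "K \<subseteq> W" using T unfolding K_def T_def by auto
  have "\<exists>v\<in>V. norm (0 + v) \<le> r" by (rule cocompact) simp
  then have r: "r \<ge> 0" by (meson norm_ge_zero order_trans)
  then have K0: "0 \<in> K" unfolding K_def T_def by auto
  obtain m where m: "m > 0" "\<And>x a. x \<in> K \<Longrightarrow> m * (norm a)\<^sup>2 \<le> g x a a"
    using g_lower_bound[OF cK KW] by blast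
  obtain M0 where M0: "\<And>x a b. x \<in> K \<Longrightarrow> norm a = 1 \<Longrightarrow> norm b = 1 \<Longrightarrow> ddg x a a b b \<le> M0"
    using ddg_upper_bound[OF cK KW] by blast
  define M where "M = max 1 M0"
  have M: "M > 0" "- bisec x n n \<le> M" if "x \<in> K" "norm n = 1" for x n
    using bisec_self_bound[of x n] M0[of x n n] M0[of x "J n" n] that KW unfolding M_def by auto
  have "continuous_on K (\<lambda>x. g x u u)"
    using continuous_on_subset[OF _ KW] Ck_g[of 0 u u] by auto
  then have "bounded ((\<lambda>x. g x u u) ` K)" using cK compact_continuous_image compact_imp_bounded by blast
  then obtain U0 where U0: "\<And>x. x \<in> K \<Longrightarrow> norm (g x u u) \<le> U0" unfolding bounded_iff by blast
  define U where "U = max 1 U0"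
  have U: "U > 0" "\<And>x. x \<in> K \<Longrightarrow> g x u u \<le> U" unfolding U_def using U0 by fastforce+
  \<comment> \<open>The constants that make the mixed curvature inequality fail at a minimum of \<open>\<theta>\<close>: the
    term \<open>Q\<^sup>2 M\<close> has to be small compared with \<open>\<kappa> Q\<close>, and then \<open>\<mu>\<close> large compared with \<open>1 / Q\<close>.\<close>
  have "M > 0" unfolding M_def by simp
  define Q where "Q = 2 * m * \<kappa> / M"
  have Q: "Q > 0" unfolding Q_def using m \<kappa> \<open>M > 0\<close> by simp
  define \<mu> where "\<mu> = U / (2 * Q * m)"
  have \<mu>: "\<mu> > 0" unfolding \<mu>_def using U Q m by simp
  define \<theta> where "\<theta> x s = ln (g x s s) - \<kappa> * (norm x)\<^sup>2 - \<mu> * ln (g x u u)" for x s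
  have \<theta>_low: "\<theta> x s \<ge> ln m + 2 * ln (norm s) - \<kappa> * r\<^sup>2 - \<mu> * ln U" if "x \<in> K" "s \<in> S" for x s
  proof -
    have s: "s \<noteq> 0" using that unfolding S_def by auto
    have xW: "x \<in> W" using that KW by auto
    have "ln (m * (norm s)\<^sup>2) \<le> ln (g x s s)"
      by (rule ln_mono[OF m(2)[OF that(1)]]) (use m s in auto)
    moreover have "ln (m * (norm s)\<^sup>2) = ln m + 2 * ln (norm s)"
      using m s by (simp add: ln_mult ln_realpow)
    moreover have "ln (g x u u) \<le> ln U"
      by (rule ln_mono[OF U(2)[OF that(1)] pos_g[OF xW uT(2)]])
    moreover have "(norm x)\<^sup>2 \<le> r\<^sup>2" using that unfolding K_def by (auto intro: power_mono)
    ultimately have "\<mu> * ln (g x u u) \<le> \<mu> * ln U" "\<kappa> * (norm x)\<^sup>2 \<le> \<kappa> * r\<^sup>2" "ln m + 2 * ln (norm s) \<le> ln (g x s s)"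
      using \<mu> \<kappa> by (auto intro: mult_left_mono)
    then show ?thesis unfolding \<theta>_def by linarith
  qed
  define s1 :: "complex^'n" where "s1 = axis k 1"
  have s1: "s1 \<in> S" "norm s1 = 1" unfolding s1_def S_def by (auto simp: norm_axis)
  define \<rho> where "\<rho> = max 1 (exp ((\<theta> 0 s1 - ln m + \<kappa> * r\<^sup>2 + \<mu> * ln U) / 2))"
  have far: "\<theta> 0 s1 \<le> \<theta> x s" if "x \<in> K" "s \<in> S" "norm s \<ge> \<rho>" for x s
  proof -
    have "exp ((\<theta> 0 s1 - ln m + \<kappa> * r\<^sup>2 + \<mu> * ln U) / 2) \<le> norm s" using that unfolding \<rho>_def by simp
    then have "ln (exp ((\<theta> 0 s1 - ln m + \<kappa> * r\<^sup>2 + \<mu> * ln U) / 2)) \<le> ln (norm s)"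
      by (rule ln_mono) simp
    then show ?thesis using \<theta>_low[OF that(1,2)] by (simp add: field_simps)
  qed
  have "closed S" unfolding S_def by (intro closed_Collect_eq continuous_intros)
  then have C: "compact (K \<times> (S \<inter> cball 0 \<rho>))"
    by (intro compact_Times cK) (simp add: closed_Int_compact)
  have "s1 \<in> S \<inter> cball 0 \<rho>" using s1 unfolding \<rho>_def by auto
  then have Cne: "K \<times> (S \<inter> cball 0 \<rho>) \<noteq> {}" using K0 by blast
  have "continuous_on (K \<times> (S \<inter> cball 0 \<rho>)) (\<lambda>p. \<theta> (fst p) (snd p))"
  proof -
    let ?C = "K \<times> (S \<inter> cball 0 \<rho>)"
    have 1: "continuous_on ?C (\<lambda>p. g (fst p) (snd p) (snd p))"
      using continuous_on_subset[OF continuous_on_g, of ?C] KW by (auto simp: case_prod_unfold)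
    have 2: "continuous_on ?C (\<lambda>p. g (fst p) u u)"
      by (rule continuous_on_compose2[OF \<open>continuous_on K (\<lambda>x. g x u u)\<close>]) (auto intro: continuous_intros)
    have "g (fst p) (snd p) (snd p) > 0" "g (fst p) u u > 0" if "p \<in> ?C" for p
      using that KW uT by (auto intro!: pos_g simp: S_def)
    then show ?thesis unfolding \<theta>_def by (intro continuous_intros 1 2) fastforce+
  qed
  from continuous_attains_inf[OF C Cne this] obtain x0 s0 where
    0: "x0 \<in> K" "s0 \<in> S" and near: "\<And>x s. x \<in> K \<Longrightarrow> s \<in> S \<Longrightarrow> norm s \<le> \<rho> \<Longrightarrow> \<theta> x0 s0 \<le> \<theta> x s"
    by fastforce
  have minK: "\<theta> x0 s0 \<le> \<theta> x s" if "x \<in> K" "s \<in> S" for x s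
    using near[OF that] near[OF K0 s1(1)] far[OF that] s1 unfolding \<rho>_def
    by (smt (verit, best))
  have min: "\<theta> x0 s0 \<le> \<theta> x s" if xk: "x $ k = 0" and sk: "s $ k = 1" for x s
  proof -
    obtain v where v: "v \<in> V" "norm (x + v) \<le> r" using cocompact[OF xk] by blast
    obtain e where e: "(cmod e)\<^sup>2 = exp (- \<kappa> * ((norm v)\<^sup>2 + 2 * (x \<bullet> v)))"
      "\<And>y. g x y y = g (x + v) (scale_coord k e y) (scale_coord k e y)"
      using deck[OF v(1) xk] by blast
    have e0: "e \<noteq> 0" using e(1) by auto
    have xv: "x + v \<in> K" using v V[OF v(1)] xk unfolding K_def T_def by simp
    then have xvW: "x + v \<in> W" using KW by auto
    define s' where "s' = inverse e *s scale_coord k e s"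
    have s': "s' \<in> S" using sk e0 unfolding s'_def S_def scale_coord_def by simp
    have "scale_coord k e s = e *s s'" unfolding s'_def using e0 by (simp add: vector_smult_assoc)
    then have "g x s s = (cmod e)\<^sup>2 * g (x + v) s' s'" using e(2)[of s] g_smult[OF xvW, of e s'] by simp
    moreover have "s' \<noteq> 0" using s' unfolding S_def by auto
    then have "g (x + v) s' s' > 0" by (rule pos_g[OF xvW])
    ultimately have "ln (g x s s) = - \<kappa> * ((norm v)\<^sup>2 + 2 * (x \<bullet> v)) + ln (g (x + v) s' s')"
      by (simp add: e(1) ln_mult)
    moreover have "scale_coord k e u = u" using uT unfolding scale_coord_def by (simp add: vec_eq_iff)
    then have "g x u u = g (x + v) u u" using e(2)[of u] by simp
    moreover have "(norm (x + v))\<^sup>2 = (norm x)\<^sup>2 + 2 * (x \<bullet> v) + (norm v)\<^sup>2"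
      by (simp add: power2_norm_eq_inner inner_add_left inner_add_right inner_commute)
    ultimately have "\<theta> x s = \<theta> (x + v) s'" unfolding \<theta>_def by (simp add: algebra_simps)
    then show ?thesis using minK[OF xv s'] by simp
  qed
  have x0: "x0 \<in> W" "x0 $ k = 0" and s0: "s0 \<noteq> 0" "s0 $ k = 1"
    using 0 KW unfolding K_def T_def S_def by auto
  define c where "c = \<Gamma> x0 u s0 $ k"
  define \<tau> where "\<tau> = c *s s0 - \<Gamma> x0 u s0"
  have \<tau>: "\<tau> $ k = 0" unfolding \<tau>_def c_def using s0 by simp
  have "2 * \<kappa> * (norm u)\<^sup>2 + \<mu> * (- bisec x0 u u / g x0 u u) \<le> - bisec x0 u s0 / g x0 s0 s0"
  proof (rule bisec_bound_at_min[OF x0(1) s0(1) uT(2)])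
    show "\<Gamma> x0 u s0 + \<tau> = c *s s0" unfolding \<tau>_def by simp
  qed (use \<mu> min \<tau> uT s0 x0 in \<open>auto simp: \<theta>_def\<close>)
  then have b: "2 * \<kappa> + \<mu> * (- bisec x0 u u / g x0 u u) \<le> - bisec x0 u s0 / g x0 s0 s0"
    using uT by simp
  define n where "n = s0 /\<^sub>R norm s0"
  have n: "norm n = 1" "n \<noteq> 0" unfolding n_def using s0 by auto
  have sn: "s0 = norm s0 *\<^sub>R n" unfolding n_def using s0 by simp
  have "bisec x0 u s0 / g x0 s0 s0 = bisec x0 u n / g x0 n n"
    using s0 bisec_scale[OF x0(1), of u "norm s0" n] unfolding sn[symmetric]
    by (subst (2) sn, subst (3) sn) (simp add: g_simps x0 power2_eq_square)
  moreover define A where "A = - bisec x0 u u"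
  ultimately have b: "2 * \<kappa> + \<mu> * (A / g x0 u u) \<le> - bisec x0 u n / g x0 n n" using b by simp
  have A: "A \<ge> 0" unfolding A_def using bisec_self_nonpos[OF x0(1)] by simp
  have gn: "g x0 n n \<ge> m" using m(2)[OF 0(1), of n] n by simp
  have gu: "g x0 u u > 0" "g x0 u u \<le> U" using pos_g[OF x0(1) uT(2)] U 0 by auto
  have "2 * \<kappa> + \<mu> * (A / U) \<le> 2 * \<kappa> + \<mu> * (A / g x0 u u)"
    using gu A \<mu> by (simp add: frac_le mult_left_mono)
  with b have "2 * \<kappa> + \<mu> * (A / U) \<le> - bisec x0 u n / g x0 n n" by simp
  moreover have "g x0 n n > 0" using gn m by linarith
  ultimately have "(2 * \<kappa> + \<mu> * (A / U)) * g x0 n n \<le> - bisec x0 u n"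
    using pos_le_divide_eq by blast
  moreover have "m * (2 * \<kappa> + \<mu> * (A / U)) \<le> (2 * \<kappa> + \<mu> * (A / U)) * g x0 n n"
    using mult_left_mono[OF gn, of "2 * \<kappa> + \<mu> * (A / U)"] A \<mu> U \<kappa> by (simp add: mult.commute)
  ultimately have "m * (2 * \<kappa> + \<mu> * (A / U)) \<le> - bisec x0 u n" by simp
  from mult_left_mono[OF this, of "2 * Q"]
  have "2 * Q * (m * (2 * \<kappa> + \<mu> * (A / U))) \<le> - 2 * Q * bisec x0 u n"
    using Q by simp
  also have "\<dots> \<le> A - Q\<^sup>2 * bisec x0 n n"
    using mixed_curvature_bound[OF x0(1), of Q u n] Q unfolding A_def by simp
  also have "\<dots> \<le> A + Q\<^sup>2 * M"
    using mult_left_mono[OF M(2)[OF 0(1) n(1)], of "Q\<^sup>2"] by simp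
  also have "Q\<^sup>2 * M = 2 * Q * m * \<kappa>" unfolding Q_def using \<open>M > 0\<close> by (simp add: power2_eq_square)
  finally have "2 * Q * (m * (2 * \<kappa> + \<mu> * (A / U))) \<le> A + 2 * Q * m * \<kappa>" .
  moreover have "2 * Q * (m * (2 * \<kappa> + \<mu> * (A / U))) = 4 * Q * m * \<kappa> + A"
    unfolding \<mu>_def using Q m U by (simp add: field_simps)
  ultimately have "2 * (Q * m * \<kappa>) \<le> 0" by simp
  then show False using Q m \<kappa> by (simp add: mult_le_0_iff)
qed

end

section \<open>Metrics in overlapping charts\<close>

lemma curvature_cong:
  assumes W: "open W" and eq: "\<And>y. y \<in> W \<Longrightarrow> g y = h y" and x: "x \<in> W"
  shows "sectional_curvature g x u v = sectional_curvature h x u v"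
proof -
  have d: "frechet_derivative (\<lambda>y. g y a b) (at y) = frechet_derivative (\<lambda>y. h y a b) (at y)" if "y \<in> W" for a b y
    by (rule frechet_derivative_cong_open[OF W that]) (simp add: eq)
  have G: "christoffel g y = christoffel h y" if "y \<in> W" for y
    unfolding christoffel_def d[OF that] eq[OF that] ..
  have "frechet_derivative (\<lambda>y. christoffel g y a b) (at x) = frechet_derivative (\<lambda>y. christoffel h y a b) (at x)" for a b
    by (rule frechet_derivative_cong_open[OF W x]) (simp add: G)
  then show ?thesis
    unfolding sectional_curvature_def curvature_tensor_def eq[OF x] G[OF x] by simp
qed

text \<open>Between two restrictions of one map \<open>\<psi>\<close>, the change of charts is any map \<open>\<gamma>\<close> with
  \<open>\<psi> \<circ> \<gamma> = \<psi>\<close>.\<close>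

lemma frechet_derivative_inv_chart:
  assumes U: "open U" "x \<in> U" and \<gamma>: "(\<gamma> has_derivative \<gamma>') (at x)"
    and inj: "inj_on \<psi> W" and mem: "\<And>y. y \<in> U \<Longrightarrow> \<gamma> y \<in> W \<and> \<psi> (\<gamma> y) = \<psi> y"
  shows "(inv_into W \<psi> \<circ> \<psi>) x = \<gamma> x" "frechet_derivative (inv_into W \<psi> \<circ> \<psi>) (at x) = \<gamma>'"
proof -
  have eq: "(inv_into W \<psi> \<circ> \<psi>) y = \<gamma> y" if "y \<in> U" for y
    using mem[OF that] inv_into_f_f[OF inj, of "\<gamma> y"] by simp
  then show "(inv_into W \<psi> \<circ> \<psi>) x = \<gamma> x" using U(2) by blast
  have "((inv_into W \<psi> \<circ> \<psi>) has_derivative \<gamma>') (at x)"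
    using has_derivative_transform_within_open[OF \<gamma> U] eq by metis
  then show "frechet_derivative (inv_into W \<psi> \<circ> \<psi>) (at x) = \<gamma>'" using frechet_derivative_at by metis
qed

text \<open>A metric on the manifold pulls back to the union of the domains of all charts that restrict one
  map, and the pull back is invariant under the maps that do not change the value of this map.\<close>

lemma metric_pullback:
  fixes \<A> :: "(complex^'n, 'p) chart set"
  assumes G: "kaehler_metric \<A> G" and K: "nonpositive_sectional_curvature \<A> G"
    and D: "open D" and cov: "\<And>x. x \<in> D \<Longrightarrow> \<exists>W. x \<in> W \<and> W \<subseteq> D \<and> open W \<and> inj_on \<psi> W \<and> (W, \<psi>) \<in> \<A>"
  obtains g where "nonpositive_kaehler_region D g"
    "\<And>\<gamma> \<gamma>' x u. x \<in> D \<Longrightarrow> (\<gamma> has_derivative \<gamma>') (at x) \<Longrightarrow> continuous_on D \<gamma> \<Longrightarrow> \<gamma> x \<in> D \<Longrightarrow>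
      (\<And>y. y \<in> D \<Longrightarrow> \<psi> (\<gamma> y) = \<psi> y) \<Longrightarrow> g x u u = g (\<gamma> x) (\<gamma>' u) (\<gamma>' u)"
proof -
  define \<S> where "\<S> = {W. W \<subseteq> D \<and> open W \<and> inj_on \<psi> W \<and> (W, \<psi>) \<in> \<A>}"
  define ch where "ch x = (SOME W. x \<in> W \<and> W \<in> \<S>)" for x
  have ch: "x \<in> ch x" "ch x \<in> \<S>" if "x \<in> D" for x
    using someI_ex[of "\<lambda>W. x \<in> W \<and> W \<in> \<S>"] cov[OF that] unfolding ch_def \<S>_def by blast+
  define g where "g x = G (ch x, \<psi>) x" for x
  note rm = G[unfolded kaehler_metric_def, THEN conjunct1]
  note rm1 = rm[unfolded riemannian_metric_def, THEN conjunct1]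
  note rm2 = rm[unfolded riemannian_metric_def, THEN conjunct2]
  have trans: "G (W, \<psi>) x u v = G (W', \<psi>) (\<gamma> x) (\<gamma>' u) (\<gamma>' v)"
    if W: "W \<in> \<S>" "W' \<in> \<S>" "x \<in> W" "\<gamma> x \<in> W'" and \<gamma>: "(\<gamma> has_derivative \<gamma>') (at x)" "continuous_on D \<gamma>"
      "\<And>y. y \<in> D \<Longrightarrow> \<psi> (\<gamma> y) = \<psi> y" for W W' x \<gamma> \<gamma>' u v
  proof -
    have A: "(W, \<psi>) \<in> \<A>" "(W', \<psi>) \<in> \<A>" "W \<subseteq> D" "open W" "open W'" "inj_on \<psi> W'"
      using W(1,2) unfolding \<S>_def by auto
    have "continuous_on W \<gamma>" using \<gamma>(2) A(3) by (rule continuous_on_subset)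
    then have oU: "open (W \<inter> \<gamma> -` W')" using A(4,5) continuous_open_preimage by blast
    have xU: "x \<in> W \<inter> \<gamma> -` W'" using W by blast
    have "\<psi> x = \<psi> (\<gamma> x)" using \<gamma>(3) W(3) A(3) by (metis subsetD)
    then have "\<psi> x \<in> \<psi> ` W'" using W(4) by simp
    then have "let \<tau> = inv_into W' \<psi> \<circ> \<psi>; D = frechet_derivative \<tau> (at x)
         in \<forall>u v. G (W, \<psi>) x u v = G (W', \<psi>) (\<tau> x) (D u) (D v)"
      using bspec[OF bspec[OF rm2 A(1), unfolded prod.case] A(2), unfolded prod.case] W(3) by simp
    moreover have "\<gamma> y \<in> W' \<and> \<psi> (\<gamma> y) = \<psi> y" if "y \<in> W \<inter> \<gamma> -` W'" for y
      using that \<gamma>(3) A(3) by blast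
    note frechet_derivative_inv_chart[OF oU xU \<gamma>(1) A(6) this]
    ultimately show ?thesis unfolding Let_def by simp
  qed
  have gW: "g x = G (W, \<psi>) x" if "W \<in> \<S>" "x \<in> W" for W x
  proof -
    have xD: "x \<in> D" using that unfolding \<S>_def by blast
    show ?thesis unfolding g_def
      using trans[OF ch(2)[OF xD] that(1) ch(1)[OF xD], of "\<lambda>x. x" "\<lambda>x. x"] that(2)
      by (intro ext) (simp add: has_derivative_ident)
  qed
  have DU: "D = \<Union>\<S>" using ch unfolding \<S>_def by blast
  have oS: "open W" if "W \<in> \<S>" for W using that unfolding \<S>_def by blast
  have loc: "(\<forall>u v. smooth_on (\<lambda>x. G (W, \<psi>) x u v) W) \<and>
        (\<forall>x\<in>W. bilinear (G (W, \<psi>) x) \<and> (\<forall>u v. G (W, \<psi>) x u v = G (W, \<psi>) x v u) \<and>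
           (\<forall>u. u \<noteq> 0 \<longrightarrow> G (W, \<psi>) x u u > 0))"
    "(\<forall>x\<in>W. \<forall>u v. G (W, \<psi>) x (\<i> *s u) (\<i> *s v) = G (W, \<psi>) x u v)"
    "closed_2form_on W (fundamental_form (G (W, \<psi>)))"
    "\<forall>x\<in>W. \<forall>u v. u \<noteq> v \<and> independent {u, v} \<longrightarrow> sectional_curvature (G (W, \<psi>)) x u v \<le> 0" if "W \<in> \<S>" for W
  proof -
    have A: "(W, \<psi>) \<in> \<A>" using that unfolding \<S>_def by blast
    show "(\<forall>u v. smooth_on (\<lambda>x. G (W, \<psi>) x u v) W) \<and>
        (\<forall>x\<in>W. bilinear (G (W, \<psi>) x) \<and> (\<forall>u v. G (W, \<psi>) x u v = G (W, \<psi>) x v u) \<and>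
           (\<forall>u. u \<noteq> 0 \<longrightarrow> G (W, \<psi>) x u u > 0))"
      using bspec[OF rm1 A, unfolded prod.case] .
    show "\<forall>x\<in>W. \<forall>u v. G (W, \<psi>) x (\<i> *s u) (\<i> *s v) = G (W, \<psi>) x u v"
      "closed_2form_on W (fundamental_form (G (W, \<psi>)))"
      using bspec[OF G[unfolded kaehler_metric_def, THEN conjunct2] A, unfolded prod.case] by simp_all
    show "\<forall>x\<in>W. \<forall>u v. u \<noteq> v \<and> independent {u, v} \<longrightarrow> sectional_curvature (G (W, \<psi>)) x u v \<le> 0"
      using bspec[OF K[unfolded nonpositive_sectional_curvature_def] A, unfolded prod.case] .
  qed
  have "nonpositive_kaehler_region D g"
  proof
    show "open D" by (rule D)
    show "smooth_on (\<lambda>x. g x u v) D" for u v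
      unfolding DU
    proof (rule smooth_on_Union[OF oS])
      fix W assume W: "W \<in> \<S>"
      show "smooth_on (\<lambda>x. g x u v) W"
        using smooth_on_cong[OF oS[OF W], of "\<lambda>x. g x u v" "\<lambda>x. G (W, \<psi>) x u v"] gW[OF W] loc(1)[OF W] by simp
    qed
    show "closed_2form_on D (fundamental_form g)"
      unfolding closed_2form_on_def
    proof (intro ballI allI)
      fix x u v w assume "x \<in> D"
      then obtain W where W: "W \<in> \<S>" "x \<in> W" using DU by blast
      have "frechet_derivative (\<lambda>y. fundamental_form g y a b) (at x) =
          frechet_derivative (\<lambda>y. fundamental_form (G (W, \<psi>)) y a b) (at x)" for a b
        by (rule frechet_derivative_cong_open[OF oS[OF W(1)] W(2)]) (simp add: fundamental_form_def gW[OF W(1)])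
      then show "frechet_derivative (\<lambda>y. fundamental_form g y v w) (at x) u
        - frechet_derivative (\<lambda>y. fundamental_form g y u w) (at x) v
        + frechet_derivative (\<lambda>y. fundamental_form g y u v) (at x) w = 0"
        using loc(3)[OF W(1)] W(2) unfolding closed_2form_on_def by simp
    qed
    fix x assume "x \<in> D"
    then obtain W where W: "W \<in> \<S>" "x \<in> W" using DU by blast
    note l = loc[OF W(1)] and e = gW[OF W]
    show "bilinear (g x)" unfolding e using l(1) W(2) by blast
    show "g x u v = g x v u" for u v unfolding e using l(1) W(2) by blast
    show "g x u u > 0" if "u \<noteq> 0" for u unfolding e using l(1) W(2) that by blast
    show "g x (\<i> *s u) (\<i> *s v) = g x u v" for u v unfolding e using l(2) W(2) by blast
    show "sectional_curvature g x u v \<le> 0" if "u \<noteq> v" "independent {u, v}" for u v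
      using curvature_cong[OF oS[OF W(1)] gW[OF W(1)] W(2)] l(4) W(2) that by simp
  qed
  moreover have "g x u u = g (\<gamma> x) (\<gamma>' u) (\<gamma>' u)"
    if "x \<in> D" "(\<gamma> has_derivative \<gamma>') (at x)" "continuous_on D \<gamma>" "\<gamma> x \<in> D" "\<And>y. y \<in> D \<Longrightarrow> \<psi> (\<gamma> y) = \<psi> y"
    for \<gamma> \<gamma>' x u
    unfolding g_def using trans[OF ch(2)[OF that(1)] ch(2)[OF that(4)] ch(1)[OF that(1)] ch(1)[OF that(4)] that(2,3,5)] by blast
  ultimately show ?thesis by (rule that)
qed

section \<open>The cusp neighbourhoods of the compactification\<close>

lemma norm_pair: "(norm (pair a w))\<^sup>2 = (cmod a)\<^sup>2 + (norm w)\<^sup>2"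
  unfolding norm_vec_def L2_set_def by (simp add: sum_nonneg sum_UNIV_option pair_def)

lemma inner_pair: "pair 0 w \<bullet> x = w \<bullet> tail x"
  unfolding inner_vec_def by (simp add: sum_UNIV_option pair_def tail_def)

lemma linear_tail: "bounded_linear tail"
  by (intro linear_conv_bounded_linear[THEN iffD1] linearI) (simp_all add: tail_def vec_eq_iff)

lemma linear_pair0: "bounded_linear (pair 0)"
  by (intro linear_conv_bounded_linear[THEN iffD1] linearI) (simp_all add: Cn_eq_iff tail_def vec_eq_iff pair_def)

lemma pair_add: "pair a w = a *s axis None 1 + pair 0 w"
  by (simp add: Cn_eq_iff) (simp add: tail_def vec_eq_iff axis_def pair_def)

text \<open>The action of a Heisenberg translation in the coordinates \<open>(b, w)\<close>.\<close>

definition deck_factor :: "real \<Rightarrow> real \<Rightarrow> complex^'m \<Rightarrow> complex^'m \<Rightarrow> complex" where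
  "deck_factor l s v w = exp (of_real (2 * pi / l) * (- of_real ((norm v)\<^sup>2 / 2) - \<i> * of_real s - std_herm v w))"

definition deck_map :: "real \<Rightarrow> real \<Rightarrow> complex^'m \<Rightarrow> 'm::finite Cn \<Rightarrow> 'm Cn" where
  "deck_map l s v z = pair (deck_factor l s v (tail z) * z $ None) (tail z + v)"

lemma has_derivative_deck_map:
  assumes x: "x $ None = 0"
  shows "(deck_map l s v has_derivative scale_coord None (deck_factor l s v (tail x))) (at x)"
proof -
  have t: "(tail has_derivative tail) (at x)" by (rule bounded_linear.has_derivative[OF linear_tail has_derivative_ident])
  have "linear (std_herm v)" by (intro linearI) (simp_all add: std_herm_def algebra_simps sum.distrib scaleR_sum_right)
  then have bl: "bounded_linear (std_herm v)" by (rule linear_conv_bounded_linear[THEN iffD1])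
  let ?E = "\<lambda>x. of_real (2 * pi / l) * (- of_real ((norm v)\<^sup>2 / 2) - \<i> * of_real s - std_herm v (tail x)) :: complex"
  have "(?E has_derivative (\<lambda>h. of_real (2 * pi / l) * (0 - 0 - std_herm v (tail h)))) (at x)"
    by (intro has_derivative_mult_right has_derivative_diff has_derivative_const bounded_linear.has_derivative[OF bl] t)
  from has_derivative_compose[OF this, of exp "\<lambda>h. exp (?E x) * h"]
  have "((\<lambda>z. deck_factor l s v (tail z)) has_derivative
      (\<lambda>h. exp (?E x) * (of_real (2 * pi / l) * (0 - 0 - std_herm v (tail h))))) (at x)"
    unfolding deck_factor_def using DERIV_exp unfolding has_field_derivative_def by blast
  moreover have n: "((\<lambda>z :: 'a Cn. z $ None) has_derivative (\<lambda>h. h $ None)) (at x)"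
    by (intro bounded_linear.has_derivative[OF bounded_linear_vec_nth] has_derivative_ident)
  ultimately have "((\<lambda>z. deck_factor l s v (tail z) * z $ None) has_derivative
      (\<lambda>h. deck_factor l s v (tail x) * h $ None +
        exp (?E x) * (of_real (2 * pi / l) * (0 - 0 - std_herm v (tail h))) * x $ None)) (at x)"
    by (rule has_derivative_mult)
  then have 1: "((\<lambda>z. deck_factor l s v (tail z) * z $ None) has_derivative (\<lambda>h. deck_factor l s v (tail x) * h $ None)) (at x)"
    using x by simp
  have "linear (\<lambda>a. a *s (axis None 1 :: 'a Cn))"
    by (intro linearI) (simp_all add: vec_eq_iff algebra_simps)
  then have ax: "bounded_linear (\<lambda>a. a *s (axis None 1 :: 'a Cn))" by (rule linear_conv_bounded_linear[THEN iffD1])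
  have D1: "((\<lambda>z. (deck_factor l s v (tail z) * z $ None) *s axis None 1 + pair 0 (tail z + v)) has_derivative
     (\<lambda>h. (deck_factor l s v (tail x) * h $ None) *s axis None 1 + pair 0 (tail h + 0))) (at x)"
    by (intro has_derivative_add bounded_linear.has_derivative[OF ax 1] bounded_linear.has_derivative[OF linear_pair0] t has_derivative_const)
  have D2: "scale_coord None (deck_factor l s v (tail x)) =
      (\<lambda>h. (deck_factor l s v (tail x) * h $ None) *s axis None 1 + pair 0 (tail h + 0))"
    by (rule ext) (simp add: pair_add[symmetric] Cn_eq_iff, simp add: scale_coord_def tail_def vec_eq_iff)
  show ?thesis unfolding deck_map_def pair_add[of "deck_factor _ _ _ _ * _"] D2 by (rule D1)
qed

lemma continuous_on_deck_map: "continuous_on S (deck_map l s v)"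
proof -
  have t: "continuous_on S tail" using linear_continuous_on[OF linear_tail] .
  have "linear (\<lambda>a. a *s (axis None 1 :: 'a Cn))"
    by (intro linearI) (simp_all add: vec_eq_iff algebra_simps)
  then have ax: "bounded_linear (\<lambda>a. a *s (axis None 1 :: 'a Cn))" by (rule linear_conv_bounded_linear[THEN iffD1])
  have h: "continuous_on S (\<lambda>z. std_herm v (tail z))"
    unfolding std_herm_def by (intro continuous_intros t)
  show ?thesis
    unfolding deck_map_def deck_factor_def pair_add[of "exp _ * _"]
    by (intro continuous_intros bounded_linear.continuous_on[OF ax] bounded_linear.continuous_on[OF linear_pair0] t h)
qed

context cusped_lattice
begin

text \<open>On the disk domain, two points have the same image under \<open>cusp_param\<close> only if a deck map in the
  lattice of the cusp relates them. By discreteness of the translation parts, \<open>cusp_param\<close> is then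
  injective on small open sets, which provide charts around every point of the hyperplane \<open>b = 0\<close>.\<close>

theorem no_nonpositive_kaehler_metric:
  assumes A: "A \<in> C"
    and G: "kaehler_metric (toroidal_compactification \<Gamma> C c) G"
    and K: "nonpositive_sectional_curvature (toroidal_compactification \<Gamma> C c) G"
  shows False
proof -
  let ?P = "frame_group \<Gamma> A"
  interpret E: cusp_end ?P "c A" by (rule cusp_end_frame[OF A])
  have cg: "cusp_group \<Gamma> A = E.\<Lambda>" by (rule cusp_group_eq[OF A])
  define l where "l = central_period \<Gamma> A"
  have lp: "l = E.period" unfolding l_def central_period_def E.period_def cg ..
  have l: "l > 0" unfolding lp by (rule E.period(1))
  have central: "(s, 0) \<in> E.\<Lambda> \<longleftrightarrow> (\<exists>k::int. s = of_int k * l)" for s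
    using E.period(2) unfolding lp by auto
  define D where "D = disk_domain \<Gamma> A (c A)"
  have D_iff: "z \<in> D \<longleftrightarrow> cmod (z $ None) < exp (- 2 * pi * c A / l) * exp (- pi * (norm (tail z))\<^sup>2 / l)" for z
    unfolding D_def disk_domain_def l_def by (simp add: Let_def)
  have ct: "continuous_on UNIV tail" by (rule linear_continuous_on[OF linear_tail])
  have oD: "open D"
  proof -
    have "D = {z. cmod (z $ None) < exp (- 2 * pi * c A / l) * exp (- pi * (norm (tail z))\<^sup>2 / l)}" using D_iff by blast
    then show ?thesis using l by (simp only:) (intro open_Collect_less continuous_intros ct, simp)
  qed
  have D0: "z \<in> D" if "z $ None = 0" for z unfolding D_iff using that by simp
  define \<sigma> :: "'m Cn \<Rightarrow> 'm Cn" where "\<sigma> z = pair (of_real (l / (2 * pi)) * Ln (z $ None)) (tail z)" for z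
  have \<sigma>_exp: "exp (of_real (2 * pi / l) * \<sigma> z $ None) = z $ None" if "z $ None \<noteq> 0" for z
  proof -
    have "complex_of_real (2 * pi / l) * (of_real (l / (2 * pi)) * Ln (z $ None)) = Ln (z $ None)"
      using l by simp
    then show ?thesis unfolding \<sigma>_def using exp_Ln[OF that] by simp
  qed
  have \<sigma>_H: "\<sigma> z \<in> horoset (c A)" if z: "z \<in> D" "z $ None \<noteq> 0" for z
  proof -
    have "ln (cmod (z $ None)) < ln (exp (- 2 * pi * c A / l) * exp (- pi * (norm (tail z))\<^sup>2 / l))"
      using z unfolding D_iff by (intro ln_strict_mono) auto
    then have "ln (cmod (z $ None)) < - 2 * pi * c A / l + - pi * (norm (tail z))\<^sup>2 / l"
      by (simp only: exp_add[symmetric] ln_exp)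
    then have "l / (2 * pi) * ln (cmod (z $ None)) < l / (2 * pi) * (- 2 * pi * c A / l + - pi * (norm (tail z))\<^sup>2 / l)"
      using l by (intro mult_strict_left_mono) auto
    also have "\<dots> = - (norm (tail z))\<^sup>2 / 2 - c A" using l by (simp add: field_simps)
    finally show ?thesis unfolding \<sigma>_def horoset_def using z(2) by (simp add: Re_Ln)
  qed
  have param: "cusp_param \<Gamma> A z = (if z $ None = 0 then Inr (A, torus_pt \<Gamma> A (tail z)) else Inl (orbit \<Gamma> (frame_pt A (\<sigma> z))))" for z
    unfolding cusp_param_def \<sigma>_def l_def by simp
  \<comment> \<open>Under \<open>b = exp (2 \<pi> a / l)\<close>, the Heisenberg translations become the deck maps.\<close>
  have heis_exp: "exp (of_real (2 * pi / l) * heis s v y $ None) =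
      deck_factor l s v (tail y) * exp (of_real (2 * pi / l) * y $ None)" for s v y
  proof -
    have "heis s v y $ None = (- of_real ((norm v)\<^sup>2 / 2) - \<i> * of_real s - std_herm v (tail y)) + y $ None"
      unfolding heis_def by simp
    then show ?thesis unfolding deck_factor_def by (simp only: distrib_left exp_add)
  qed
  have deck_None: "deck_map l s v z $ None = 0 \<longleftrightarrow> z $ None = 0" for s v z
    unfolding deck_map_def deck_factor_def by simp
  have \<Lambda>_P: "(s, v) \<in> E.\<Lambda> \<longleftrightarrow> hmat s v \<in> ?P" for s v unfolding E.\<Lambda>_def by simp
  have torus_eq: "torus_pt \<Gamma> A w = {w + v |s v. (s, v) \<in> E.\<Lambda>}" for w
    unfolding torus_pt_def cg by force
  have deck_param: "cusp_param \<Gamma> A (deck_map l s v z) = cusp_param \<Gamma> A z" if sv: "(s, v) \<in> E.\<Lambda>" for s v z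
  proof (cases "z $ None = 0")
    case True
    have "torus_pt \<Gamma> A (tail z + v) = torus_pt \<Gamma> A (tail z)"
    proof
      show "torus_pt \<Gamma> A (tail z + v) \<subseteq> torus_pt \<Gamma> A (tail z)"
        unfolding torus_eq using E.\<Lambda>_mult[OF sv] by (fastforce simp: add.assoc)
      have "tail z + v' = (tail z + v) + (- v + v')" for v' by simp
      then show "torus_pt \<Gamma> A (tail z) \<subseteq> torus_pt \<Gamma> A (tail z + v)"
        unfolding torus_eq using E.\<Lambda>_mult[OF E.\<Lambda>_inv[OF sv]] by fast
    qed
    moreover have "tail (deck_map l s v z) = tail z + v" unfolding deck_map_def by simp
    ultimately show ?thesis unfolding param deck_None using True by simp
  next
    case False
    let ?y = "heis s v (\<sigma> z)" and ?y' = "\<sigma> (deck_map l s v z)"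
    have t: "tail ?y = tail ?y'" unfolding heis_def \<sigma>_def deck_map_def by simp
    have "exp (of_real (2 * pi / l) * ?y' $ None) = deck_factor l s v (tail z) * z $ None"
      using \<sigma>_exp[of "deck_map l s v z"] False unfolding deck_None by (simp add: deck_map_def)
    also have "\<dots> = exp (of_real (2 * pi / l) * ?y $ None)"
      unfolding heis_exp \<sigma>_exp[OF False] by (simp add: \<sigma>_def)
    finally obtain n :: int where n: "of_real (2 * pi / l) * ?y' $ None =
        of_real (2 * pi / l) * ?y $ None + of_int (2 * n) * (of_real pi * \<i>)"
      unfolding exp_eq by (auto simp: mult_ac)
    have "?y' $ None = of_real (l / (2 * pi)) * (of_real (2 * pi / l) * ?y' $ None)" using l by simp
    also have "\<dots> = ?y $ None - \<i> * of_real (of_int (- n) * l)"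
      unfolding n using l by (simp add: field_simps)
    finally have "?y' = heis (of_int (- n) * l) 0 ?y" unfolding heis_def[of "of_int (- n) * l"] Cn_eq_iff using t by simp
    then have y': "lift ?y' = (hmat (of_int (- n) * l) 0 ** hmat s v) *v lift (\<sigma> z)"
      by (simp add: hmat_lift flip: matrix_vector_mul_assoc)
    have "(of_int (- n) * l, 0) \<in> E.\<Lambda>" unfolding central by blast
    then have "hmat (of_int (- n) * l) 0 ** hmat s v \<in> ?P" using E.P_mult sv unfolding \<Lambda>_P by blast
    moreover have "(hmat (of_int (- n) * l) 0 ** hmat s v) *v lift (\<sigma> z) = 1 *s lift ?y'" unfolding y' by simp
    ultimately have "orbit \<Gamma> (frame_pt A (\<sigma> z)) = orbit \<Gamma> (frame_pt A ?y')"
      unfolding orbit_frame_eq_iff[OF A] using zero_neq_one by metis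
    then show ?thesis unfolding param deck_None using False by simp
  qed
  have param_eqD: "\<exists>s v. (s, v) \<in> E.\<Lambda> \<and> z' = deck_map l s v z"
    if z: "z \<in> D" "z' \<in> D" and eq: "cusp_param \<Gamma> A z = cusp_param \<Gamma> A z'" for z z'
  proof (cases "z $ None = 0")
    case True
    then have z'0: "z' $ None = 0" and t: "torus_pt \<Gamma> A (tail z) = torus_pt \<Gamma> A (tail z')"
      using eq unfolding param by (auto split: if_splits)
    have "tail z' \<in> torus_pt \<Gamma> A (tail z')" unfolding torus_eq using E.\<Lambda>_0 by force
    then have "tail z' \<in> torus_pt \<Gamma> A (tail z)" unfolding t .
    then obtain s v where sv: "(s, v) \<in> E.\<Lambda>" "tail z' = tail z + v" unfolding torus_eq by blast
    then have "z' = deck_map l s v z" unfolding deck_map_def Cn_eq_iff using True z'0 by simp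
    then show ?thesis using sv by blast
  next
    case False
    then have z'0: "z' $ None \<noteq> 0" and o: "orbit \<Gamma> (frame_pt A (\<sigma> z)) = orbit \<Gamma> (frame_pt A (\<sigma> z'))"
      using eq unfolding param by (auto split: if_splits)
    obtain N a where N: "N \<in> ?P" "N *v lift (\<sigma> z) = a *s lift (\<sigma> z')"
      using o unfolding orbit_frame_eq_iff[OF A] by blast
    obtain \<mu> where "N *v f1 = \<mu> *s f1"
      using E.precisely_invariant[OF N(1) \<sigma>_H[OF z(1) False] \<sigma>_H[OF z(2) z'0] N(2)] by blast
    then obtain d s v where d: "cmod d = 1" "mat d ** N = hmat s v" "hmat s v \<in> ?P"
      by (rule E.stabiliser_translations[OF N(1)])
    have "(d * a) *s lift (\<sigma> z') = lift (heis s v (\<sigma> z))"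
      unfolding hmat_lift[symmetric] d(2)[symmetric] using N(2)
      by (simp add: mat_vector vector_smult_assoc flip: matrix_vector_mul_assoc)
    then have y: "\<sigma> z' = heis s v (\<sigma> z)" using lift_inj by blast
    have "tail z' = tail z + v" using arg_cong[OF y, of tail] unfolding heis_def by (simp add: \<sigma>_def)
    moreover have "z' $ None = deck_factor l s v (tail z) * z $ None"
      using \<sigma>_exp[OF z'0] unfolding y heis_exp \<sigma>_exp[OF False] by (simp add: \<sigma>_def)
    ultimately have "z' = deck_map l s v z" unfolding deck_map_def Cn_eq_iff by simp
    then show ?thesis using d(3) \<Lambda>_P by blast
  qed
  obtain e where e: "e > 0" "\<And>s v. (s, v) \<in> E.\<Lambda> \<Longrightarrow> norm v < e \<Longrightarrow> v = 0"
    using E.translation_parts_discrete by blast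
  have charts: "\<exists>W. x \<in> W \<and> W \<subseteq> D \<and> open W \<and> inj_on (cusp_param \<Gamma> A) W \<and>
      (W, cusp_param \<Gamma> A) \<in> toroidal_compactification \<Gamma> C c" if x: "x \<in> D" for x
  proof -
    define W where "W = D \<inter> {z. norm (tail z - tail x) < e / 2}"
    have oW: "open W" unfolding W_def by (intro open_Int oD open_Collect_less continuous_intros ct)
    have inj: "inj_on (cusp_param \<Gamma> A) W"
    proof (rule inj_onI)
      fix z z' assume z: "z \<in> W" "z' \<in> W" "cusp_param \<Gamma> A z = cusp_param \<Gamma> A z'"
      then obtain s v where sv: "(s, v) \<in> E.\<Lambda>" "z' = deck_map l s v z" using param_eqD unfolding W_def by blast
      have "v = (tail z' - tail x) - (tail z - tail x)" unfolding sv(2) deck_map_def by simp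
      then have "norm v < e" using norm_triangle_ineq4[of "tail z' - tail x" "tail z - tail x"] z unfolding W_def by auto
      then have v: "v = 0" using e(2) sv(1) by blast
      then obtain k :: int where k: "s = of_int k * l" using sv(1) central by blast
      have "deck_factor l s v (tail z) = exp (- (of_int (2 * k) * of_real pi * \<i>))"
        unfolding deck_factor_def v k using l by (simp add: mult_ac)
      also have "\<dots> = 1" unfolding exp_minus by (simp add: exp_eq_1 mult_ac)
      finally have "z' = z" unfolding sv(2) deck_map_def v by simp
      then show "z = z'" by simp
    qed
    have "(W, cusp_param \<Gamma> A) \<in> toroidal_compactification \<Gamma> C c"
      unfolding toroidal_compactification_def using A oW inj unfolding W_def D_def by blast
    then show ?thesis using oW inj x e(1) unfolding W_def by (intro exI[of _ W]) (auto simp: W_def)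
  qed
  obtain g where g: "nonpositive_kaehler_region D g"
    "\<And>\<gamma> \<gamma>' x u. x \<in> D \<Longrightarrow> (\<gamma> has_derivative \<gamma>') (at x) \<Longrightarrow> continuous_on D \<gamma> \<Longrightarrow> \<gamma> x \<in> D \<Longrightarrow>
      (\<And>y. y \<in> D \<Longrightarrow> cusp_param \<Gamma> A (\<gamma> y) = cusp_param \<Gamma> A y) \<Longrightarrow> g x u u = g (\<gamma> x) (\<gamma>' u) (\<gamma>' u)"
    using metric_pullback[OF G K oD charts] by blast
  interpret N: nonpositive_kaehler_region D g by (rule g(1))
  obtain r where r: "\<And>w. \<exists>(s, v)\<in>E.\<Lambda>. norm (w + v) \<le> r" using E.translations_cocompact by blast
  define V where "V = {pair 0 v |s v. (s, v) \<in> E.\<Lambda>}"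
  show False
  proof (rule N.no_theta_periodic_metric[where k = None and i = "Some undefined" and V = V and r = r and \<kappa> = "2 * pi / l"])
    show "Some undefined \<noteq> None" by simp
    show "{x. x $ None = 0} \<subseteq> D" using D0 by blast
    show "2 * pi / l > 0" using l by simp
    show "v $ None = 0" if "v \<in> V" for v using that unfolding V_def by auto
    show "\<exists>f. (cmod f)\<^sup>2 = exp (- (2 * pi / l) * ((norm v)\<^sup>2 + 2 * (x \<bullet> v))) \<and>
            (\<forall>y. g x y y = g (x + v) (scale_coord None f y) (scale_coord None f y))"
      if v: "v \<in> V" and x: "x $ None = 0" for v x
    proof -
      obtain s w where w: "v = pair 0 w" "(s, w) \<in> E.\<Lambda>" using v unfolding V_def by blast
      have nv: "(norm v)\<^sup>2 = (norm w)\<^sup>2" "x \<bullet> v = w \<bullet> tail x"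
        unfolding w(1) norm_pair using inner_pair[of w x] by (simp_all add: inner_commute)
      have xv: "deck_map l s w x = x + v"
        unfolding deck_map_def w(1) Cn_eq_iff using x by (simp add: tail_def vec_eq_iff pair_def)
      have "cmod (deck_factor l s w (tail x)) = exp (2 * pi / l * (- (norm w)\<^sup>2 / 2 - w \<bullet> tail x))"
        unfolding deck_factor_def norm_exp_eq_Re by (simp add: Re_std_herm del: of_real_power)
      then have "(cmod (deck_factor l s w (tail x)))\<^sup>2 = exp (2 * (2 * pi / l * (- (norm w)\<^sup>2 / 2 - w \<bullet> tail x)))"
        by (simp only: exp_double)
      also have "2 * (2 * pi / l * (- (norm w)\<^sup>2 / 2 - w \<bullet> tail x)) = - (2 * pi / l) * ((norm v)\<^sup>2 + 2 * (x \<bullet> v))"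
        unfolding nv using l by (simp add: field_simps)
      finally have "(cmod (deck_factor l s w (tail x)))\<^sup>2 = exp (- (2 * pi / l) * ((norm v)\<^sup>2 + 2 * (x \<bullet> v)))" .
      moreover have "g x y y = g (x + v) (scale_coord None (deck_factor l s w (tail x)) y) (scale_coord None (deck_factor l s w (tail x)) y)" for y
      proof -
        have "x + v \<in> D" using D0 x w(1) by (simp add: pair_def)
        then show ?thesis
          using g(2)[of x "deck_map l s w" "scale_coord None (deck_factor l s w (tail x))" y,
              OF D0[OF x] has_derivative_deck_map[OF x] continuous_on_deck_map _ deck_param[OF w(2)]]
          unfolding xv by blast
      qed
      ultimately show ?thesis by blast
    qed
    show "\<exists>v\<in>V. norm (x + v) \<le> r" if x: "x $ None = 0" for x
    proof -
      obtain s v where v: "(s, v) \<in> E.\<Lambda>" "norm (tail x + v) \<le> r" using r[of "tail x"] by blast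
      have "x + pair 0 v = pair 0 (tail x + v)"
        unfolding Cn_eq_iff using x by (simp add: tail_def vec_eq_iff pair_def)
      moreover have "norm (pair 0 w) = norm w" for w :: "complex^'m"
        using norm_pair[of 0 w] by simp
      ultimately have "norm (x + pair 0 v) \<le> r" using v(2) by simp
      then show ?thesis unfolding V_def using v(1) by blast
    qed
  qed
qed

end

theorem theorem1:
  fixes \<Gamma> :: "'m::finite pu set"
    and C :: "'m mat_n1 set"
    and c :: "'m mat_n1 \<Rightarrow> real"
  assumes "CARD('m option) \<ge> 2"
    and "nonuniform_lattice \<Gamma>"
    and "torsion_free \<Gamma>"
    and "admits_toroidal_compactification \<Gamma>"
    and "cusp_decomposition \<Gamma> C c"
  shows "\<not> (\<exists>G. kaehler_metric (toroidal_compactification \<Gamma> C c) G \<and>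
                 nonpositive_sectional_curvature (toroidal_compactification \<Gamma> C c) G)"
proof
  assume "\<exists>G. kaehler_metric (toroidal_compactification \<Gamma> C c) G \<and>
                 nonpositive_sectional_curvature (toroidal_compactification \<Gamma> C c) G"
  then obtain G where G: "kaehler_metric (toroidal_compactification \<Gamma> C c) G"
      "nonpositive_sectional_curvature (toroidal_compactification \<Gamma> C c) G" by blast
  interpret cusped_lattice \<Gamma> C c using assms by unfold_locales
  obtain A where "A \<in> C" using C_nonempty by blast
  then show False using no_nonpositive_kaehler_metric G by blast
qed

end
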